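(* Let $\alpha\ge0$ and $\mu_\alpha(z)=|z-1|^{2\alpha}$. For any $p\in(1,\infty)$ and $q$ with $\frac1p+\frac1q=1$, the dual space of $\mathcal{H}^p(\mathbb{T},|z-1|^{\alpha p})$ can be identified with $\mathcal{H}^q(\mathbb{T},|z-1|^{\alpha q})$ under the pairing $\langle f,h\rangle=\int_{\mathbb{T}}f(z)\overline{h(z)}|z-1|^{2\alpha}d\theta$; that is, every $h\in\mathcal{H}^q(\mathbb{T},|z-1|^{\alpha q})$ defines a bounded linear functional $f\mapsto\langle f,h\rangle$ on $\mathcal{H}^p(\mathbb{T},|z-1|^{\alpha p})$, and every bounded linear functional on $\mathcal{H}^p(\mathbb{T},|z-1|^{\alpha p})$ is of this form for some $h\in\mathcal{H}^q(\mathbb{T},|z-1|^{\alpha q})$.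
   Context: $\mathbb{D}$ is the unit disc, $\mathbb{T}$ the unit circle with measure $d\theta$. For $1\le p<\infty$ and $\beta\ge0$, $\mathcal{H}^p(\mathbb{T},|z-1|^\beta)$ is the space of holomorphic $f$ on $\mathbb{D}$ with $\sup_{0\le r<1}\int_0^{2\pi}|f(re^{i\theta})|^p|re^{i\theta}-1|^{\beta}d\theta<\infty$, identified with its a.e. boundary values on $\mathbb{T}$, with norm $\left(\int_{\mathbb{T}}|f|^p|z-1|^\beta d\theta\right)^{1/p}$. *)

theory Defs
  imports "HOL-Complex_Analysis.Complex_Analysis"
begin

definition wHardy :: "real \<Rightarrow> real \<Rightarrow> (complex \<Rightarrow> complex) set" where
  "wHardy p \<beta> = {f. f holomorphic_on ball 0 1 \<and>
     bdd_above ((\<lambda>r. LINT \<theta>:{0..2*pi}|lborel.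
        norm (f (complex_of_real r * cis \<theta>)) powr p *
        norm (complex_of_real r * cis \<theta> - 1) powr \<beta>) ` {0..<1})}"

text \<open>Boundary value (radial limit) of f at the point cis theta of the unit circle;
  it exists for almost every theta when f is in a weighted Hardy space.\<close>
definition bval :: "(complex \<Rightarrow> complex) \<Rightarrow> real \<Rightarrow> complex" where
  "bval f \<theta> = Lim (at_left 1) (\<lambda>r::real. f (complex_of_real r * cis \<theta>))"

definition wHardy_norm :: "real \<Rightarrow> real \<Rightarrow> (complex \<Rightarrow> complex) \<Rightarrow> real" where
  "wHardy_norm p \<beta> f = (LINT \<theta>:{0..2*pi}|lborel.
      norm (bval f \<theta>) powr p * norm (cis \<theta> - 1) powr \<beta>) powr (1/p)"

definition pairing :: "real \<Rightarrow> (complex \<Rightarrow> complex) \<Rightarrow> (complex \<Rightarrow> complex) \<Rightarrow> complex" where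
  "pairing \<alpha> f h = (LINT \<theta>:{0..2*pi}|lborel.
      bval f \<theta> * cnj (bval h \<theta>) * complex_of_real (norm (cis \<theta> - 1) powr (2*\<alpha>)))"

definition bounded_linear_functional_on ::
    "real \<Rightarrow> real \<Rightarrow> ((complex \<Rightarrow> complex) \<Rightarrow> complex) \<Rightarrow> bool" where
  "bounded_linear_functional_on p \<beta> L \<longleftrightarrow>
     (\<forall>f\<in>wHardy p \<beta>. \<forall>g\<in>wHardy p \<beta>. \<forall>a b.
         L (\<lambda>z. a * f z + b * g z) = a * L f + b * L g) \<and>
     (\<exists>C. \<forall>f\<in>wHardy p \<beta>. norm (L f) \<le> C * wHardy_norm p \<beta> f)"

end

theory Submission
  imports Defs
begin

text \<open>
  Multiplication by a branch of \<open>(1 - z)\<^sup>\<alpha>\<close> maps the weighted Hardy spaces isometrically onto the unweighted ones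
  and turns the pairing into \<open>\<integral> F \<cdot> cnj H d\<theta>\<close>, so only the unweighted duality matters.

  \<^item> Boundary values. Integral means of \<open>\<bar>f\<bar>\<^sup>p\<close> increase with the radius, and uniform convexity of \<open>L\<^sup>p\<close> then makes the
  slices \<open>f\<^sub>r(\<theta>) = f(r e\<^sup>i\<^sup>\<theta>)\<close> Cauchy in \<open>L\<^sup>p\<close> as \<open>r \<rightarrow> 1\<close>. With the weak type bound of the radial maximal function (Vitali
  covering) radial limits exist almost everywhere, and \<open>f\<^sub>r\<close> tends to them in \<open>L\<^sup>p\<close>. Hoelder's inequality bounds the pairing.

  \<^item> Representation. For a bounded functional \<open>\<Lambda>\<close> put \<open>h(w) = (2\<pi>)\<^sup>-\<^sup>1 \<Sum> cnj(\<Lambda>(z\<^sup>n)) w\<^sup>n\<close>. If \<open>G\<close> is the Cauchy integral of a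
  continuous \<open>g\<close>, then \<open>\<integral> g \<cdot> cnj h\<^sub>s d\<theta> = \<Lambda>(G\<^sub>s)\<close>. Taking \<open>g = \<bar>h\<^sub>s\<bar>\<^sup>q\<^sup>-\<^sup>2 h\<^sub>s\<close>, M. Riesz's theorem \<open>\<parallel>G\<^sub>s\<parallel>\<^sub>p \<le> A \<parallel>g\<parallel>\<^sub>p\<close> bounds
  \<open>\<parallel>h\<^sub>s\<parallel>\<^sub>q\<close>, so \<open>h\<close> is in the Hardy space; taking \<open>g = f\<^sub>r\<close>, \<open>s = r \<rightarrow> 1\<close> identifies \<open>\<Lambda>\<close>. No extension of \<open>\<Lambda>\<close> to \<open>L\<^sup>p\<close> is needed.
\<close>

subsection \<open>Cauchy and Poisson integrals on the circle\<close>

text \<open>Membership in the spaces is decided on circles of radius below 1, while the norm, the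
  pairing and the boundedness of a functional see only radial limits. Mean convergence of the slices
  joins the two: it makes a functional continuous along dilations and identifies the limit of the
  pairings of slices. The test function used to bound h on the circle of radius s is the equality
  case of Hoelder's inequality, so pairing it with h returns the q-th power mean of h itself. It is
  not holomorphic, so the functional cannot be applied to it. Its Cauchy integral keeps exactly the
  nonnegative frequencies, the only ones that a power series h can see, and Riesz's theorem controls
  the price of this replacement. Dilating by s < 1 makes the Taylor coefficients absolutely
  summable, so the functional may be evaluated term by term. Riesz's theorem rests on the harmonic
  function Re(w^p) in the right half plane, which gives exponents up to 2; larger exponents follow
  because the projection is its own adjoint.\<close>

lemma Cauchy_circle:
  fixes f :: "complex \<Rightarrow> complex"
  assumes "continuous_on (cball 0 1) f" "f holomorphic_on ball 0 1" "norm w < 1"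
  shows "((\<lambda>t. f (cis t) / (1 - w * cis (-t))) has_integral 2 * pi * f w) {0..2*pi}"
proof -
  have "((\<lambda>u. f u / (u - w)) has_contour_integral (2 * of_real pi * \<i> * f w)) (circlepath 0 1)"
    using Cauchy_integral_circlepath[of 0 1 f w] assms by simp
  then have "((\<lambda>t. f (cis t) / (cis t - w) * \<i> * cis t) has_integral 2 * of_real pi * \<i> * f w) {0..2*pi}"
    unfolding circlepath_def by (subst (asm) has_contour_integral_part_circlepath_iff) auto
  then have "((\<lambda>t. (-\<i>) * (f (cis t) / (cis t - w) * \<i> * cis t)) has_integral (-\<i>) * (2 * of_real pi * \<i> * f w)) {0..2*pi}"
    by (rule has_integral_mult_right)
  moreover have "(-\<i>) * (f (cis t) / (cis t - w) * \<i> * cis t) = f (cis t) / (1 - w * cis (-t))" for t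
  proof -
    have "cis t - w \<noteq> 0"
      using assms(3) by (metis eq_iff_diff_eq_0 less_irrefl norm_cis)
    moreover have "1 - w * cis (-t) = (cis t - w) * cis (-t)"
      by (simp add: algebra_simps cis_mult)
    ultimately show ?thesis
      by (simp add: field_simps cis_mult flip: cis_inverse)
  qed
  ultimately show ?thesis
    by (simp add: algebra_simps)
qed

definition poisson :: "complex \<Rightarrow> real \<Rightarrow> real" where
  "poisson w t = (1 - (norm w)\<^sup>2) / (norm (cis t - w))\<^sup>2"

lemma cis_minus_nonzero: "norm w < 1 \<Longrightarrow> cis t - w \<noteq> 0"
  by (metis eq_iff_diff_eq_0 less_irrefl norm_cis)

lemma poisson_pos: "norm w < 1 \<Longrightarrow> poisson w t > 0"
  unfolding poisson_def using cis_minus_nonzero[of w t]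
  by (simp add: abs_square_less_1 zero_less_divide_iff)

lemma continuous_on_poisson:
  assumes "continuous_on A w" "continuous_on A t" "\<And>x. x \<in> A \<Longrightarrow> norm (w x) < 1"
  shows "continuous_on A (\<lambda>x. poisson (w x) (t x))"
  unfolding poisson_def using assms cis_minus_nonzero
  by (intro continuous_intros) auto

text \<open>Cauchy's formula is applied to the auxiliary function \<open>g\<close>: its extra factor
  is holomorphic on the disc, equals 1 at \<open>w\<close>, and on the circle turns the Cauchy
  kernel into the Poisson kernel.\<close>

lemma Poisson_circle:
  fixes f :: "complex \<Rightarrow> complex"
  assumes "continuous_on (cball 0 1) f" "f holomorphic_on ball 0 1" "norm w < 1"
  shows "((\<lambda>t. of_real (poisson w t) * f (cis t)) has_integral 2 * pi * f w) {0..2*pi}"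
proof -
  define g where "g = (\<lambda>u. f u * (1 - (norm w)\<^sup>2) / (1 - cnj w * u))"
  have nz: "1 - cnj w * u \<noteq> 0" if "norm u \<le> 1" for u
  proof
    assume "1 - cnj w * u = 0"
    then have "norm (cnj w * u) = 1" by (metis eq_iff_diff_eq_0 norm_one)
    moreover have "norm (cnj w * u) \<le> norm w * 1"
      unfolding norm_mult using that by (intro mult_mono) auto
    ultimately show False using assms(3) by simp
  qed
  have "continuous_on (cball 0 1) g" "g holomorphic_on ball 0 1"
    unfolding g_def using assms nz by (auto intro!: continuous_intros holomorphic_intros)
  from Cauchy_circle[OF this assms(3)]
  have *: "((\<lambda>t. g (cis t) / (1 - w * cis (-t))) has_integral 2 * pi * g w) {0..2*pi}" .
  have "cmod w * cmod w < 1"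
    using assms(3) by (metis abs_norm_cancel abs_square_less_1 power2_eq_square)
  then have "complex_of_real ((norm w)\<^sup>2) \<noteq> 1"
    by (metis less_irrefl of_real_eq_1_iff power2_eq_square)
  moreover have "cnj w * w = complex_of_real ((norm w)\<^sup>2)"
    by (simp add: complex_norm_square mult.commute del: of_real_power)
  ultimately have "g w = f w"
    unfolding g_def using nz[of w] assms(3) by (simp add: field_simps)
  moreover have "g (cis t) / (1 - w * cis (-t)) = of_real (poisson w t) * f (cis t)" for t
  proof -
    have "(1 - cnj w * cis t) * (1 - w * cis (-t)) = (cis t - w) * cnj (cis t - w)"
      by (simp add: algebra_simps cis_mult cis_cnj)
    also have "\<dots> = of_real ((norm (cis t - w))\<^sup>2)"
      by (simp add: complex_norm_square del: of_real_power)
    finally show ?thesis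
      unfolding g_def poisson_def by (simp add: mult.commute)
  qed
  ultimately show ?thesis using * by simp
qed

lemma poisson_has_integral:
  assumes "norm w < 1"
  shows "(poisson w has_integral 2 * pi) {0..2*pi}"
proof -
  have "((\<lambda>t. of_real (poisson w t) * 1) has_integral 2 * pi * (1::complex)) {0..2*pi}"
    by (rule Poisson_circle[where f = "\<lambda>_. 1"]) (use assms in auto)
  then show ?thesis
    by (auto dest: has_integral_linear[OF _ bounded_linear_Re] simp: o_def)
qed

lemma norm_cis_minus_sq: "(norm (cis t - of_real r * cis \<theta>))\<^sup>2 = 1 - 2 * r * cos (t - \<theta>) + r\<^sup>2"
proof -
  have "(norm (cis t - of_real r * cis \<theta>))\<^sup>2 = (cos t - r * cos \<theta>)\<^sup>2 + (sin t - r * sin \<theta>)\<^sup>2"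
    by (simp add: cmod_power2)
  also have "\<dots> = ((cos t)\<^sup>2 + (sin t)\<^sup>2) - 2 * r * (cos t * cos \<theta> + sin t * sin \<theta>) + r\<^sup>2 * ((cos \<theta>)\<^sup>2 + (sin \<theta>)\<^sup>2)"
    by (simp only: power2_eq_square ring_distribs) (simp add: algebra_simps)
  finally show ?thesis
    by (simp add: cos_diff)
qed

lemma poisson_polar: "poisson (of_real r * cis \<theta>) t = (1 - r\<^sup>2) / (1 - 2 * r * cos (t - \<theta>) + r\<^sup>2)"
  by (simp add: poisson_def norm_cis_minus_sq norm_mult)

lemma poisson_sym: "poisson (of_real r * cis \<theta>) t = poisson (of_real r * cis t) \<theta>"
  unfolding poisson_polar by (simp only: cos_diff mult.commute)

text \<open>Convexity of the power function in tangent form. Young's inequality with exponents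
  \<open>p\<close> and \<open>p / (p - 1)\<close> gives it uniformly, the case \<open>m = 0\<close>
  included.\<close>

lemma tangent_le_powr:
  fixes x m p :: real
  assumes "1 < p" "0 \<le> x" "0 \<le> m"
  shows "m powr p + p * m powr (p - 1) * (x - m) \<le> x powr p"
proof -
  have "x * m powr (p - 1) \<le> x powr p / p + (m powr (p - 1)) powr (p / (p - 1)) / (p / (p - 1))"
    using assms by (intro Youngs_inequality) (auto simp: field_simps)
  also have "(m powr (p - 1)) powr (p / (p - 1)) = m powr p"
    using assms by (simp add: powr_powr)
  finally have *: "p * (x * m powr (p - 1)) \<le> p * (x powr p / p + m powr p / (p / (p - 1)))"
    using assms by (intro mult_left_mono) auto
  have "p * (x powr p / p + m powr p / (p / (p - 1))) = x powr p + (p - 1) * m powr p"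
    using assms by (simp add: field_simps)
  moreover have "m powr (p - 1) * m = m powr p"
    using assms by (cases "m = 0") (auto simp: powr_diff)
  ultimately show ?thesis using *
    by (simp add: algebra_simps)
qed

lemma continuous_on_powr_nonneg [continuous_intros]:
  fixes f :: "'a::topological_space \<Rightarrow> real"
  assumes "continuous_on A f" "\<And>x. x \<in> A \<Longrightarrow> 0 \<le> f x" "0 < p"
  shows "continuous_on A (\<lambda>x. f x powr p)"
  using assms by (intro continuous_on_powr') auto

lemma continuous_on_disc_slice:
  assumes "continuous_on (cball 0 1) f" "continuous_on A r" "continuous_on A t"
    "\<And>x. x \<in> A \<Longrightarrow> \<bar>r x\<bar> \<le> 1"
  shows "continuous_on A (\<lambda>x. f (of_real (r x) * cis (t x)))"
  using assms by (intro continuous_on_compose2[OF assms(1)] continuous_intros) (auto simp: norm_mult)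

lemma integral_swap_ivl:
  fixes f :: "real \<Rightarrow> real \<Rightarrow> 'a::banach"
  assumes "continuous_on ({a..b} \<times> {c..d}) (\<lambda>(x, y). f x y)"
  shows "integral {a..b} (\<lambda>x. integral {c..d} (f x)) = integral {c..d} (\<lambda>y. integral {a..b} (\<lambda>x. f x y))"
  using integral_swap_continuous[of a c b d f] assms
  by (simp only: cbox_Pair_eq box_real)

lemma integral_continuous_on_param_ivl:
  fixes f :: "'a::topological_space \<Rightarrow> real \<Rightarrow> 'c::banach"
  assumes "continuous_on (U \<times> {a..b}) (\<lambda>(x, t). f x t)"
  shows "continuous_on U (\<lambda>x. integral {a..b} (f x))"
  using integral_continuous_on_param[of U a b f] assms by simp

text \<open>Jensen's inequality for the probability density \<open>poisson w t / (2*pi)\<close>: the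
  tangent inequality at the mean \<open>m\<close> of \<open>g\<close> is integrated, and its linear
  term integrates to zero.\<close>

lemma Poisson_Jensen:
  fixes g :: "real \<Rightarrow> real"
  assumes g: "continuous_on {0..2*pi} g" "\<And>t. t \<in> {0..2*pi} \<Longrightarrow> 0 \<le> g t"
    and "1 < p" "norm w < 1"
  shows "(integral {0..2*pi} (\<lambda>t. poisson w t * g t) / (2*pi)) powr p
       \<le> integral {0..2*pi} (\<lambda>t. poisson w t * g t powr p) / (2*pi)"
proof -
  have cP: "continuous_on {0..2*pi} (poisson w)"
    using assms by (intro continuous_on_poisson continuous_intros)
  have nn: "0 \<le> poisson w t" for t
    using poisson_pos[OF assms(4)] less_imp_le by blast
  define I where "I = integral {0..2*pi} (\<lambda>t. poisson w t * g t)"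
  define m where "m = I / (2*pi)"
  have i1: "((\<lambda>t. poisson w t * g t) has_integral I) {0..2*pi}"
    unfolding I_def by (intro integrable_integral integrable_continuous_real continuous_intros cP g)
  have "0 \<le> I"
    using i1 by (rule has_integral_nonneg) (use g nn in auto)
  then have m0: "0 \<le> m" by (simp add: m_def)
  have "((\<lambda>t. (m powr p - p * m powr (p-1) * m) * poisson w t + p * m powr (p-1) * (poisson w t * g t))
      has_integral (m powr p - p * m powr (p-1) * m) * (2 * pi) + p * m powr (p-1) * I) {0..2*pi}"
    by (intro has_integral_add has_integral_mult_right i1 poisson_has_integral assms)
  then have "((\<lambda>t. poisson w t * (m powr p + p * m powr (p-1) * (g t - m))) has_integral 2 * pi * m powr p) {0..2*pi}"
    by (simp add: algebra_simps m_def)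
  moreover have "((\<lambda>t. poisson w t * g t powr p) has_integral integral {0..2*pi} (\<lambda>t. poisson w t * g t powr p)) {0..2*pi}"
    by (intro integrable_integral integrable_continuous_real continuous_intros cP g) (use assms in auto)
  ultimately have "2 * pi * m powr p \<le> integral {0..2*pi} (\<lambda>t. poisson w t * g t powr p)"
    by (rule has_integral_le) (use assms m0 in \<open>auto intro!: mult_left_mono tangent_le_powr nn\<close>)
  then show ?thesis
    by (simp add: m_def I_def field_simps)
qed

lemma Poisson_contraction:
  fixes g :: "real \<Rightarrow> real"
  assumes g: "continuous_on {0..2*pi} g" "\<And>t. t \<in> {0..2*pi} \<Longrightarrow> 0 \<le> g t"
    and "1 < p" "0 \<le> r" "r < 1"
  shows "integral {0..2*pi} (\<lambda>\<theta>. (integral {0..2*pi} (\<lambda>t. poisson (of_real r * cis \<theta>) t * g t) / (2*pi)) powr p)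
       \<le> integral {0..2*pi} (\<lambda>t. g t powr p)"
proof -
  have c: "continuous_on (UNIV \<times> {0..2*pi}) (\<lambda>(\<theta>, t). poisson (of_real r * cis \<theta>) t * h t)"
    if "continuous_on {0..2*pi} h" for h
  proof -
    have "continuous_on (UNIV \<times> {0..2*pi}) (\<lambda>x::real \<times> real. h (snd x))"
      by (rule continuous_on_compose2[OF that continuous_on_snd[OF continuous_on_id]]) auto
    then show ?thesis
      unfolding case_prod_unfold using assms
      by (intro continuous_intros continuous_on_poisson) (auto simp: norm_mult)
  qed
  have c1: "continuous_on UNIV (\<lambda>\<theta>. integral {0..2*pi} (\<lambda>t. poisson (of_real r * cis \<theta>) t * h t))"
    if "continuous_on {0..2*pi} h" for h
    by (rule integral_continuous_on_param_ivl[OF c[OF that]])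
  have gp: "continuous_on {0..2*pi} (\<lambda>t. g t powr p)"
    using assms by (intro continuous_intros) auto
  have pp: "0 \<le> poisson (of_real r * cis \<theta>) t" for \<theta> t
    using poisson_pos[of "of_real r * cis \<theta>" t] assms by (simp add: norm_mult)
  have "integral {0..2*pi} (\<lambda>\<theta>. (integral {0..2*pi} (\<lambda>t. poisson (of_real r * cis \<theta>) t * g t) / (2*pi)) powr p)
      \<le> integral {0..2*pi} (\<lambda>\<theta>. integral {0..2*pi} (\<lambda>t. poisson (of_real r * cis \<theta>) t * g t powr p) / (2*pi))"
  proof (rule integral_le)
    have "0 \<le> integral {0..2*pi} (\<lambda>t. poisson (of_real r * cis \<theta>) t * g t)" for \<theta>
      using g pp by (intro integral_nonneg integrable_continuous_real continuous_intros continuous_on_poisson)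
        (use assms in \<open>auto simp: norm_mult\<close>)
    then show "(\<lambda>\<theta>. (integral {0..2*pi} (\<lambda>t. poisson (of_real r * cis \<theta>) t * g t) / (2*pi)) powr p)
        integrable_on {0..2*pi}"
      using assms by (intro integrable_continuous_real continuous_intros continuous_on_subset[OF c1] g) auto
    show "(\<lambda>\<theta>. integral {0..2*pi} (\<lambda>t. poisson (of_real r * cis \<theta>) t * g t powr p) / (2*pi)) integrable_on {0..2*pi}"
      by (intro integrable_continuous_real continuous_intros continuous_on_subset[OF c1] gp) auto
    show "(integral {0..2*pi} (\<lambda>t. poisson (of_real r * cis \<theta>) t * g t) / (2*pi)) powr p
       \<le> integral {0..2*pi} (\<lambda>t. poisson (of_real r * cis \<theta>) t * g t powr p) / (2*pi)" for \<theta>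
      by (rule Poisson_Jensen) (use assms in \<open>auto simp: norm_mult\<close>)
  qed
  also have "\<dots> = integral {0..2*pi} (\<lambda>\<theta>. integral {0..2*pi} (\<lambda>t. poisson (of_real r * cis \<theta>) t * g t powr p)) / (2*pi)"
    by simp
  also have "\<dots> = integral {0..2*pi} (\<lambda>t. integral {0..2*pi} (\<lambda>\<theta>. poisson (of_real r * cis \<theta>) t * g t powr p)) / (2*pi)"
    by (subst integral_swap_ivl[OF continuous_on_subset[OF c[OF gp]]]) auto
  \<comment> \<open>The kernel is symmetric in the two angles, so its total mass is also 2 pi when
    the angle of the disc point is the variable.\<close>
  also have "(\<lambda>t. integral {0..2*pi} (\<lambda>\<theta>. poisson (of_real r * cis \<theta>) t * g t powr p)) = (\<lambda>t. 2 * pi * g t powr p)"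
  proof
    fix t
    have "(poisson (of_real r * cis t) has_integral 2*pi) {0..2*pi}"
      by (rule poisson_has_integral) (use assms in \<open>auto simp: norm_mult\<close>)
    then show "integral {0..2*pi} (\<lambda>\<theta>. poisson (of_real r * cis \<theta>) t * g t powr p) = 2 * pi * g t powr p"
      using poisson_sym[of r _ t] by (simp add: integral_unique)
  qed
  finally show ?thesis by simp
qed

lemma norm_le_Poisson:
  assumes "continuous_on (cball 0 1) f" "f holomorphic_on ball 0 1" "norm w < 1"
  shows "norm (f w) \<le> integral {0..2*pi} (\<lambda>t. poisson w t * norm (f (cis t))) / (2*pi)"
proof -
  have cf: "continuous_on {0..2*pi} (\<lambda>t. f (cis t))"
    using assms by (intro continuous_on_compose2[OF assms(1)] continuous_intros) auto
  have cP: "continuous_on {0..2*pi} (poisson w)"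
    using assms by (intro continuous_on_poisson continuous_intros)
  have "norm (2 * pi * f w) = norm (integral {0..2*pi} (\<lambda>t. of_real (poisson w t) * f (cis t)))"
    using Poisson_circle[OF assms] by (simp add: integral_unique)
  also have "\<dots> \<le> integral {0..2*pi} (\<lambda>t. poisson w t * norm (f (cis t)))"
    using poisson_pos[OF assms(3), THEN less_imp_le]
    by (intro integral_norm_bound_integral integrable_continuous_real continuous_intros cf cP)
       (auto simp: norm_mult)
  finally show ?thesis
    by (simp add: norm_mult field_simps)
qed

text \<open>The modulus of \<open>f\<close> is dominated by the Poisson integral of its boundary
  values, and Poisson integration contracts the p-th power mean. Applied to dilates of
  \<open>f\<close>, this is the growth of the means with the radius.\<close>

lemma integral_mean_le:
  assumes f: "continuous_on (cball 0 1) f" "f holomorphic_on ball 0 1"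
    and "1 < p" "0 \<le> r" "r < 1"
  shows "integral {0..2*pi} (\<lambda>\<theta>. norm (f (of_real r * cis \<theta>)) powr p)
       \<le> integral {0..2*pi} (\<lambda>\<theta>. norm (f (cis \<theta>)) powr p)"
proof -
  have cf: "continuous_on {0..2*pi} (\<lambda>t. f (cis t))"
    by (intro continuous_on_compose2[OF f(1)] continuous_intros) auto
  have cfr: "continuous_on {0..2*pi} (\<lambda>t. f (of_real r * cis t))"
    using assms by (intro continuous_on_disc_slice[OF f(1)] continuous_intros) auto
  have c: "continuous_on UNIV (\<lambda>\<theta>. integral {0..2*pi} (\<lambda>t. poisson (of_real r * cis \<theta>) t * norm (f (cis t))))"
  proof (rule integral_continuous_on_param_ivl)
    have "continuous_on (UNIV \<times> {0..2*pi}) (\<lambda>x::real \<times> real. f (cis (snd x)))"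
      by (rule continuous_on_compose2[OF cf continuous_on_snd[OF continuous_on_id]]) auto
    then show "continuous_on (UNIV \<times> {0..2*pi}) (\<lambda>(\<theta>, t). poisson (of_real r * cis \<theta>) t * norm (f (cis t)))"
      unfolding case_prod_unfold using assms
      by (intro continuous_intros continuous_on_poisson) (auto simp: norm_mult)
  qed
  have le: "norm (f (of_real r * cis \<theta>)) \<le> integral {0..2*pi} (\<lambda>t. poisson (of_real r * cis \<theta>) t * norm (f (cis t))) / (2*pi)" for \<theta>
    by (rule norm_le_Poisson[OF f]) (use assms in \<open>auto simp: norm_mult\<close>)
  have nn: "0 \<le> integral {0..2*pi} (\<lambda>t. poisson (of_real r * cis \<theta>) t * norm (f (cis t))) / (2*pi)" for \<theta>
    using le[of \<theta>] norm_ge_zero order_trans by blast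
  have "integral {0..2*pi} (\<lambda>\<theta>. norm (f (of_real r * cis \<theta>)) powr p)
     \<le> integral {0..2*pi} (\<lambda>\<theta>. (integral {0..2*pi} (\<lambda>t. poisson (of_real r * cis \<theta>) t * norm (f (cis t))) / (2*pi)) powr p)"
  proof (rule integral_le)
    show "(\<lambda>\<theta>. norm (f (of_real r * cis \<theta>)) powr p) integrable_on {0..2*pi}"
      using assms by (intro integrable_continuous_real continuous_intros cfr) auto
    show "(\<lambda>\<theta>. (integral {0..2*pi} (\<lambda>t. poisson (of_real r * cis \<theta>) t * norm (f (cis t))) / (2*pi)) powr p)
       integrable_on {0..2*pi}"
      using nn assms by (intro integrable_continuous_real continuous_intros continuous_on_subset[OF c]) auto
  qed (use le nn assms in \<open>auto intro!: powr_mono2\<close>)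
  also have "\<dots> \<le> integral {0..2*pi} (\<lambda>\<theta>. norm (f (cis \<theta>)) powr p)"
    by (rule Poisson_contraction) (use assms in \<open>auto intro!: continuous_intros cf\<close>)
  finally show ?thesis .
qed

subsection \<open>The radial maximal function\<close>

lemma integral_periodic_shift:
  fixes k :: "real \<Rightarrow> real"
  assumes k: "continuous_on UNIV k" "\<And>x. k (x + T) = k x" and a: "\<bar>a\<bar> \<le> T"
  shows "integral {a..a+T} k = integral {0..T} k"
proof -
  have int: "k integrable_on {c..d}" for c d
    by (rule integrable_continuous_real[OF continuous_on_subset[OF k(1)]]) auto
  have pos: "integral {a..a+T} k = integral {0..T} k" if "0 \<le> a" "a \<le> T" for a
  proof -
    have "integral {a..a+T} k = integral {a..T} k + integral {T..a+T} k"
      using that by (intro Henstock_Kurzweil_Integration.integral_combine[symmetric] int) auto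
    also have "integral {T..a+T} k = integral {0..a} k"
      using integral_shift_real_ivl[of T T "a+T" k] by (simp add: k(2))
    also have "integral {a..T} k + integral {0..a} k = integral {0..T} k"
      using Henstock_Kurzweil_Integration.integral_combine[of 0 a T k] that int by simp
    finally show ?thesis .
  qed
  show ?thesis
  proof (cases "0 \<le> a")
    case False
    have "integral {a..a+T} k = integral {a+T..a+T+T} k"
      using integral_shift_real_ivl[of "a+T" T "a+T+T" k] by (simp add: k(2) add.commute[of a T])
    also have "\<dots> = integral {0..T} k"
      using False a by (intro pos) auto
    finally show ?thesis .
  qed (use pos a in auto)
qed

text \<open>The Poisson kernel as a function of the angle between the two points alone: even, and
  open to integration by parts in that angle.\<close>

definition radial_poisson :: "real \<Rightarrow> real \<Rightarrow> real" where
  "radial_poisson r t = (1 - r\<^sup>2) / (1 - 2 * r * cos t + r\<^sup>2)"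

lemma poisson_eq_radial: "poisson (of_real r * cis \<theta>) t = radial_poisson r (t - \<theta>)"
  by (simp add: poisson_polar radial_poisson_def)

lemma poisson_denom_pos:
  fixes r t :: real
  assumes "0 \<le> r" "r < 1"
  shows "1 - 2 * r * cos t + r\<^sup>2 > 0"
proof -
  have "r * cos t \<le> r * 1" using assms by (intro mult_left_mono) auto
  then have "1 - 2 * r * cos t + r\<^sup>2 \<ge> (1 - r)\<^sup>2" by (simp add: power2_eq_square algebra_simps)
  moreover have "(1 - r)\<^sup>2 > 0" using assms by simp
  ultimately show ?thesis by linarith
qed

lemma continuous_on_radial_poisson:
  fixes t :: "real \<Rightarrow> real"
  assumes "0 \<le> r" "r < 1" "continuous_on A t"
  shows "continuous_on A (\<lambda>x. radial_poisson r (t x))"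
  unfolding radial_poisson_def using poisson_denom_pos[OF assms(1,2)]
  by (intro continuous_intros continuous_on_cos[OF assms(3)]) (auto simp: less_imp_neq[THEN not_sym])

lemma radial_poisson_nonneg:
  assumes "0 \<le> r" "r < 1"
  shows "0 \<le> radial_poisson r t"
  unfolding radial_poisson_def using poisson_denom_pos[OF assms, of t] assms
  by (intro divide_nonneg_nonneg) (auto simp: abs_square_le_1)

text \<open>The period is centred at \<open>\<theta>\<close> and the even kernel folded. The sum
  \<open>g (\<theta> + t) + g (\<theta> - t)\<close> is the derivative of the integral of
  \<open>g\<close> over the centred interval of radius \<open>t\<close>, which is what integration
  by parts needs.\<close>

lemma poisson_integral_folded:
  fixes g :: "real \<Rightarrow> real"
  assumes g: "continuous_on UNIV g" "\<And>x. g (x + 2*pi) = g x" and r: "0 \<le> r" "r < 1"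
    and \<theta>: "\<theta> \<in> {0..2*pi}"
  shows "integral {0..2*pi} (\<lambda>t. poisson (of_real r * cis \<theta>) t * g t)
       = integral {0..pi} (\<lambda>t. radial_poisson r t * (g (\<theta> + t) + g (\<theta> - t)))"
proof -
  let ?k = "\<lambda>t. radial_poisson r (t - \<theta>) * g t"
  have cg: "continuous_on A (\<lambda>x. g (h x))" if "continuous_on A h" for A and h :: "real \<Rightarrow> real"
    using that by (intro continuous_on_compose2[OF g(1)]) auto
  have "integral {0..2*pi} (\<lambda>t. poisson (of_real r * cis \<theta>) t * g t) = integral {0..2*pi} ?k"
    by (simp add: poisson_eq_radial)
  also have "\<dots> = integral {(\<theta> - pi)..(\<theta> - pi) + 2*pi} ?k"
  proof (rule integral_periodic_shift[symmetric])
    show "radial_poisson r (x + 2*pi - \<theta>) * g (x + 2*pi) = radial_poisson r (x - \<theta>) * g x" for x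
    proof -
      have "cos (x + 2*pi - \<theta>) = cos (x - \<theta>)"
        using cos_periodic[of "x - \<theta>"] by (simp add: algebra_simps)
      then show ?thesis by (simp add: radial_poisson_def g(2))
    qed
  qed (use \<theta> r in \<open>auto intro!: continuous_intros continuous_on_radial_poisson g\<close>)
  also have "\<dots> = integral {-pi..pi} (\<lambda>t. radial_poisson r t * g (\<theta> + t))"
    using integral_shift_real_ivl[of "\<theta> - pi" \<theta> "\<theta> + pi" ?k] by (simp add: add.commute)
  also have "\<dots> = integral {-pi..0} (\<lambda>t. radial_poisson r t * g (\<theta> + t))
               + integral {0..pi} (\<lambda>t. radial_poisson r t * g (\<theta> + t))"
    by (intro Henstock_Kurzweil_Integration.integral_combine[symmetric] integrable_continuous_real
          continuous_intros continuous_on_radial_poisson r cg) auto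
  also have "integral {-pi..0} (\<lambda>t. radial_poisson r t * g (\<theta> + t))
      = integral {0..pi} (\<lambda>t. radial_poisson r t * g (\<theta> - t))"
    using Henstock_Kurzweil_Integration.integral_reflect_real[of pi 0 "\<lambda>t. radial_poisson r t * g (\<theta> - t)"]
    by (simp add: radial_poisson_def)
  also have "\<dots> + integral {0..pi} (\<lambda>t. radial_poisson r t * g (\<theta> + t))
      = integral {0..pi} (\<lambda>t. radial_poisson r t * g (\<theta> - t) + radial_poisson r t * g (\<theta> + t))"
    by (intro Henstock_Kurzweil_Integration.integral_add[symmetric] integrable_continuous_real
          continuous_intros continuous_on_radial_poisson r cg)
  finally show ?thesis
    by (simp add: algebra_simps)
qed

lemma radial_poisson_deriv:
  assumes r: "0 \<le> r" "r < 1"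
  shows "(radial_poisson r has_real_derivative
     - ((1 - r\<^sup>2) * (2 * r * sin t)) / (1 - 2 * r * cos t + r\<^sup>2)\<^sup>2) (at t within A)"
proof -
  have "((\<lambda>t. 1 - 2 * r * cos t + r\<^sup>2) has_real_derivative 2 * r * sin t) (at t within A)"
    by (auto intro!: derivative_eq_intros)
  moreover have "1 - 2 * r * cos t + r\<^sup>2 \<noteq> 0"
    using poisson_denom_pos[OF r, of t] by simp
  ultimately show ?thesis
    unfolding radial_poisson_def[abs_def]
    using DERIV_divide[OF DERIV_const[of "1 - r\<^sup>2"]] by (fastforce simp: power2_eq_square)
qed

text \<open>The Poisson kernel decreases in \<open>\<bar>t\<bar>\<close>, so integration by parts bounds the Poisson integral by
  the centred averages of \<open>g\<close>.\<close>
lemma poisson_integral_le_maximal: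
  fixes g :: "real \<Rightarrow> real"
  assumes g: "continuous_on UNIV g" "\<And>x. g (x + 2*pi) = g x" and r: "0 \<le> r" "r < 1"
    and \<theta>: "\<theta> \<in> {0..2*pi}"
    and avg: "\<And>h. 0 < h \<Longrightarrow> h \<le> pi \<Longrightarrow> integral {\<theta>-h..\<theta>+h} g \<le> 2 * h * \<kappa>"
  shows "integral {0..2*pi} (\<lambda>t. poisson (of_real r * cis \<theta>) t * g t) \<le> 2 * pi * \<kappa>"
proof -
  have cg: "continuous_on A (\<lambda>x. g (h x))" if "continuous_on A h" for A and h :: "real \<Rightarrow> real"
    using that by (intro continuous_on_compose2[OF g(1)]) auto
  \<comment> \<open>A base point strictly to the left of every \<open>\<theta> - t\<close> with
    \<open>t \<le> pi\<close>, so that the primitive \<open>A\<close> is differentiable from both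
    sides wherever it is used.\<close>
  define c where "c = \<theta> - pi - 1"
  define A where "A = (\<lambda>x. integral {c..x} g)"
  have A: "(A has_real_derivative g x) (at x)" if "c < x" for x
  proof -
    have "(A has_real_derivative g x) (at x within {c..x+1})"
      unfolding A_def using that continuous_on_subset[OF g(1)]
      by (intro integral_has_real_derivative) auto
    then show ?thesis using that by (simp add: at_within_Icc_at)
  qed
  define F where "F = (\<lambda>t. A (\<theta> + t) - A (\<theta> - t))"
  have F: "F t = integral {\<theta>-t..\<theta>+t} g" if "0 \<le> t" "t \<le> pi" for t
  proof -
    have "integral {c..\<theta>-t} g + integral {\<theta>-t..\<theta>+t} g = integral {c..\<theta>+t} g"
      using that by (intro Henstock_Kurzweil_Integration.integral_combine
          integrable_continuous_real continuous_on_subset[OF g(1)]) (auto simp: c_def)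
    then show ?thesis by (simp add: F_def A_def)
  qed
  have Fle: "F t - 2 * \<kappa> * t \<le> 0" if "0 \<le> t" "t \<le> pi" for t
    using avg[of t] F[OF that] that by (cases "t = 0") (auto simp: F_def algebra_simps)
  define P' where "P' = (\<lambda>t. - ((1 - r\<^sup>2) * (2 * r * sin t)) / (1 - 2 * r * cos t + r\<^sup>2)\<^sup>2)"
  have dF: "(F has_real_derivative g (\<theta> + t) + g (\<theta> - t)) (at t within S)" if "0 \<le> t" "t \<le> pi" for t S
    unfolding F_def using that
    by (auto intro!: derivative_eq_intros DERIV_chain'[OF _ A, THEN has_field_derivative_at_within] simp: c_def)
  \<comment> \<open>The derivative of the kernel times \<open>F t - 2 * \<kappa> * t\<close>, the
    excess of the centred integral over its permitted size.\<close>
  let ?h = "\<lambda>t. P' t * (F t - 2 * \<kappa> * t) + radial_poisson r t * (g (\<theta> + t) + g (\<theta> - t) - 2 * \<kappa>)"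
  have "(?h has_integral
     radial_poisson r pi * (F pi - 2 * \<kappa> * pi) - radial_poisson r 0 * (F 0 - 2 * \<kappa> * 0)) {0..pi}"
  proof (rule fundamental_theorem_of_calculus)
    fix t assume t: "t \<in> {0..pi}"
    show "((\<lambda>t. radial_poisson r t * (F t - 2 * \<kappa> * t)) has_vector_derivative ?h t) (at t within {0..pi})"
    proof -
      have "((\<lambda>t. F t - 2 * \<kappa> * t) has_real_derivative (g (\<theta> + t) + g (\<theta> - t)) - 2 * \<kappa>) (at t within {0..pi})"
        using t by (intro DERIV_diff dF DERIV_cmult_Id) auto
      from DERIV_mult[OF radial_poisson_deriv[OF r] this] show ?thesis
        unfolding has_real_derivative_iff_has_vector_derivative[symmetric] P'_def
        by (simp add: mult.commute)
    qed
  qed simp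
  moreover have "((\<lambda>t. radial_poisson r t * (g (\<theta> + t) + g (\<theta> - t) - 2 * \<kappa>)) has_integral
      integral {0..pi} (\<lambda>t. radial_poisson r t * (g (\<theta> + t) + g (\<theta> - t) - 2 * \<kappa>))) {0..pi}"
    by (intro integrable_integral integrable_continuous_real
          continuous_intros continuous_on_radial_poisson r cg)
  \<comment> \<open>The discarded summand is a product of two nonpositive factors: the kernel
    decreases, and the excess is at most 0 by \<open>avg\<close>. Of the boundary terms, the one at
    0 vanishes and the one at \<open>pi\<close> is nonpositive.\<close>
  moreover have "radial_poisson r t * (g (\<theta> + t) + g (\<theta> - t) - 2 * \<kappa>) \<le> ?h t" if t: "t \<in> {0..pi}" for t
  proof -
    have "P' t \<le> 0"
      unfolding P'_def using r t sin_ge_zero[of t] by (auto intro!: divide_nonneg_nonneg mult_nonneg_nonneg simp: abs_square_le_1)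
    then show ?thesis using Fle[of t] t by (auto simp: mult_nonpos_nonpos)
  qed
  ultimately have "integral {0..pi} (\<lambda>t. radial_poisson r t * (g (\<theta> + t) + g (\<theta> - t) - 2 * \<kappa>))
      \<le> radial_poisson r pi * (F pi - 2 * \<kappa> * pi) - radial_poisson r 0 * (F 0 - 2 * \<kappa> * 0)"
    by (meson has_integral_le)
  also have "\<dots> \<le> 0"
    using Fle[of pi] radial_poisson_nonneg[OF r, of pi] by (simp add: F_def mult_nonneg_nonpos)
  finally have "integral {0..pi} (\<lambda>t. radial_poisson r t * (g (\<theta> + t) + g (\<theta> - t)) - radial_poisson r t * (\<kappa> + \<kappa>)) \<le> 0"
    by (simp add: algebra_simps)
  then have "integral {0..pi} (\<lambda>t. radial_poisson r t * (g (\<theta> + t) + g (\<theta> - t)))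
      - integral {0..pi} (\<lambda>t. radial_poisson r t * (\<kappa> + \<kappa>)) \<le> 0"
    by (subst (asm) Henstock_Kurzweil_Integration.integral_diff)
       (intro integrable_continuous_real continuous_intros continuous_on_radial_poisson r cg | assumption)+
  \<comment> \<open>This is the folding formula again, for the constant function
    \<open>\<kappa>\<close>.\<close>
  also have "integral {0..pi} (\<lambda>t. radial_poisson r t * (\<kappa> + \<kappa>)) = 2 * pi * \<kappa>"
  proof -
    have "integral {0..pi} (\<lambda>t. radial_poisson r t * (\<kappa> + \<kappa>))
       = integral {0..2*pi} (\<lambda>t. poisson (of_real r * cis \<theta>) t * \<kappa>)"
      by (rule poisson_integral_folded[symmetric]) (use r \<theta> in auto)
    also have "\<dots> = 2 * pi * \<kappa>"
      using poisson_has_integral[of "of_real r * cis \<theta>"] r by (simp add: norm_mult integral_unique)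
    finally show ?thesis .
  qed
  finally show ?thesis
    using poisson_integral_folded[OF g r \<theta>] by simp
qed

lemma nn_integral_continuous_Icc:
  fixes g :: "real \<Rightarrow> real"
  assumes "continuous_on {a..b} g" "\<And>t. t \<in> {a..b} \<Longrightarrow> 0 \<le> g t"
  shows "(\<integral>\<^sup>+t. ennreal (g t) * indicator {a..b} t \<partial>lborel) = ennreal (integral {a..b} g)"
  by (rule nn_integral_has_integral_lebesgue')
     (use assms in \<open>auto intro: integrable_integral integrable_continuous_real\<close>)

text \<open>Subadditivity over an arbitrary countable index set. The sum is an integral over
  counting measure because the Vitali family is indexed by its centres, which are real
  numbers.\<close>

lemma emeasure_UN_countable_le:
  assumes "countable I" "\<And>i. i \<in> I \<Longrightarrow> X i \<in> sets M"
  shows "emeasure M (\<Union>(X ` I)) \<le> (\<integral>\<^sup>+i. emeasure M (X i) \<partial>count_space I)"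
proof -
  have "emeasure M (\<Union>(X ` I)) = (\<integral>\<^sup>+x. indicator (\<Union>(X ` I)) x \<partial>M)"
    using assms by (intro nn_integral_indicator[symmetric] sets.countable_UN') auto
  also have "\<dots> \<le> (\<integral>\<^sup>+x. \<integral>\<^sup>+i. indicator (X i) x \<partial>count_space I \<partial>M)"
  proof (rule nn_integral_mono)
    fix x
    show "indicator (\<Union>(X ` I)) x \<le> (\<integral>\<^sup>+i. indicator (X i) x \<partial>count_space I)"
    proof (cases "x \<in> \<Union>(X ` I)")
      case True
      then obtain i where i: "i \<in> I" "x \<in> X i" by auto
      then have "(indicator (X i) x :: ennreal) \<le> (\<integral>\<^sup>+i. indicator (X i) x \<partial>count_space I)"
        by (intro nn_integral_ge_point)
      then show ?thesis using i True by (auto simp: indicator_def)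
    qed simp
  qed
  also have "\<dots> = (\<integral>\<^sup>+i. \<integral>\<^sup>+x. indicator (X i) x \<partial>M \<partial>count_space I)"
    using assms by (intro nn_integral_count_space_nn_integral) auto
  also have "\<dots> = (\<integral>\<^sup>+i. emeasure M (X i) \<partial>count_space I)"
    using assms by (intro nn_integral_cong) (auto simp: nn_integral_indicator)
  finally show ?thesis .
qed

text \<open>Each bad centre carries an interval of length 2h on which \<open>g\<close> has mass more
  than 2h times \<open>\<kappa>\<close>. Vitali selects disjoint intervals whose fivefold
  enlargements, of length 10h, cover the bad set. The constant 10 is this factor 5 times the 2
  periods that contain all the intervals. The measurable cover \<open>U\<close> stands in for the
  bad set, whose own measurability is left open.\<close>

lemma maximal_weak_type:
  fixes g :: "real \<Rightarrow> real"
  assumes g: "continuous_on UNIV g" "\<And>x. g (x + 2*pi) = g x" "\<And>x. 0 \<le> g x" and \<kappa>: "0 < \<kappa>"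
  obtains U where "U \<in> sets lborel" "emeasure lborel U \<le> ennreal (10 / \<kappa> * integral {0..2*pi} g)"
    "{\<theta> \<in> {0..2*pi}. \<exists>h. 0 < h \<and> h \<le> pi \<and> 2 * h * \<kappa> < integral {\<theta>-h..\<theta>+h} g} \<subseteq> U"
proof -
  define K where "K = {\<theta> \<in> {0..2*pi}. \<exists>h. 0 < h \<and> h \<le> pi \<and> 2 * h * \<kappa> < integral {\<theta>-h..\<theta>+h} g}"
  have "\<forall>\<theta>\<in>K. \<exists>h. 0 < h \<and> h \<le> pi \<and> 2 * h * \<kappa> < integral {\<theta>-h..\<theta>+h} g"
    unfolding K_def by blast
  then obtain h where h: "\<And>\<theta>. \<theta> \<in> K \<Longrightarrow> 0 < h \<theta> \<and> h \<theta> \<le> pi \<and> 2 * h \<theta> * \<kappa> < integral {\<theta>-h \<theta>..\<theta>+h \<theta>} g"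
    by metis
  have "K \<subseteq> (\<Union>\<theta>\<in>K. cball \<theta> (h \<theta>))" using h by (force simp: less_imp_le)
  then obtain C where C: "countable C" "C \<subseteq> K"
     "pairwise (\<lambda>i j. disjnt (cball i (h i)) (cball j (h j))) C"
     "K \<subseteq> (\<Union>i\<in>C. cball i (5 * h i))"
    by (rule Vitali_covering_lemma_cballs[where a = "\<lambda>x. x" and B = pi]) (use h in auto)
  \<comment> \<open>As a measure with density \<open>g\<close>, the masses of the disjoint intervals
    add up by countable additivity.\<close>
  define N where "N = density lborel (\<lambda>t. ennreal (g t))"
  have gm [measurable]: "g \<in> borel_measurable borel"
    using g(1) by (rule borel_measurable_continuous_onI)
  have N: "emeasure N {a..b} = ennreal (integral {a..b} g)" for a b
    unfolding N_def
    by (subst emeasure_density) (auto intro!: nn_integral_continuous_Icc continuous_on_subset[OF g(1)] g)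
  have setsN [simp]: "sets N = sets borel" by (simp add: N_def)
  have "emeasure lborel (\<Union>i\<in>C. cball i (5 * h i)) \<le> (\<integral>\<^sup>+i. emeasure lborel (cball i (5 * h i)) \<partial>count_space C)"
    by (rule emeasure_UN_countable_le) (use C in auto)
  also have "\<dots> \<le> (\<integral>\<^sup>+i. ennreal (5 / \<kappa>) * emeasure N (cball i (h i)) \<partial>count_space C)"
  proof (rule nn_integral_mono)
    fix i assume "i \<in> space (count_space C)"
    then have i: "i \<in> K" using C by auto
    have "emeasure lborel (cball i (5 * h i)) = ennreal (10 * h i)"
      using h[OF i] by (simp add: cball_eq_atLeastAtMost)
    also have "\<dots> \<le> ennreal (5 / \<kappa> * integral {i-h i..i+h i} g)"
      using h[OF i] \<kappa> by (intro ennreal_leI) (simp add: field_simps)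
    also have "\<dots> = ennreal (5 / \<kappa>) * emeasure N (cball i (h i))"
      using \<kappa> by (simp add: cball_eq_atLeastAtMost N flip: ennreal_mult')
    finally show "emeasure lborel (cball i (5 * h i)) \<le> ennreal (5 / \<kappa>) * emeasure N (cball i (h i))" .
  qed
  also have "\<dots> = ennreal (5 / \<kappa>) * (\<integral>\<^sup>+i. emeasure N (cball i (h i)) \<partial>count_space C)"
    by (rule nn_integral_cmult) simp
  also have "(\<integral>\<^sup>+i. emeasure N (cball i (h i)) \<partial>count_space C) = emeasure N (\<Union>i\<in>C. cball i (h i))"
  proof (rule emeasure_UN_countable[symmetric])
    show "disjoint_family_on (\<lambda>i. cball i (h i)) C"
      using C(3) unfolding pairwise_def disjoint_family_on_def disjnt_def by blast
  qed (use C(1) in auto)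
  \<comment> \<open>Radii are at most \<open>pi\<close>, so the intervals stay within distance
    \<open>pi\<close> of one period, that is, inside two periods.\<close>
  also have "\<dots> \<le> emeasure N {-pi..-pi+2*pi+2*pi}"
  proof (rule emeasure_mono)
    have "cball i (h i) \<subseteq> {-pi..-pi+2*pi+2*pi}" if "i \<in> C" for i
    proof -
      have "i \<in> K" using that C(2) by blast
      then have "0 \<le> i" "i \<le> 2*pi" "h i \<le> pi" using h[of i] unfolding K_def by auto
      then show ?thesis unfolding cball_eq_atLeastAtMost by auto
    qed
    then show "(\<Union>i\<in>C. cball i (h i)) \<subseteq> {-pi..-pi+2*pi+2*pi}" by blast
  qed simp
  also have "\<dots> = ennreal (2 * integral {0..2*pi} g)"
  proof -
    have "integral {-pi..-pi+2*pi+2*pi} g = integral {-pi..-pi+2*pi} g + integral {pi..pi+2*pi} g"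
      using Henstock_Kurzweil_Integration.integral_combine[of "-pi" pi "3*pi" g] 
      by (simp add: integrable_continuous_real continuous_on_subset[OF g(1)])
    also have "\<dots> = 2 * integral {0..2*pi} g"
      using integral_periodic_shift[of g "2*pi" "-pi", OF g(1,2)] integral_periodic_shift[of g "2*pi" pi, OF g(1,2)] by simp
    finally show ?thesis by (simp add: N)
  qed
  also have "ennreal (5 / \<kappa>) * \<dots> = ennreal (10 / \<kappa> * integral {0..2*pi} g)"
    using \<kappa> by (simp flip: ennreal_mult')
  finally show ?thesis
    using C(4) by (intro that[of "\<Union>i\<in>C. cball i (5 * h i)"]) (use C(1) in \<open>auto simp: K_def mult_left_mono\<close>)
qed

text \<open>If the modulus exceeds \<open>\<kappa>\<close> somewhere on a radius, so does a Poisson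
  average of the boundary modulus; then some centred average exceeds \<open>\<kappa>\<close> as
  well, by \<open>poisson_integral_le_maximal\<close> read backwards.\<close>

lemma radial_maximal_weak_type:
  fixes f :: "complex \<Rightarrow> complex"
  assumes f: "continuous_on (cball 0 1) f" "f holomorphic_on ball 0 1" and \<kappa>: "0 < \<kappa>"
  defines "E \<equiv> {\<theta> \<in> {0..2*pi}. \<exists>r\<in>{0..<1}. \<kappa> < norm (f (of_real r * cis \<theta>))}"
  shows "E \<in> sets borel" "emeasure lborel E \<le> ennreal (10 / \<kappa> * integral {0..2*pi} (\<lambda>\<theta>. norm (f (cis \<theta>))))"
proof -
  have cf: "continuous_on UNIV (\<lambda>t. f (cis t))"
    by (intro continuous_on_compose2[OF f(1)] continuous_intros) auto
  have cfr: "continuous_on UNIV (\<lambda>t. f (of_real r * cis t))" if "r \<in> {0..<1}" for r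
    using that by (intro continuous_on_disc_slice[OF f(1)] continuous_intros) auto
  have "E = {0..2*pi} \<inter> (\<Union>r\<in>{0..<1}. {\<theta>. \<kappa> < norm (f (of_real r * cis \<theta>))})"
    by (auto simp: E_def)
  \<comment> \<open>The union runs over uncountably many radii; openness is what makes it
    measurable.\<close>
  moreover have "open (\<Union>r\<in>{0..<1}. {\<theta>. \<kappa> < norm (f (of_real r * cis \<theta>))})"
    by (intro open_UN ballI open_Collect_less continuous_intros cfr)
  ultimately show "E \<in> sets borel" by auto
  let ?g = "\<lambda>t. norm (f (cis t))"
  obtain U where U: "U \<in> sets lborel" "emeasure lborel U \<le> ennreal (10 / \<kappa> * integral {0..2*pi} ?g)"
    "{\<theta> \<in> {0..2*pi}. \<exists>h. 0 < h \<and> h \<le> pi \<and> 2 * h * \<kappa> < integral {\<theta>-h..\<theta>+h} ?g} \<subseteq> U"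
    by (rule maximal_weak_type[of ?g \<kappa>])
       (use \<kappa> in \<open>auto intro!: continuous_intros cf simp flip: cis_mult\<close>)
  have "E \<subseteq> U"
  proof
    fix \<theta> assume "\<theta> \<in> E"
    then obtain r where r: "\<theta> \<in> {0..2*pi}" "0 \<le> r" "r < 1" "\<kappa> < norm (f (of_real r * cis \<theta>))"
      by (auto simp: E_def)
    have "\<kappa> < integral {0..2*pi} (\<lambda>t. poisson (of_real r * cis \<theta>) t * ?g t) / (2*pi)"
      using r norm_le_Poisson[OF f, of "of_real r * cis \<theta>"] by (simp add: norm_mult)
    then have "\<not> integral {0..2*pi} (\<lambda>t. poisson (of_real r * cis \<theta>) t * ?g t) \<le> 2 * pi * \<kappa>"
      by (simp add: field_simps)
    then have "\<exists>h. 0 < h \<and> h \<le> pi \<and> 2 * h * \<kappa> < integral {\<theta>-h..\<theta>+h} ?g"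
      using poisson_integral_le_maximal[of ?g r \<theta> \<kappa>, OF continuous_on_norm[OF cf]] r
      by (auto simp: not_le[symmetric] simp flip: cis_mult)
    then show "\<theta> \<in> U" using U(3) r by auto
  qed
  then have "emeasure lborel E \<le> emeasure lborel U"
    using U(1) by (rule emeasure_mono)
  then show "emeasure lborel E \<le> ennreal (10 / \<kappa> * integral {0..2*pi} ?g)"
    using U(2) by (rule order_trans)
qed

subsection \<open>Uniform convexity and mean convergence of dilations\<close>

text \<open>The mean value theorem on the two halves of the interval, with a strictly increasing
  derivative. Only interior points are differentiated, which admits \<open>x = 0\<close>.\<close>

lemma powr_midpoint_less:
  fixes x y p :: real
  assumes "1 < p" "0 \<le> x" "x < y"
  shows "((x + y) / 2) powr p < (x powr p + y powr p) / 2"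
proof -
  define m where "m = (x + y) / 2"
  have m: "x < m" "m < y" "0 < m" using assms by (auto simp: m_def)
  have mvt: "\<exists>c. a < c \<and> c < b \<and> b powr p - a powr p = (b - a) * (p * c powr (p - 1))"
    if "0 \<le> a" "a < b" for a b
  proof -
    have d: "((\<lambda>x. x powr p) has_real_derivative p * c powr (p - 1)) (at c)" if "a < c" for c
      using that \<open>0 \<le> a\<close> by (intro has_real_derivative_powr) auto
    have "continuous_on {a..b} (\<lambda>x. x powr p)"
      using that assms by (intro continuous_intros) auto
    moreover have "(\<lambda>x. x powr p) differentiable (at c)" if "a < c" for c
      using d[OF that] real_differentiable_def by blast
    ultimately obtain l c where c: "a < c" "c < b" "((\<lambda>x. x powr p) has_real_derivative l) (at c)"
      "b powr p - a powr p = (b - a) * l"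
      using MVT[of a b "\<lambda>x. x powr p"] \<open>a < b\<close> by blast
    then show ?thesis using DERIV_unique[OF d[OF c(1)] c(3)] by auto
  qed
  obtain c1 c2 where c: "x < c1" "c1 < m" "m powr p - x powr p = (m - x) * (p * c1 powr (p - 1))"
    "m < c2" "c2 < y" "y powr p - m powr p = (y - m) * (p * c2 powr (p - 1))"
    using mvt[of x m] mvt[of m y] m assms by auto
  have "c1 powr (p - 1) < c2 powr (p - 1)"
    using c assms by (intro powr_less_mono2) auto
  then have "(m - x) * (p * c1 powr (p - 1)) < (m - x) * (p * c2 powr (p - 1))"
    using m assms by simp
  moreover have "y - m = m - x" by (simp add: m_def field_simps)
  ultimately have "m powr p - x powr p < y powr p - m powr p" using c by simp
  then show ?thesis by (simp add: m_def)
qed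

text \<open>Strictness has two sources. For equal moduli the parallelogram law shortens the
  midpoint; for different moduli the power function is strictly convex.\<close>

lemma norm_midpoint_powr_less:
  fixes a b :: complex
  assumes p: "1 < p" and ab: "a \<noteq> b"
  shows "norm ((a + b) / 2) powr p < (norm a powr p + norm b powr p) / 2"
proof -
  have tri: "norm ((a + b) / 2) \<le> (norm a + norm b) / 2"
    using norm_triangle_ineq[of a b] by (simp add: norm_divide)
  show ?thesis
  proof (cases "norm a = norm b")
    case True
    have "(norm (a + b))\<^sup>2 + (norm (a - b))\<^sup>2 = 2 * (norm a)\<^sup>2 + 2 * (norm b)\<^sup>2"
      by (simp only: cmod_power2) (simp add: power2_eq_square algebra_simps)
    moreover have "0 < (norm (a - b))\<^sup>2" using ab by simp
    ultimately have "(norm (a + b))\<^sup>2 < 4 * (norm a)\<^sup>2"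
      unfolding True by linarith
    then have "(norm (a + b))\<^sup>2 < (2 * norm a)\<^sup>2"
      by (simp add: power_mult_distrib)
    then have "norm (a + b) < 2 * norm a"
      by (rule power_less_imp_less_base) simp
    then have "norm ((a + b) / 2) < norm a" by (simp add: norm_divide)
    then have "norm ((a + b) / 2) powr p < norm a powr p"
      using p by (intro powr_less_mono2) auto
    then show ?thesis using True by simp
  next
    case False
    have "norm ((a + b) / 2) powr p \<le> ((norm a + norm b) / 2) powr p"
      using tri p by (intro powr_mono2) auto
    also have "\<dots> < (norm a powr p + norm b powr p) / 2"
    proof (cases "norm a < norm b")
      case True then show ?thesis using powr_midpoint_less[OF p _ True] by simp
    next
      case F: False
      then have "norm b < norm a" using False by simp
      from powr_midpoint_less[OF p _ this] show ?thesis by (simp add: add.commute)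
    qed
    finally show ?thesis .
  qed
qed

text \<open>Uniform convexity of \<open>L\<^sup>p\<close> in pointwise form; by homogeneity it is enough to consider the compact set
  \<open>\<bar>a\<bar>\<^sup>p + \<bar>b\<bar>\<^sup>p = 1\<close>.\<close>
lemma uniformly_convex_powr:
  assumes p: "1 < p" and e: "0 < e"
  obtains K where "0 \<le> K" "\<And>a b :: complex. norm (a - b) powr p \<le> e * (norm a powr p + norm b powr p)
      + K * ((norm a powr p + norm b powr p) / 2 - norm ((a + b) / 2) powr p)"
proof -
  \<comment> \<open>\<open>D\<close> is the convexity defect of a pair; \<open>S\<close> collects
    the normalised pairs that are at least \<open>e\<close> apart in p-th power. On the compact set
    \<open>S\<close> the defect has a positive minimum.\<close>
  define D where "D = (\<lambda>x::complex \<times> complex. (norm (fst x) powr p + norm (snd x) powr p) / 2 - norm ((fst x + snd x) / 2) powr p)"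
  define S where "S = {x::complex \<times> complex. norm (fst x) powr p + norm (snd x) powr p = 1 \<and> e \<le> norm (fst x - snd x) powr p}"
  have Dnn: "0 \<le> D x" for x
    using norm_midpoint_powr_less[OF p, of "fst x" "snd x"] by (cases "fst x = snd x") (auto simp: D_def)
  have le1: "norm a \<le> 1 \<and> norm b \<le> 1" if "norm a powr p + norm b powr p = 1" for a b :: complex
  proof -
    have "norm c \<le> 1" if "norm c powr p \<le> 1" for c :: complex
      using that p gr_one_powr[of "norm c" p] by linarith
    then show ?thesis using that powr_ge_zero[of "norm a" p] powr_ge_zero[of "norm b" p] by (metis add_increasing add_increasing2 order_refl)
  qed
  have "closed S" unfolding S_def
    using p by (intro closed_Collect_conj closed_Collect_eq closed_Collect_le continuous_intros) auto
  moreover have "bounded S"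
  proof -
    have "S \<subseteq> cball 0 1 \<times> cball 0 1" using le1 by (auto simp: S_def)
    then show ?thesis
      using bounded_subset[OF bounded_Times[OF bounded_cball bounded_cball]] by blast
  qed
  ultimately have S: "compact S" by (simp add: compact_eq_bounded_closed)
  have Dpos: "0 < D x" if "x \<in> S" for x
  proof -
    have "fst x \<noteq> snd x" using that e p by (auto simp: S_def)
    then show ?thesis using norm_midpoint_powr_less[OF p] by (simp add: D_def)
  qed
  have "\<exists>\<delta>>0. \<forall>x\<in>S. \<delta> \<le> D x"
  proof (cases "S = {}")
    case False
    have "continuous_on S D" unfolding D_def using p by (intro continuous_intros) auto
    then obtain x where "x \<in> S" "\<forall>y\<in>S. D x \<le> D y"
      using continuous_attains_inf[OF S False] by blast
    then show ?thesis using Dpos by blast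
  qed (auto intro: exI[of _ 1])
  then obtain \<delta> where \<delta>: "0 < \<delta>" "\<And>x. x \<in> S \<Longrightarrow> \<delta> \<le> D x" by blast
  \<comment> \<open>On \<open>S\<close> both moduli are at most 1, so the left side is at most
    \<open>2 powr p = K * \<delta>\<close> and the defect term pays for it; off \<open>S\<close> the
    term \<open>e\<close> suffices.\<close>
  define K where "K = 2 powr p / \<delta>"
  have K: "0 \<le> K" using \<delta> by (simp add: K_def)
  have unit: "norm (a - b) powr p \<le> e + K * D (a, b)" if "norm a powr p + norm b powr p = 1" for a b
  proof (cases "(a, b) \<in> S")
    case True
    have "norm (a - b) \<le> 2" using le1[OF that] norm_triangle_ineq4[of a b] by simp
    then have "norm (a - b) powr p \<le> 2 powr p" using p by (intro powr_mono2) auto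
    also have "\<dots> = K * \<delta>" using \<delta> by (simp add: K_def)
    also have "\<dots> \<le> K * D (a, b)" using \<delta>(2)[OF True] K by (rule mult_left_mono)
    finally show ?thesis using e by simp
  next
    case False
    then have "norm (a - b) powr p \<le> e" using that by (auto simp: S_def)
    then show ?thesis using K Dnn[of "(a, b)"] by (simp add: add_increasing2)
  qed
  have "norm (a - b) powr p \<le> e * (norm a powr p + norm b powr p) + K * D (a, b)" for a b
  proof (cases "a = 0 \<and> b = 0")
    case False
    define N where "N = norm a powr p + norm b powr p"
    have N: "0 < N" using False by (auto simp: N_def add_pos_nonneg add_nonneg_pos)
    \<comment> \<open>Both sides are homogeneous of degree \<open>p\<close>; \<open>c\<close>
      rescales the pair to \<open>N = 1\<close>.\<close>
    define c where "c = N powr (-1/p)"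
    have "c powr p = N powr (-1)" unfolding c_def powr_powr using p by simp
    then have "c powr p = 1 / N" using N by (simp add: powr_minus_divide)
    moreover have "0 \<le> c" by (simp add: c_def)
    ultimately have cn: "norm (c *\<^sub>R z) powr p = norm z powr p / N" for z :: complex
      by (simp add: powr_mult)
    have "norm (c *\<^sub>R a - c *\<^sub>R b) powr p \<le> e + K * D (c *\<^sub>R a, c *\<^sub>R b)"
      by (rule unit) (use N in \<open>simp add: cn del: norm_scaleR flip: add_divide_distrib N_def\<close>)
    also have "c *\<^sub>R a - c *\<^sub>R b = c *\<^sub>R (a - b)" by (simp add: scaleR_diff_right)
    also have "D (c *\<^sub>R a, c *\<^sub>R b) = D (a, b) / N"
    proof -
      have "(c *\<^sub>R a + c *\<^sub>R b) / 2 = c *\<^sub>R ((a + b) / 2)" by (simp add: scaleR_conv_of_real algebra_simps)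
      then show ?thesis
        unfolding D_def fst_conv snd_conv by (simp only: cn) (simp add: add_divide_distrib diff_divide_distrib)
    qed
    finally have "norm (a - b) powr p / N \<le> e + K * (D (a, b) / N)" by (simp only: cn)
    then show ?thesis using N by (simp add: N_def[symmetric] field_simps)
  qed (use p in \<open>simp add: D_def\<close>)
  then show ?thesis using K by (intro that[of K]) (auto simp: D_def)
qed

text \<open>The case of weight 1. Slices of holomorphic functions are continuous, so the gauge
  integral may replace the Lebesgue integral of \<open>wHardy\<close>.\<close>

definition hardy :: "real \<Rightarrow> (complex \<Rightarrow> complex) set" where
  "hardy p = {f. f holomorphic_on ball 0 1 \<and>
     (\<exists>B. \<forall>r\<in>{0..<1}. integral {0..2*pi} (\<lambda>\<theta>. norm (f (of_real r * cis \<theta>)) powr p) \<le> B)}"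

lemma hardy_holomorphic: "f \<in> hardy p \<Longrightarrow> f holomorphic_on ball 0 1"
  by (simp add: hardy_def)

text \<open>Dilates reach continuously to the closed disc, as the Cauchy and Poisson formulas
  require; statements about Hardy functions are proved for dilates first.\<close>

lemma dilate:
  assumes f: "f holomorphic_on ball 0 1" and s: "0 \<le> s" "s < 1"
  shows "continuous_on (cball 0 1) (\<lambda>z. f (complex_of_real s * z))"
    "(\<lambda>z. f (complex_of_real s * z)) holomorphic_on ball 0 1"
proof -
  have b: "complex_of_real s * z \<in> ball 0 1" if "norm z \<le> 1" for z
  proof -
    have "s * norm z \<le> s * 1" using that s by (intro mult_left_mono) auto
    then show ?thesis using s by (simp add: norm_mult)
  qed
  show "continuous_on (cball 0 1) (\<lambda>z. f (complex_of_real s * z))"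
    by (rule continuous_on_compose2[OF holomorphic_on_imp_continuous_on[OF f]]) (use b in \<open>auto intro!: continuous_intros\<close>)
  have "(f \<circ> (\<lambda>z. complex_of_real s * z)) holomorphic_on ball 0 1"
    by (rule holomorphic_on_compose_gen[OF _ f]) (use b in \<open>auto intro!: holomorphic_intros\<close>)
  then show "(\<lambda>z. f (complex_of_real s * z)) holomorphic_on ball 0 1" by (simp add: o_def)
qed

lemma continuous_on_ball_slice:
  assumes "f holomorphic_on ball 0 1" "continuous_on A r" "continuous_on A t"
    "\<And>x. x \<in> A \<Longrightarrow> \<bar>r x\<bar> < 1"
  shows "continuous_on A (\<lambda>x. f (of_real (r x) * cis (t x)))"
  using assms by (intro continuous_on_compose2[OF holomorphic_on_imp_continuous_on[OF assms(1)]] continuous_intros)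
    (auto simp: norm_mult)

lemma continuous_on_mean_powr:
  assumes "continuous_on {0..2*pi} g" "0 < p"
  shows "(\<lambda>\<theta>. norm (g \<theta> :: complex) powr p) integrable_on {0..2*pi}"
  using assms by (intro integrable_continuous_real continuous_intros) auto

text \<open>Let \<open>M\<close> be the supremum of the means and \<open>t\<close> a radius whose
  mean is almost \<open>M\<close>. For \<open>r\<close> and \<open>s\<close> near 1 the midpoint of
  the slices at \<open>r * t\<close> and \<open>s * t\<close> is close to the slice at
  \<open>t\<close>, hence has almost the mean \<open>M\<close>. Monotonicity of means passes this to
  the midpoint of the slices at \<open>r\<close> and \<open>s\<close>. A midpoint with nearly
  maximal mean forces the two slices together by uniform convexity.\<close>

lemma hardy_mean_Cauchy:
  assumes f: "f \<in> hardy p" and p: "1 < p" and e: "0 < e"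
  obtains R where "0 < R" "R < 1" "\<And>r s. R < r \<Longrightarrow> r < 1 \<Longrightarrow> R < s \<Longrightarrow> s < 1 \<Longrightarrow>
     integral {0..2*pi} (\<lambda>\<theta>. norm (f (of_real r * cis \<theta>) - f (of_real s * cis \<theta>)) powr p) < e"
proof -
  let ?m = "\<lambda>r. integral {0..2*pi} (\<lambda>\<theta>. norm (f (of_real r * cis \<theta>)) powr p)"
  have hf: "f holomorphic_on ball 0 1" using f by (rule hardy_holomorphic)
  have cf: "continuous_on A (\<lambda>\<theta>. f (of_real r * cis \<theta>))" if "0 \<le> r" "r < 1" for r A
    using that by (intro continuous_on_ball_slice hf continuous_intros) auto
  obtain B where "\<forall>r\<in>{0..<1}. ?m r \<le> B" using f by (auto simp: hardy_def)
  then have bdd: "bdd_above (?m ` {0..<1})" by (auto intro!: bdd_aboveI2)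
  define M where "M = (SUP r\<in>{0..<1}. ?m r)"
  have mM: "?m r \<le> M" if "0 \<le> r" "r < 1" for r
    unfolding M_def using that by (intro cSUP_upper bdd) auto
  have "0 \<le> ?m 0" using p by (intro integral_nonneg continuous_on_mean_powr continuous_intros) auto
  then have M0: "0 \<le> M" using mM[of 0] by linarith
  \<comment> \<open>The choices depend on each other in the order \<open>e1\<close>,
    \<open>K\<close>, \<open>d\<close>, \<open>t\<close>, \<open>\<delta>\<close>. They leave
    \<open>e / 2\<close> for the term with \<open>e1\<close> and \<open>e / 4\<close> for the
    defect; the summands 1 in the denominators keep them positive.\<close>
  define e1 where "e1 = e / (4 * (M + 1))"
  have e1: "0 < e1" "e1 * (2 * M) \<le> e / 2" using e M0 by (auto simp: e1_def field_simps)
  obtain K where K: "0 \<le> K" "\<And>a b :: complex. norm (a - b) powr p \<le> e1 * (norm a powr p + norm b powr p)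
      + K * ((norm a powr p + norm b powr p) / 2 - norm ((a + b) / 2) powr p)"
    using uniformly_convex_powr[OF p e1(1)] by blast
  define d where "d = e / (8 * (K + 1))"
  have d: "0 < d" "K * (2 * d) \<le> e / 4" using e K by (auto simp: d_def field_simps)
  have "\<exists>t\<in>{0..<1}. M - d < ?m t"
    using d less_cSUP_iff[of "{0..<1}" ?m "M - d"] bdd by (auto simp: M_def)
  then obtain t where t: "0 \<le> t" "t < 1" "M - d < ?m t" by auto
  \<comment> \<open>The extra factor \<open>t < 1\<close> keeps all points in a compact part of the
    open disc, so \<open>\<Psi>\<close> is continuous up to the corner \<open>(1, 1)\<close>, where
    it is the mean at \<open>t\<close>.\<close>
  define \<Psi> where "\<Psi> = (\<lambda>x::real\<times>real. integral {0..2*pi} (\<lambda>\<theta>.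
     norm ((f (of_real (fst x * t) * cis \<theta>) + f (of_real (snd x * t) * cis \<theta>)) / 2) powr p))"
  have "continuous_on ({0..1} \<times> {0..1}) \<Psi>"
    unfolding \<Psi>_def
  proof (rule integral_continuous_on_param_ivl)
    have "\<bar>u * t\<bar> < 1" if "0 \<le> u" "u \<le> 1" for u
      using that t mult_right_mono[of u 1 t] by (simp add: abs_mult)
    then have "continuous_on (({0..1} \<times> {0..1}) \<times> {0..2*pi})
       (\<lambda>y. norm ((f (complex_of_real (fst (fst y) * t) * cis (snd y)) + f (complex_of_real (snd (fst y) * t) * cis (snd y))) / 2) powr p)"
      using p by (intro continuous_on_powr_nonneg continuous_on_norm continuous_on_divide continuous_on_add
          continuous_on_ball_slice[OF hf] continuous_on_mult continuous_on_fst continuous_on_snd continuous_on_id continuous_on_const) auto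
    then show "continuous_on (({0..1} \<times> {0..1}) \<times> {0..2*pi})
      (\<lambda>(x, \<theta>). norm ((f (of_real (fst x * t) * cis \<theta>) + f (of_real (snd x * t) * cis \<theta>)) / 2) powr p)"
      by (simp add: case_prod_unfold)
  qed
  moreover have "\<Psi> (1, 1) = ?m t" by (simp add: \<Psi>_def)
  ultimately obtain \<delta> where \<delta>: "0 < \<delta>"
    "\<And>x. x \<in> {0..1} \<times> {0..1} \<Longrightarrow> dist x (1, 1) < \<delta> \<Longrightarrow> dist (\<Psi> x) (?m t) < d"
    unfolding continuous_on_iff using d by (metis atLeastAtMost_iff mem_Sigma_iff order_refl zero_le_one)
  define R where "R = max (1/2) (1 - \<delta> / 2)"
  have R: "0 < R" "R < 1" using \<delta> by (auto simp: R_def)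
  show ?thesis
  proof (rule that[OF R])
    fix r s assume rs: "R < r" "r < 1" "R < s" "s < 1"
    then have r0: "0 \<le> r" "0 \<le> s" using R by auto
    have "dist (r, s) (1, 1) \<le> dist r 1 + dist s 1"
      by (simp add: dist_Pair_Pair sqrt_sum_squares_le_sum)
    also have "\<dots> < \<delta>" using rs by (auto simp: dist_real_def R_def)
    finally have "dist (\<Psi> (r, s)) (?m t) < d" using rs r0 by (intro \<delta>(2)) auto
    then have \<Psi>: "M - 2 * d < \<Psi> (r, s)" using t by (auto simp: dist_real_def)
    let ?k = "\<lambda>z. (f (complex_of_real r * z) + f (complex_of_real s * z)) / 2"
    let ?j = "integral {0..2*pi} (\<lambda>\<theta>. norm (?k (cis \<theta>)) powr p)"
    have "\<Psi> (r, s) = integral {0..2*pi} (\<lambda>\<theta>. norm (?k (of_real t * cis \<theta>)) powr p)"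
      by (simp add: \<Psi>_def mult.assoc)
    \<comment> \<open>The factor \<open>t\<close> is removed by comparing the means of the
      holomorphic midpoint \<open>?k\<close> at the radii \<open>t\<close> and 1.\<close>
    also have "\<dots> \<le> ?j"
      using p t r0 rs by (intro integral_mean_le continuous_intros holomorphic_intros dilate hf) auto
    finally have j: "M - 2 * d < ?j" using \<Psi> by simp
    have i: "(\<lambda>\<theta>. norm (f (of_real u * cis \<theta>)) powr p) integrable_on {0..2*pi}" if "0 \<le> u" "u < 1" for u
      using that p by (intro continuous_on_mean_powr cf) auto
    have ij: "(\<lambda>\<theta>. norm (?k (cis \<theta>)) powr p) integrable_on {0..2*pi}"
      using p rs r0 by (intro continuous_on_mean_powr continuous_intros cf) auto
    let ?rhs = "\<lambda>\<theta>. (e1 + K / 2) * (norm (f (of_real r * cis \<theta>)) powr p)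
       + (e1 + K / 2) * (norm (f (of_real s * cis \<theta>)) powr p)
       - K * norm (?k (cis \<theta>)) powr p"
    have rhs: "(?rhs has_integral (e1 + K / 2) * ?m r + (e1 + K / 2) * ?m s - K * ?j) {0..2*pi}"
      using rs r0
      by (intro has_integral_diff has_integral_add has_integral_mult_right integrable_integral i ij)
    have "integral {0..2*pi} (\<lambda>\<theta>. norm (f (of_real r * cis \<theta>) - f (of_real s * cis \<theta>)) powr p)
       \<le> integral {0..2*pi} ?rhs"
    proof (rule integral_le)
      show "(\<lambda>\<theta>. norm (f (of_real r * cis \<theta>) - f (of_real s * cis \<theta>)) powr p) integrable_on {0..2*pi}"
        using p rs r0 by (intro continuous_on_mean_powr continuous_intros cf) auto
      show "?rhs integrable_on {0..2*pi}" using rhs by blast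
      show "norm (f (of_real r * cis \<theta>) - f (of_real s * cis \<theta>)) powr p \<le> ?rhs \<theta>" for \<theta>
        using K(2)[of "f (of_real r * cis \<theta>)" "f (of_real s * cis \<theta>)"]
        by (simp add: algebra_simps add_divide_distrib)
    qed
    also have "\<dots> = (e1 + K / 2) * ?m r + (e1 + K / 2) * ?m s - K * ?j"
      using rhs by (rule integral_unique)
    also have "\<dots> \<le> (e1 + K / 2) * M + (e1 + K / 2) * M - K * (M - 2 * d)"
      using K e1 rs r0 mM j by (intro diff_mono add_mono mult_left_mono) auto
    also have "\<dots> = e1 * (2 * M) + K * (2 * d)" by (simp add: algebra_simps)
    also have "\<dots> \<le> e / 2 + e / 4" using e1 d by simp
    also have "\<dots> < e" using e by simp
    finally show "integral {0..2*pi} (\<lambda>\<theta>. norm (f (of_real r * cis \<theta>) - f (of_real s * cis \<theta>)) powr p) < e" .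
  qed
qed

subsection \<open>Radial limits\<close>

text \<open>Passes from small p-th power means to small first power means, which the weak type
  estimate takes as input. Values up to \<open>e\<close> are absorbed by the constant, larger ones
  by the power.\<close>

lemma le_weighted_powr:
  fixes x e p :: real
  assumes "1 < p" "0 < e" "0 \<le> x"
  shows "x \<le> e + e powr (1 - p) * x powr p"
proof (cases "x \<le> e")
  case False
  then have "x = x powr p * x powr (1 - p)" using assms by (simp flip: powr_add)
  also have "\<dots> \<le> x powr p * e powr (1 - p)"
    using assms False by (intro mult_left_mono powr_mono2') auto
  finally show ?thesis using assms by (simp add: mult.commute)
qed (use assms in \<open>simp add: add_increasing2\<close>)

lemma archimedean_divide:
  fixes c d :: real
  assumes "0 < d"
  obtains N :: nat where "c / (real N + 1) < d"
proof -
  obtain N :: nat where "c / d < real N" using reals_Archimedean2 by blast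
  then have "c < d * real N" using assms by (simp add: field_simps)
  also have "\<dots> \<le> d * (real N + 1)" using assms by simp
  finally have "c / (real N + 1) < d" by (simp add: field_simps)
  then show ?thesis by (rule that)
qed

text \<open>A Cauchy criterion in which only the natural numbers \<open>k\<close> and
  \<open>N\<close> need countable set operations. The non-strict inequality makes the conditions on
  the radii closed, so the set of convergence will be Borel.\<close>

lemma convergent_at_left_iff:
  fixes g :: "real \<Rightarrow> complex"
  shows "(\<exists>l. (g \<longlongrightarrow> l) (at_left 1)) \<longleftrightarrow>
    (\<forall>k::nat. \<exists>N::nat. \<forall>r\<in>{1 - 1 / (real N + 1)<..<1}. \<forall>s\<in>{1 - 1 / (real N + 1)<..<1}. dist (g r) (g s) \<le> 1 / (real k + 1))"
    (is "?L \<longleftrightarrow> ?R")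
proof
  assume ?L
  then obtain l where l: "(g \<longlongrightarrow> l) (at_left 1)" by blast
  show ?R
  proof
    fix k :: nat
    have "eventually (\<lambda>r. dist (g r) l < 1 / (2 * (real k + 1))) (at_left 1)"
      by (rule tendstoD[OF l]) simp
    then obtain b where b: "b < 1" "\<And>r. b < r \<Longrightarrow> r < 1 \<Longrightarrow> dist (g r) l < 1 / (2 * (real k + 1))"
      by (auto simp: eventually_at_left_field)
    obtain N :: nat where "1 / (real N + 1) < 1 - b"
      using b(1) by (auto intro: archimedean_divide[of "1 - b" 1])
    then have N: "b < 1 - 1 / (real N + 1)" by simp
    show "\<exists>N::nat. \<forall>r\<in>{1 - 1 / (real N + 1)<..<1}. \<forall>s\<in>{1 - 1 / (real N + 1)<..<1}. dist (g r) (g s) \<le> 1 / (real k + 1)"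
    proof (intro exI[of _ N] ballI)
      fix r s assume rs: "r \<in> {1 - 1 / (real N + 1)<..<1}" "s \<in> {1 - 1 / (real N + 1)<..<1}"
      have "dist (g r) (g s) \<le> dist (g r) l + dist (g s) l" by (rule dist_triangle2)
      also have "\<dots> \<le> 1 / (2 * (real k + 1)) + 1 / (2 * (real k + 1))"
        using b(2)[of r] b(2)[of s] N rs by (intro add_mono) auto
      also have "\<dots> = 1 / (real k + 1)" by (simp add: field_simps)
      finally show "dist (g r) (g s) \<le> 1 / (real k + 1)" .
    qed
  qed
next
  assume R: ?R
  have "cauchy_filter (filtermap g (at_left 1))"
    unfolding cauchy_filter_metric_filtermap
  proof (intro allI impI)
    fix e :: real assume e: "0 < e"
    then obtain k :: nat where k: "1 / (real k + 1) < e" by (rule archimedean_divide)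
    obtain N :: nat where N: "\<forall>r\<in>{1 - 1 / (real N + 1)<..<1}. \<forall>s\<in>{1 - 1 / (real N + 1)<..<1}. dist (g r) (g s) \<le> 1 / (real k + 1)"
      using R by blast
    show "\<exists>P. eventually P (at_left 1) \<and> (\<forall>x y. P x \<and> P y \<longrightarrow> dist (g x) (g y) < e)"
    proof (intro exI[of _ "\<lambda>r. r \<in> {1 - 1 / (real N + 1)<..<1}"] conjI allI impI)
      show "eventually (\<lambda>r. r \<in> {1 - 1 / (real N + 1)<..<1}) (at_left 1)"
        by (rule eventually_at_left_real) simp
    qed (use N k in \<open>meson le_less_trans\<close>)
  qed
  moreover have "filtermap g (at_left 1) \<noteq> bot" by (simp add: filtermap_bot_iff)
  moreover have "complete (UNIV :: complex set)" by (rule complete_UNIV)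
  ultimately show ?L
    unfolding complete_uniform filterlim_def by auto
qed

text \<open>The failure set of \<open>P\<close> need not be measurable; it lies in the intersection
  of exceptional sets of measure at most 1/(n+1), which is null.\<close>

lemma AE_by_small_exceptional_sets:
  assumes "\<And>\<delta>. 0 < \<delta> \<Longrightarrow> \<exists>E\<in>sets M. emeasure M E \<le> ennreal \<delta> \<and> (\<forall>x\<in>space M - E. P x)"
  shows "AE x in M. P x"
proof -
  have "\<forall>n::nat. \<exists>E\<in>sets M. emeasure M E \<le> ennreal (1 / (real n + 1)) \<and> (\<forall>x\<in>space M - E. P x)"
    using assms by simp
  then obtain E where E: "\<And>n::nat. E n \<in> sets M" "\<And>n. emeasure M (E n) \<le> ennreal (1 / (real n + 1))"
    "\<And>n x. x \<in> space M - E n \<Longrightarrow> P x"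
    by metis
  define N where "N = (\<Inter>n. E n)"
  have N: "N \<in> sets M" unfolding N_def using E(1) by (intro sets.countable_INT) auto
  have "emeasure M N \<le> ennreal (1 / (real n + 1))" for n
    using E(1,2)[of n] emeasure_mono[of N "E n" M] by (force simp: N_def intro: order_trans)
  moreover have "(\<lambda>n. ennreal (1 / (real n + 1))) \<longlonglongrightarrow> ennreal 0"
    by (intro tendsto_ennrealI LIMSEQ_inverse_real_of_nat[unfolded inverse_eq_divide, THEN tendsto_cong[THEN iffD1, rotated]]) auto
  ultimately have "emeasure M N \<le> 0"
    using LIMSEQ_le_const[of "\<lambda>n. ennreal (1 / (real n + 1))" 0 "emeasure M N"] by auto
  then have "N \<in> null_sets M" using N by auto
  moreover have "{x \<in> space M. \<not> P x} \<subseteq> N" using E(3) by (auto simp: N_def)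
  ultimately show ?thesis by (rule AE_I')
qed

text \<open>For a fixed \<open>s\<close> near 1 the function \<open>f z - f (s * z)\<close> is small
  in mean, so its radial maximal function is at most \<open>\<kappa>\<close> off a small set. There
  the oscillation of \<open>f\<close> along a radius is inherited from \<open>f (s * z)\<close>,
  which is continuous up to the circle: near the end of the radius \<open>f\<close> stays within
  \<open>\<kappa> + \<kappa> / 2\<close> of a fixed value, and two such points differ by at most
  \<open>3 * \<kappa>\<close>. The maximal estimate needs continuity on the closed disc, hence the
  further dilation by \<open>t < 1\<close> and an increasing union as \<open>t\<close> tends to
  1.\<close>

lemma hardy_small_oscillation:
  assumes f: "f \<in> hardy p" and p: "1 < p" and \<kappa>: "0 < \<kappa>" and \<delta>: "0 < \<delta>"
  obtains E where "E \<in> sets borel" "emeasure lborel E \<le> ennreal \<delta>"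
    "\<And>\<theta>. \<theta> \<in> {0..2*pi} - E \<Longrightarrow> \<exists>R. 0 \<le> R \<and> R < 1 \<and> (\<forall>r\<in>{R<..<1}. \<forall>s\<in>{R<..<1}.
       dist (f (of_real r * cis \<theta>)) (f (of_real s * cis \<theta>)) \<le> 3 * \<kappa>)"
proof -
  have hf: "f holomorphic_on ball 0 1" using f by (rule hardy_holomorphic)
  have cf: "continuous_on A (\<lambda>\<theta>. f (of_real r * cis \<theta>))" if "0 \<le> r" "r < 1" for r A
    using that by (intro continuous_on_ball_slice hf continuous_intros) auto
  \<comment> \<open>The weak type bound is at most \<open>\<delta>\<close> once the first power mean
    is at most \<open>\<kappa> * \<delta> / 10\<close>; \<open>\<eta>\<close> and \<open>e\<close>
    each account for half of that in \<open>le_weighted_powr\<close>.\<close>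
  define \<eta> where "\<eta> = \<kappa> * \<delta> / (40 * pi)"
  have \<eta>: "0 < \<eta>" using \<kappa> \<delta> by (simp add: \<eta>_def)
  define e where "e = \<kappa> * \<delta> / 20 / \<eta> powr (1 - p)"
  have e: "0 < e" using \<kappa> \<delta> \<eta> by (simp add: e_def)
  obtain R where R: "0 < R" "R < 1" "\<And>r s. R < r \<Longrightarrow> r < 1 \<Longrightarrow> R < s \<Longrightarrow> s < 1 \<Longrightarrow>
     integral {0..2*pi} (\<lambda>\<theta>. norm (f (of_real r * cis \<theta>) - f (of_real s * cis \<theta>)) powr p) < e"
    using hardy_mean_Cauchy[OF f p e] by blast
  \<comment> \<open>The midpoint of \<open>R\<close> and 1 has a square above \<open>R\<close>,
    since the arithmetic mean exceeds the geometric one. Hence \<open>s * t > R\<close> for all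
    \<open>t \<ge> s\<close>.\<close>
  define s where "s = (1 + R) / 2"
  have s: "0 < s" "s < 1" using R by (auto simp: s_def)
  have sR: "R < s * s"
  proof -
    have "0 < (1 - R)\<^sup>2" using R by simp
    then show ?thesis by (simp add: s_def power2_eq_square field_simps)
  qed
  define E where "E = (\<lambda>t. {\<theta> \<in> {0..2*pi}. \<exists>r\<in>{0..<1}. \<kappa> < norm (f (complex_of_real t * (of_real r * cis \<theta>)) - f (complex_of_real (s * t) * (of_real r * cis \<theta>)))})"
  have E: "E t \<in> sets borel \<and> emeasure lborel (E t) \<le> ennreal \<delta>" if t: "s \<le> t" "t < 1" for t
  proof -
    have "s * s \<le> s * t" using t s by (intro mult_left_mono) auto
    then have stR: "R < s * t" using sR by linarith
    have st1: "s * t < 1" using s t by (smt (verit) mult_left_le_one_le)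
    have t0: "0 \<le> t" "0 \<le> s * t" using t s by auto
    let ?g = "\<lambda>z. f (complex_of_real t * z) - f (complex_of_real (s * t) * z)"
    have g: "continuous_on (cball 0 1) ?g" "?g holomorphic_on ball 0 1"
      using t t0 st1 by (intro continuous_on_diff holomorphic_on_diff dilate hf; simp)+
    have ig: "(\<lambda>\<theta>. norm (?g (cis \<theta>)) powr p) integrable_on {0..2*pi}"
      using t t0 st1 p by (intro continuous_on_mean_powr continuous_intros cf) auto
    have R': "R < t" using stR s t t0 by (smt (verit) mult_left_le_one_le)
    have "integral {0..2*pi} (\<lambda>\<theta>. norm (?g (cis \<theta>)))
       \<le> integral {0..2*pi} (\<lambda>\<theta>. \<eta> + \<eta> powr (1 - p) * norm (?g (cis \<theta>)) powr p)"
    proof (rule integral_le)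
      show "(\<lambda>\<theta>. norm (?g (cis \<theta>))) integrable_on {0..2*pi}"
        using t t0 st1 by (intro integrable_continuous_real continuous_intros cf) auto
      show "(\<lambda>\<theta>. \<eta> + \<eta> powr (1 - p) * norm (?g (cis \<theta>)) powr p) integrable_on {0..2*pi}"
        by (intro integrable_add integrable_const_ivl integrable_on_mult_right ig)
    qed (use le_weighted_powr p \<eta> in auto)
    also have "\<dots> = 2 * pi * \<eta> + \<eta> powr (1 - p) * integral {0..2*pi} (\<lambda>\<theta>. norm (?g (cis \<theta>)) powr p)"
      using ig by (subst Henstock_Kurzweil_Integration.integral_add) (auto intro: integrable_on_mult_right)
    also have "\<dots> \<le> 2 * pi * \<eta> + \<eta> powr (1 - p) * e"
      using R(3)[of t "s * t"] R' t stR st1 by (intro add_left_mono mult_left_mono) auto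
    also have "\<dots> = \<kappa> * \<delta> / 10" using \<eta> by (simp add: e_def \<eta>_def)
    finally have "10 / \<kappa> * integral {0..2*pi} (\<lambda>\<theta>. norm (?g (cis \<theta>))) \<le> \<delta>"
      using \<kappa> by (simp add: field_simps)
    then show ?thesis
      unfolding E_def using radial_maximal_weak_type[OF g \<kappa>] ennreal_leI order_trans by blast
  qed
  define t where "t = (\<lambda>n::nat. 1 - (1 - s) / (real n + 1))"
  have t: "s \<le> t n" "t n < 1" for n
  proof -
    have "(1 - s) / (real n + 1) \<le> (1 - s) / 1" using s by (intro divide_left_mono) auto
    moreover have "0 < (1 - s) / (real n + 1)" using s by simp
    ultimately show "s \<le> t n" "t n < 1" by (auto simp: t_def)
  qed
  \<comment> \<open>A point at radius \<open>r\<close> for the dilation \<open>u\<close> is the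
    point at radius \<open>u / v * r\<close> for the dilation \<open>v\<close>.\<close>
  have mono: "E u \<subseteq> E v" if "s \<le> u" "u \<le> v" "v < 1" for u v
  proof
    fix \<theta> assume "\<theta> \<in> E u"
    then obtain r where r: "\<theta> \<in> {0..2*pi}" "0 \<le> r" "r < 1"
      "\<kappa> < norm (f (complex_of_real u * (of_real r * cis \<theta>)) - f (complex_of_real (s * u) * (of_real r * cis \<theta>)))"
      by (auto simp: E_def)
    have uv: "0 < v" "0 \<le> u" using that s by auto
    then have "u / v * r \<le> 1 * r" using that r by (intro mult_right_mono) auto
    then have "u / v * r < 1" using r by linarith
    moreover have "0 \<le> u / v * r" using uv r by simp
    ultimately have "u / v * r \<in> {0..<1}" by simp
    moreover have "complex_of_real u * (of_real r * cis \<theta>) = complex_of_real v * (of_real (u / v * r) * cis \<theta>)"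
      "complex_of_real (s * u) * (of_real r * cis \<theta>) = complex_of_real (s * v) * (of_real (u / v * r) * cis \<theta>)"
      using uv by auto
    ultimately show "\<theta> \<in> E v" unfolding E_def using r by (simp only: mem_Collect_eq) metis
  qed
  define EE where "EE = (\<Union>n. E (t n))"
  have inc: "incseq (\<lambda>n. E (t n))"
  proof (rule incseq_SucI)
    fix n show "E (t n) \<subseteq> E (t (Suc n))"
      using t s by (intro mono) (auto simp: t_def field_simps)
  qed
  have m: "range (\<lambda>n. E (t n)) \<subseteq> sets lborel" using E t by auto
  have "emeasure lborel EE \<le> ennreal \<delta>"
    unfolding EE_def using SUP_emeasure_incseq[OF m inc, symmetric] E t by (auto intro: SUP_least)
  moreover have "EE \<in> sets borel" unfolding EE_def using E t by auto
  moreover have "\<exists>R. 0 \<le> R \<and> R < 1 \<and> (\<forall>r\<in>{R<..<1}. \<forall>u\<in>{R<..<1}.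
       dist (f (of_real r * cis \<theta>)) (f (of_real u * cis \<theta>)) \<le> 3 * \<kappa>)" if \<theta>: "\<theta> \<in> {0..2*pi} - EE" for \<theta>
  proof -
    \<comment> \<open>Each radius \<open>r < 1\<close> lies below some \<open>t n\<close>, and
      \<open>r / t n\<close> is then an admissible radius in the definition of
      \<open>E (t n)\<close>.\<close>
    have near: "dist (f (of_real r * cis \<theta>)) (f (of_real (s * r) * cis \<theta>)) \<le> \<kappa>"
      if r: "0 \<le> r" "r < 1" for r
    proof -
      obtain n :: nat where "(1 - s) / (real n + 1) < 1 - r"
        using r by (auto intro: archimedean_divide[of "1 - r" "1 - s"])
      then have n: "r < t n" by (simp add: t_def)
      then have tn: "0 < t n" "r / t n \<in> {0..<1}" using r by auto
      have "\<theta> \<notin> E (t n)" using \<theta> by (auto simp: EE_def)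
      then have "\<not> \<kappa> < norm (f (complex_of_real (t n) * (of_real (r / t n) * cis \<theta>)) - f (complex_of_real (s * t n) * (of_real (r / t n) * cis \<theta>)))"
        using \<theta> tn unfolding E_def by blast
      moreover have "complex_of_real (t n) * (of_real (r / t n) * cis \<theta>) = of_real r * cis \<theta>"
        "complex_of_real (s * t n) * (of_real (r / t n) * cis \<theta>) = of_real (s * r) * cis \<theta>"
        using tn by auto
      ultimately show ?thesis by (simp add: dist_norm not_less)
    qed
    have "continuous_on {0..1} (\<lambda>r. f (of_real (s * r) * cis \<theta>))"
    proof (intro continuous_on_ball_slice hf continuous_intros)
      fix r assume "r \<in> {0..1::real}"
      then have "s * r \<le> s" "0 \<le> s * r" using s by (auto intro: mult_left_le)
      then show "\<bar>s * r\<bar> < 1" using s by linarith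
    qed
    then obtain d where d: "0 < d" "\<And>r. r \<in> {0..1} \<Longrightarrow> dist r 1 < d \<Longrightarrow>
       dist (f (of_real (s * r) * cis \<theta>)) (f (of_real (s * 1) * cis \<theta>)) < \<kappa> / 2"
      unfolding continuous_on_iff using \<kappa> by (metis atLeastAtMost_iff half_gt_zero order_refl zero_le_one)
    show ?thesis
    proof (intro exI[of _ "max 0 (1 - d)"] conjI ballI)
      fix r u assume ru: "r \<in> {max 0 (1 - d)<..<1}" "u \<in> {max 0 (1 - d)<..<1}"
      have close: "dist (f (of_real w * cis \<theta>)) (f (of_real (s * 1) * cis \<theta>)) \<le> 3 * \<kappa> / 2"
        if "w \<in> {max 0 (1 - d)<..<1}" for w
        using dist_triangle[of "f (of_real w * cis \<theta>)" "f (of_real (s * 1) * cis \<theta>)" "f (of_real (s * w) * cis \<theta>)"]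
          near[of w] d(2)[of w] that by (auto simp: dist_real_def)
      show "dist (f (of_real r * cis \<theta>)) (f (of_real u * cis \<theta>)) \<le> 3 * \<kappa>"
        using dist_triangle2[of "f (of_real r * cis \<theta>)" "f (of_real u * cis \<theta>)" "f (of_real (s * 1) * cis \<theta>)"]
          close[OF ru(1)] close[OF ru(2)] by linarith
    qed (use d in auto)
  qed
  ultimately show ?thesis using that by blast
qed

lemma hardy_radial_limit:
  assumes f: "f \<in> hardy p" and p: "1 < p"
  shows "AE \<theta> in lborel. \<theta> \<in> {0..2*pi} \<longrightarrow> (\<exists>l. ((\<lambda>r. f (of_real r * cis \<theta>)) \<longlongrightarrow> l) (at_left 1))"
proof -
  have "AE \<theta> in lborel. \<forall>k::nat. \<theta> \<in> {0..2*pi} \<longrightarrow> (\<exists>R. 0 \<le> R \<and> R < 1 \<and> (\<forall>r\<in>{R<..<1}. \<forall>s\<in>{R<..<1}.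
       dist (f (of_real r * cis \<theta>)) (f (of_real s * cis \<theta>)) \<le> 1 / (real k + 1)))"
    unfolding AE_all_countable
  proof (intro allI AE_by_small_exceptional_sets)
    fix k :: nat and \<delta> :: real assume "0 < \<delta>"
    moreover have "3 * (1 / (3 * (real k + 1))) = 1 / (real k + 1)" by (simp add: field_simps)
    ultimately obtain E where "E \<in> sets borel" "emeasure lborel E \<le> ennreal \<delta>"
    "\<And>\<theta>. \<theta> \<in> {0..2*pi} - E \<Longrightarrow> \<exists>R. 0 \<le> R \<and> R < 1 \<and> (\<forall>r\<in>{R<..<1}. \<forall>s\<in>{R<..<1}.
       dist (f (of_real r * cis \<theta>)) (f (of_real s * cis \<theta>)) \<le> 1 / (real k + 1))"
      using hardy_small_oscillation[OF f p, of "1 / (3 * (real k + 1))" \<delta>] by auto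
    then show "\<exists>E\<in>sets lborel. emeasure lborel E \<le> ennreal \<delta> \<and> (\<forall>\<theta>\<in>space lborel - E.
       \<theta> \<in> {0..2*pi} \<longrightarrow> (\<exists>R. 0 \<le> R \<and> R < 1 \<and> (\<forall>r\<in>{R<..<1}. \<forall>s\<in>{R<..<1}.
       dist (f (of_real r * cis \<theta>)) (f (of_real s * cis \<theta>)) \<le> 1 / (real k + 1))))"
      by (intro bexI[of _ E]) auto
  qed
  then show ?thesis
  proof eventually_elim
    case (elim \<theta>)
    show ?case
    proof
      assume \<theta>: "\<theta> \<in> {0..2*pi}"
      show "\<exists>l. ((\<lambda>r. f (of_real r * cis \<theta>)) \<longlongrightarrow> l) (at_left 1)"
        unfolding convergent_at_left_iff
      proof
        fix k :: nat
        obtain R where R: "0 \<le> R" "R < 1" "\<forall>r\<in>{R<..<1}. \<forall>s\<in>{R<..<1}.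
          dist (f (of_real r * cis \<theta>)) (f (of_real s * cis \<theta>)) \<le> 1 / (real k + 1)"
          using elim \<theta> by blast
        obtain N :: nat where "1 / (real N + 1) < 1 - R"
          using R by (auto intro: archimedean_divide[of "1 - R" 1])
        then have N: "R < 1 - 1 / (real N + 1)" by simp
        show "\<exists>N::nat. \<forall>r\<in>{1 - 1 / (real N + 1)<..<1}. \<forall>s\<in>{1 - 1 / (real N + 1)<..<1}.
           dist (f (of_real r * cis \<theta>)) (f (of_real s * cis \<theta>)) \<le> 1 / (real k + 1)"
          using R(3) N by (intro exI[of _ N]) auto
      qed
    qed
  qed
qed

subsection \<open>Boundary values in \<open>L\<^sup>p\<close>\<close>

abbreviation circ :: "real measure" where
  "circ \<equiv> restrict_space lborel {0..2*pi}"

lemma LINT_circ: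
  fixes f :: "real \<Rightarrow> 'a::{banach, second_countable_topology}"
  shows "(LINT t:{0..2*pi}|lborel. f t) = integral\<^sup>L circ f"
  unfolding set_lebesgue_integral_def by (subst integral_restrict_space) auto

lemma set_integrable_circ:
  fixes f :: "real \<Rightarrow> 'a::{banach, second_countable_topology}"
  shows "set_integrable lborel {0..2*pi} f \<longleftrightarrow> integrable circ f"
  unfolding set_integrable_def by (subst integrable_restrict_space) auto

lemma continuous_circ:
  fixes g :: "real \<Rightarrow> 'a::euclidean_space"
  assumes "continuous_on {0..2*pi} g"
  shows "integrable circ g" "integral\<^sup>L circ g = integral {0..2*pi} g"
proof -
  have s: "set_integrable lborel {0..2*pi} g" using assms by (rule borel_integrable_atLeastAtMost')
  then show "integrable circ g" by (simp add: set_integrable_circ)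
  show "integral\<^sup>L circ g = integral {0..2*pi} g"
    using set_borel_integral_eq_integral(2)[OF s] by (simp add: LINT_circ)
qed

lemma continuous_circ_slice:
  fixes f :: "complex \<Rightarrow> complex"
  assumes "f holomorphic_on ball 0 1" "0 \<le> r" "r < 1"
  shows "continuous_on A (\<lambda>t. f (of_real r * cis t))"
  using assms by (intro continuous_on_ball_slice continuous_intros) auto

lemma measurable_circ: "f \<in> borel_measurable borel \<Longrightarrow> f \<in> borel_measurable circ"
  by (rule measurable_restrict_space1) simp

lemma borel_measurable_norm_powr:
  fixes u :: "'a \<Rightarrow> complex"
  shows "u \<in> borel_measurable M \<Longrightarrow> (\<lambda>x. norm (u x) powr p) \<in> borel_measurable M"
  by measurable

lemma norm_add_powr_le:
  fixes a b :: complex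
  assumes "0 \<le> p"
  shows "norm (a + b) powr p \<le> 2 powr p * (norm a powr p + norm b powr p)"
proof -
  define m where "m = max (norm a) (norm b)"
  have "norm (a + b) \<le> 2 * m" using norm_triangle_ineq[of a b] by (auto simp: m_def)
  then have "norm (a + b) powr p \<le> (2 * m) powr p" using assms by (intro powr_mono2) auto
  also have "\<dots> = 2 powr p * m powr p" by (simp add: powr_mult m_def)
  also have "m powr p \<le> norm a powr p + norm b powr p" by (auto simp: m_def max_def)
  finally show ?thesis by simp
qed

lemma Holder_inequality_complex:
  fixes f g :: "'a \<Rightarrow> complex"
  assumes pq: "1 < p" "1 < q" "1/p + 1/q = 1"
    and fm: "f \<in> borel_measurable M" and gm: "g \<in> borel_measurable M"
    and fi: "integrable M (\<lambda>x. norm (f x) powr p)" and gi: "integrable M (\<lambda>x. norm (g x) powr q)"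
  shows "integrable M (\<lambda>x. f x * g x)"
    and "norm (integral\<^sup>L M (\<lambda>x. f x * g x))
      \<le> (integral\<^sup>L M (\<lambda>x. norm (f x) powr p)) powr (1/p) * (integral\<^sup>L M (\<lambda>x. norm (g x) powr q)) powr (1/q)"
proof -
  note [measurable] = fm gm
  have "integrable M (\<lambda>x. norm (f x) powr p / p + norm (g x) powr q / q)"
    using fi gi by auto
  then show int: "integrable M (\<lambda>x. f x * g x)"
    by (rule Bochner_Integration.integrable_bound)
       (auto intro!: AE_I2 order_trans[OF Youngs_inequality[OF pq]] simp: norm_mult)
  define A where "A = integral\<^sup>L M (\<lambda>x. norm (f x) powr p)"
  define B where "B = integral\<^sup>L M (\<lambda>x. norm (g x) powr q)"
  have AB: "0 \<le> A" "0 \<le> B" by (auto simp: A_def B_def)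
  consider "A = 0" | "B = 0" | "0 < A" "0 < B" using AB by linarith
  then show "norm (integral\<^sup>L M (\<lambda>x. f x * g x)) \<le> A powr (1/p) * B powr (1/q)"
  proof cases
    case 1
    then have "AE x in M. norm (f x) powr p = 0"
      using integral_nonneg_eq_0_iff_AE[OF fi] by (simp add: A_def)
    then have "AE x in M. f x * g x = 0" by eventually_elim simp
    then show ?thesis by (simp add: integral_eq_zero_AE)
  next
    case 2
    then have "AE x in M. norm (g x) powr q = 0"
      using integral_nonneg_eq_0_iff_AE[OF gi] by (simp add: B_def)
    then have "AE x in M. f x * g x = 0" by eventually_elim simp
    then show ?thesis by (simp add: integral_eq_zero_AE)
  next
    case 3
    define a where "a = A powr (1/p)"
    define b where "b = B powr (1/q)"
    have ab: "0 < a" "0 < b" "a powr p = A" "b powr q = B"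
      using 3 pq by (auto simp: a_def b_def powr_powr)
    have "norm (f x * g x) / (a * b) \<le> norm (f x) powr p / (p * A) + norm (g x) powr q / (q * B)" for x
      using Youngs_inequality[OF pq, of "norm (f x) / a" "norm (g x) / b"] ab pq
      by (simp add: norm_mult powr_divide mult.commute)
    then have "integral\<^sup>L M (\<lambda>x. norm (f x * g x) / (a * b))
       \<le> integral\<^sup>L M (\<lambda>x. norm (f x) powr p / (p * A) + norm (g x) powr q / (q * B))"
      using fi gi int by (intro integral_mono) auto
    also have "\<dots> = A / (p * A) + B / (q * B)"
      using fi gi by (simp add: A_def B_def)
    also have "\<dots> = 1" using 3 pq by simp
    finally have "integral\<^sup>L M (\<lambda>x. norm (f x * g x)) \<le> a * b"
      using ab by (simp add: field_simps)
    then show ?thesis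
      unfolding a_def b_def by (rule order_trans[OF integral_norm_bound])
  qed
qed

section \<open>Measurability, integrability and mean approximation of radial limits\<close>

lemma bval_eqI: "((\<lambda>r. f (of_real r * cis t)) \<longlongrightarrow> l) (at_left 1) \<Longrightarrow> bval f t = l"
  unfolding bval_def by (rule tendsto_Lim) auto

lemma bval_continuous:
  assumes "continuous_on (cball 0 1) f"
  shows "bval f t = f (cis t)"
proof (rule bval_eqI)
  have "continuous_on {0..1} (\<lambda>r. f (of_real r * cis t))"
    by (intro continuous_on_disc_slice[OF assms] continuous_intros) auto
  then have "((\<lambda>r. f (of_real r * cis t)) \<longlongrightarrow> f (of_real 1 * cis t)) (at 1 within {0..1})"
    unfolding continuous_on_def by (rule bspec) simp
  then show "((\<lambda>r. f (of_real r * cis t)) \<longlongrightarrow> f (cis t)) (at_left 1)"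
    by (simp add: at_within_Icc_at_left)
qed

text \<open>A fixed sequence of radii tending to 1 from below, along which Fatou's lemma and the
  measurability of pointwise limits apply.\<close>

definition approach :: "nat \<Rightarrow> real" where
  "approach n = 1 - 1 / (real n + 2)"

lemma approach_bounds: "0 \<le> approach n" "approach n < 1"
  by (auto simp: approach_def field_simps)

lemma approach_at_left: "filterlim approach (at_left 1) sequentially"
proof -
  have "approach \<longlonglongrightarrow> 1 - 0"
    unfolding approach_def
    using LIMSEQ_ignore_initial_segment[OF lim_1_over_n, of 2]
    by (intro tendsto_diff tendsto_const) (simp add: add.commute)
  then show ?thesis
    using approach_bounds approach_bounds(2)[THEN less_imp_neq]
    by (auto simp: filterlim_at intro!: always_eventually)
qed

text \<open>Where the radial limit fails to exist, \<open>bval\<close> is the junk value \<open>THE l. False\<close>.\<close>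
lemma bval_measurable:
  assumes hf: "f holomorphic_on ball 0 1"
  shows "bval f \<in> borel_measurable borel"
proof -
  define C where "C = {t. \<exists>l. ((\<lambda>r. f (of_real r * cis t)) \<longlongrightarrow> l) (at_left 1)}"
  have cf: "continuous_on UNIV (\<lambda>t. f (of_real r * cis t))" if "0 \<le> r" "r < 1" for r
    using that hf by (intro continuous_circ_slice)
  let ?I = "\<lambda>N::nat. {1 - 1 / (real N + 1)<..<1}"
  \<comment> \<open>The intersections over \<open>r\<close> and \<open>s\<close> are uncountable but
    consist of closed sets; only those over \<open>k\<close> and \<open>N\<close> have to be
    countable.\<close>
  have "C = (\<Inter>k::nat. \<Union>N::nat. \<Inter>r\<in>?I N. \<Inter>s\<in>?I N. {t. dist (f (of_real r * cis t)) (f (of_real s * cis t)) \<le> 1 / (real k + 1)})"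
    unfolding C_def convergent_at_left_iff by auto
  also have "\<dots> \<in> sets borel"
  proof -
    have "closed (\<Inter>r\<in>?I N. \<Inter>s\<in>?I N. {t. dist (f (of_real r * cis t)) (f (of_real s * cis t)) \<le> 1 / (real k + 1)})" for k N :: nat
    proof (intro closed_INT ballI)
      fix r s :: real assume rs: "r \<in> ?I N" "s \<in> ?I N"
      have "0 \<le> 1 - 1 / (real N + 1)" by (simp add: field_simps)
      with rs have "0 \<le> r" "r < 1" "0 \<le> s" "s < 1" unfolding greaterThanLessThan_iff by linarith+
      then show "closed {t. dist (f (of_real r * cis t)) (f (of_real s * cis t)) \<le> 1 / (real k + 1)}"
        by (intro closed_Collect_le continuous_on_dist continuous_on_const cf)
    qed
    then show ?thesis
      by (intro sets.countable_INT sets.countable_UN image_subsetI borel_closed) auto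
  qed
  finally have C: "C \<in> sets borel" .
  have "bval f t = (if t \<in> C then lim (\<lambda>n. if t \<in> C then f (of_real (approach n) * cis t) else 0) else (THE l. False))" for t
  proof (cases "t \<in> C")
    case True
    then obtain l where l: "((\<lambda>r. f (of_real r * cis t)) \<longlongrightarrow> l) (at_left 1)"
      by (auto simp: C_def)
    then have "(\<lambda>n. f (of_real (approach n) * cis t)) \<longlonglongrightarrow> l"
      using approach_at_left by (rule filterlim_compose)
    then show ?thesis using True l by (simp add: limI bval_eqI)
  next
    case False
    then show ?thesis by (simp add: C_def bval_def t2_space_class.Lim_def)
  qed
  moreover have "(\<lambda>t. if t \<in> C then lim (\<lambda>n. if t \<in> C then f (of_real (approach n) * cis t) else 0) else (THE l. False))
     \<in> borel_measurable borel"
  proof -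
    note C[measurable]
    have "(\<lambda>t. if t \<in> C then f (of_real (approach n) * cis t) else 0) \<in> borel_measurable borel" for n
    proof -
      have [measurable]: "(\<lambda>t. f (of_real (approach n) * cis t)) \<in> borel_measurable borel"
        using cf approach_bounds by (intro borel_measurable_continuous_onI) auto
      show ?thesis by measurable
    qed
    then have [measurable]: "(\<lambda>t. lim (\<lambda>n. if t \<in> C then f (of_real (approach n) * cis t) else 0)) \<in> borel_measurable borel"
      by (rule borel_measurable_lim_metric)
    show ?thesis by measurable
  qed
  ultimately show ?thesis by (simp cong: measurable_cong)
qed

lemma hardy_bval_limit:
  assumes "f \<in> hardy p" "1 < p"
  shows "AE t in circ. ((\<lambda>r. f (of_real r * cis t)) \<longlongrightarrow> bval f t) (at_left 1)"
proof -
  have "AE t in lborel. t \<in> {0..2*pi} \<longrightarrow> ((\<lambda>r. f (of_real r * cis t)) \<longlongrightarrow> bval f t) (at_left 1)"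
    using hardy_radial_limit[OF assms] by eventually_elim (metis bval_eqI)
  then show ?thesis by (simp add: AE_restrict_space_iff)
qed

lemma nn_integral_circ_continuous:
  fixes g :: "real \<Rightarrow> real"
  assumes "continuous_on {0..2*pi} g" "\<And>t. 0 \<le> g t"
  shows "(\<integral>\<^sup>+t. ennreal (g t) \<partial>circ) = ennreal (integral {0..2*pi} g)"
  using assms continuous_circ[OF assms(1)] by (subst nn_integral_eq_integral) auto

text \<open>Fatou's lemma along \<open>approach\<close>. It is used with \<open>g = 0\<close> for
  integrability of the boundary values, and with \<open>g\<close> a slice for mean
  convergence.\<close>

lemma bval_powr_integral_le:
  assumes f: "f \<in> hardy p" and p: "1 < p" and g: "continuous_on {0..2*pi} g"
    and R: "R < 1" "\<And>r. R < r \<Longrightarrow> 0 \<le> r \<Longrightarrow> r < 1 \<Longrightarrow>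
      integral {0..2*pi} (\<lambda>t. norm (f (of_real r * cis t) - g t) powr p) \<le> B"
  shows "integrable circ (\<lambda>t. norm (bval f t - g t) powr p)"
    "integral\<^sup>L circ (\<lambda>t. norm (bval f t - g t) powr p) \<le> B"
proof -
  have hf: "f holomorphic_on ball 0 1" using f by (rule hardy_holomorphic)
  have bm: "bval f \<in> borel_measurable circ" using bval_measurable[OF hf] by (rule measurable_circ)
  have gm: "g \<in> borel_measurable circ" using continuous_circ(1)[OF g] by auto
  have cs: "continuous_on {0..2*pi} (\<lambda>t. norm (f (of_real (approach n) * cis t) - g t) powr p)" for n
    using approach_bounds p by (intro continuous_intros continuous_circ_slice[OF hf] g) auto
  have ev: "eventually (\<lambda>n. R < approach n) sequentially"
    using approach_at_left R(1) by (auto simp: filterlim_at intro: order_tendstoD)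
  obtain n0 where "R < approach n0" using eventually_happens[OF ev] by auto
  have "0 \<le> integral {0..2*pi} (\<lambda>t. norm (f (of_real (approach n0) * cis t) - g t) powr p)"
    by (intro integral_nonneg integrable_continuous_real cs) auto
  also have "\<dots> \<le> B" using R(2) \<open>R < approach n0\<close> approach_bounds by auto
  finally have B: "0 \<le> B" .
  have "(\<integral>\<^sup>+t. ennreal (norm (bval f t - g t) powr p) \<partial>circ)
      = (\<integral>\<^sup>+t. liminf (\<lambda>n. ennreal (norm (f (of_real (approach n) * cis t) - g t) powr p)) \<partial>circ)"
  proof (rule nn_integral_cong_AE)
    show "AE t in circ. ennreal (norm (bval f t - g t) powr p)
      = liminf (\<lambda>n. ennreal (norm (f (of_real (approach n) * cis t) - g t) powr p))"
      using hardy_bval_limit[OF f p]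
    proof eventually_elim
      case (elim t)
      have "(\<lambda>n. f (of_real (approach n) * cis t)) \<longlonglongrightarrow> bval f t"
        using elim approach_at_left by (rule filterlim_compose)
      then have "(\<lambda>n. norm (f (of_real (approach n) * cis t) - g t)) \<longlonglongrightarrow> norm (bval f t - g t)"
        by (intro tendsto_intros)
      then have "(\<lambda>n. norm (f (of_real (approach n) * cis t) - g t) powr p) \<longlonglongrightarrow> norm (bval f t - g t) powr p"
        using p by (intro tendsto_powr') auto
      then have "(\<lambda>n. ennreal (norm (f (of_real (approach n) * cis t) - g t) powr p)) \<longlonglongrightarrow> ennreal (norm (bval f t - g t) powr p)"
        by (rule tendsto_ennrealI)
      then show ?case using lim_imp_Liminf[OF trivial_limit_sequentially] by metis
    qed
  qed
  also have "\<dots> \<le> liminf (\<lambda>n. (\<integral>\<^sup>+t. ennreal (norm (f (of_real (approach n) * cis t) - g t) powr p) \<partial>circ))"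
    by (rule nn_integral_liminf) (use continuous_circ(1)[OF cs] in auto)
  also have "\<dots> \<le> ennreal B"
  proof (rule Liminf_le)
    show "eventually (\<lambda>n. (\<integral>\<^sup>+t. ennreal (norm (f (of_real (approach n) * cis t) - g t) powr p) \<partial>circ) \<le> ennreal B) sequentially"
      using ev
    proof eventually_elim
      case (elim n)
      then show ?case
        using R(2)[of "approach n"] approach_bounds
        by (subst nn_integral_circ_continuous[OF cs]) (auto intro: ennreal_leI)
    qed
  qed auto
  finally have le: "(\<integral>\<^sup>+t. ennreal (norm (bval f t - g t) powr p) \<partial>circ) \<le> ennreal B" .
  have m: "(\<lambda>t. norm (bval f t - g t) powr p) \<in> borel_measurable circ"
    using bm gm by measurable
  show i: "integrable circ (\<lambda>t. norm (bval f t - g t) powr p)"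
    using le by (intro integrableI_nonneg m) (auto intro: le_less_trans)
  show "integral\<^sup>L circ (\<lambda>t. norm (bval f t - g t) powr p) \<le> B"
    using le nn_integral_eq_integral[OF i] B by (auto simp: ennreal_le_iff)
qed

lemma hardy_bval_integrable:
  assumes f: "f \<in> hardy p" and p: "1 < p"
  shows "integrable circ (\<lambda>t. norm (bval f t) powr p)"
proof -
  obtain B where "\<forall>r\<in>{0..<1}. integral {0..2*pi} (\<lambda>t. norm (f (of_real r * cis t)) powr p) \<le> B"
    using f by (auto simp: hardy_def)
  then show ?thesis
    using bval_powr_integral_le(1)[OF f p continuous_on_const, of 0 0 B] by auto
qed

text \<open>In the mean Cauchy estimate one radius is sent to 1 by Fatou while the other stays
  fixed. Integrability at every radius, not only near 1, comes from
  \<open>norm_add_powr_le\<close>.\<close>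

lemma hardy_slice_tendsto_bval:
  assumes f: "f \<in> hardy p" and p: "1 < p"
  shows "((\<lambda>r. integral\<^sup>L circ (\<lambda>t. norm (bval f t - f (of_real r * cis t)) powr p)) \<longlongrightarrow> 0) (at_left 1)"
    and "0 \<le> r \<Longrightarrow> r < 1 \<Longrightarrow> integrable circ (\<lambda>t. norm (bval f t - f (of_real r * cis t)) powr p)"
proof -
  have hf: "f holomorphic_on ball 0 1" using f by (rule hardy_holomorphic)
  have cf: "continuous_on A (\<lambda>t. f (of_real r * cis t))" if "0 \<le> r" "r < 1" for r A
    using that hf by (intro continuous_circ_slice)
  show "((\<lambda>r. integral\<^sup>L circ (\<lambda>t. norm (bval f t - f (of_real r * cis t)) powr p)) \<longlongrightarrow> 0) (at_left 1)"
  proof (rule tendstoI)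
    fix e :: real assume e: "0 < e"
    obtain R where R: "0 < R" "R < 1" "\<And>r s. R < r \<Longrightarrow> r < 1 \<Longrightarrow> R < s \<Longrightarrow> s < 1 \<Longrightarrow>
      integral {0..2*pi} (\<lambda>t. norm (f (of_real r * cis t) - f (of_real s * cis t)) powr p) < e / 2"
      using hardy_mean_Cauchy[OF f p, of "e / 2"] e by auto
    have "dist (integral\<^sup>L circ (\<lambda>t. norm (bval f t - f (of_real r * cis t)) powr p)) 0 < e" if r: "R < r" "r < 1" for r
    proof -
      have "integral\<^sup>L circ (\<lambda>t. norm (bval f t - f (of_real r * cis t)) powr p) \<le> e / 2"
        by (rule bval_powr_integral_le(2)[OF f p cf R(2)]) (use r R in \<open>auto intro: less_imp_le\<close>)
      moreover have "0 \<le> integral\<^sup>L circ (\<lambda>t. norm (bval f t - f (of_real r * cis t)) powr p)" by simp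
      ultimately show ?thesis using e by (simp add: dist_real_def)
    qed
    then show "eventually (\<lambda>r. dist (integral\<^sup>L circ (\<lambda>t. norm (bval f t - f (of_real r * cis t)) powr p)) 0 < e) (at_left 1)"
      using R(2) by (auto simp: eventually_at_left_field)
  qed
  assume r: "0 \<le> r" "r < 1"
  have bd: "norm (bval f t - f (of_real r * cis t)) powr p
      \<le> 2 powr p * (norm (bval f t) powr p + norm (f (of_real r * cis t)) powr p)" for t
    using norm_add_powr_le[of p "bval f t" "- f (of_real r * cis t)"] p by simp
  have int: "integrable circ (\<lambda>t. 2 powr p * (norm (bval f t) powr p + norm (f (of_real r * cis t)) powr p))"
  proof (intro integrable_mult_right Bochner_Integration.integrable_add hardy_bval_integrable[OF f p] continuous_circ(1))
    show "continuous_on {0..2*pi} (\<lambda>t. norm (f (of_real r * cis t)) powr p)"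
      using p by (intro continuous_intros cf r) auto
  qed
  have meas: "(\<lambda>t. norm (bval f t - f (of_real r * cis t)) powr p) \<in> borel_measurable circ"
  proof -
    have "(\<lambda>t. f (of_real r * cis t)) \<in> borel_measurable circ"
      using continuous_circ(1)[OF cf[OF r]] by (rule borel_measurable_integrable)
    then show ?thesis
      by (intro borel_measurable_norm_powr borel_measurable_diff measurable_circ[OF bval_measurable[OF hf]])
  qed
  show "integrable circ (\<lambda>t. norm (bval f t - f (of_real r * cis t)) powr p)"
  proof (rule Bochner_Integration.integrable_bound[OF int meas], rule AE_I2)
    fix t
    show "norm (norm (bval f t - f (of_real r * cis t)) powr p)
      \<le> norm (2 powr p * (norm (bval f t) powr p + norm (f (of_real r * cis t)) powr p))"
      using order_trans[OF bd abs_ge_self] by simp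
  qed
qed

subsection \<open>The Riesz projection\<close>

lemma integral_sums_Weierstrass:
  fixes u :: "nat \<Rightarrow> real \<Rightarrow> complex"
  assumes c: "\<And>n. continuous_on {a..b} (u n)" and M: "\<And>n t. t \<in> {a..b} \<Longrightarrow> norm (u n t) \<le> M n" "summable M"
  shows "(\<lambda>n. integral {a..b} (u n)) sums integral {a..b} (\<lambda>t. \<Sum>n. u n t)"
proof -
  have ul: "uniform_limit {a..b} (\<lambda>n t. \<Sum>i<n. u i t) (\<lambda>t. \<Sum>n. u n t) sequentially"
    by (rule Weierstrass_m_test[OF M])
  have cs: "continuous_on {a..b} (\<lambda>t. \<Sum>i<n. u i t)" for n
    by (intro continuous_on_sum c)
  obtain I J where IJ: "\<And>n. ((\<lambda>t. \<Sum>i<n. u i t) has_integral I n) {a..b}"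
    "((\<lambda>t. \<Sum>n. u n t) has_integral J) {a..b}" "(I \<longlongrightarrow> J) sequentially"
    using uniform_limit_integral[OF ul cs] by auto
  have "I = (\<lambda>n. \<Sum>i<n. integral {a..b} (u i))"
    using integral_unique[OF IJ(1)]
    by (simp add: fun_eq_iff Henstock_Kurzweil_Integration.integral_sum integrable_continuous_real c)
  then show ?thesis
    using IJ(3) integral_unique[OF IJ(2)] by (simp add: sums_def)
qed

lemma integral_of_real_Icc:
  fixes f :: "real \<Rightarrow> real"
  assumes "f integrable_on {a..b}"
  shows "integral {a..b} (\<lambda>x. complex_of_real (f x)) = of_real (integral {a..b} f)"
  using integral_linear[OF assms bounded_linear_of_real] by (simp add: o_def)

text \<open>The Riesz projection read inside the disc: its Taylor coefficients are the Fourier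
  coefficients of \<open>g\<close> at nonnegative frequencies.\<close>

definition cauchy_int :: "(real \<Rightarrow> complex) \<Rightarrow> complex \<Rightarrow> complex" where
  "cauchy_int g z = integral {0..2*pi} (\<lambda>t. g t / (1 - z * cis (-t))) / (2*pi)"

definition fourier_coeff :: "(real \<Rightarrow> complex) \<Rightarrow> nat \<Rightarrow> complex" where
  "fourier_coeff g n = integral {0..2*pi} (\<lambda>t. g t * cis (-t) ^ n) / (2*pi)"

lemma one_minus_cis_nonzero: "norm z < 1 \<Longrightarrow> 1 - z * cis t \<noteq> 0"
proof
  assume "norm z < 1" "1 - z * cis t = 0"
  then have "norm (z * cis t) = 1" by (metis eq_iff_diff_eq_0 norm_one)
  then show False using \<open>norm z < 1\<close> by (simp add: norm_mult)
qed

lemma continuous_on_bounded_Icc: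
  fixes g :: "real \<Rightarrow> complex"
  assumes "continuous_on {a..b} g"
  obtains B where "0 \<le> B" "\<And>t. t \<in> {a..b} \<Longrightarrow> norm (g t) \<le> B"
proof -
  have "bounded (g ` {a..b})"
    by (rule compact_imp_bounded[OF compact_continuous_image[OF assms compact_Icc]])
  then obtain B where "\<forall>x\<in>g ` {a..b}. norm x \<le> B" by (auto simp: bounded_iff)
  then show ?thesis by (intro that[of "max B 0"]) (auto simp: le_max_iff_disj)
qed

lemma cauchy_int_sums:
  assumes g: "continuous_on {0..2*pi} g" and z: "norm z < 1"
  shows "(\<lambda>n. fourier_coeff g n * z ^ n) sums cauchy_int g z"
proof -
  obtain B where B: "0 \<le> B" "\<And>t. t \<in> {0..2*pi} \<Longrightarrow> norm (g t) \<le> B"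
    using continuous_on_bounded_Icc[OF g] by blast
  have "(\<lambda>n. integral {0..2*pi} (\<lambda>t. g t * (z * cis (-t)) ^ n)) sums
     integral {0..2*pi} (\<lambda>t. \<Sum>n. g t * (z * cis (-t)) ^ n)"
  proof (rule integral_sums_Weierstrass)
    show "continuous_on {0..2*pi} (\<lambda>t. g t * (z * cis (-t)) ^ n)" for n
      by (intro continuous_intros g)
    show "norm (g t * (z * cis (-t)) ^ n) \<le> B * norm z ^ n" if "t \<in> {0..2*pi}" for n t
      using B(2)[OF that] by (simp add: norm_mult norm_power mult_right_mono)
    show "summable (\<lambda>n. B * norm z ^ n)"
      using z by (intro summable_mult summable_geometric) simp
  qed
  moreover have "(\<Sum>n. g t * (z * cis (-t)) ^ n) = g t / (1 - z * cis (-t))" for t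
  proof -
    have "norm (z * cis (-t)) < 1" using z by (simp add: norm_mult)
    then show ?thesis
      using sums_mult[OF geometric_sums, of "z * cis (-t)" "g t"] by (simp add: sums_iff)
  qed
  moreover have "integral {0..2*pi} (\<lambda>t. g t * (z * cis (-t)) ^ n) = z ^ n * integral {0..2*pi} (\<lambda>t. g t * cis (-t) ^ n)" for n
  proof -
    have "(\<lambda>t. g t * (z * cis (-t)) ^ n) = (\<lambda>t. z ^ n * (g t * cis (-t) ^ n))"
      by (simp add: fun_eq_iff power_mult_distrib)
    then show ?thesis by (simp only: integral_mult_right)
  qed
  ultimately have "(\<lambda>n. z ^ n * integral {0..2*pi} (\<lambda>t. g t * cis (-t) ^ n) / (2*pi)) sums
    (integral {0..2*pi} (\<lambda>t. g t / (1 - z * cis (-t))) / (2*pi))"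
    by (intro sums_divide) simp
  then show ?thesis
    by (simp add: cauchy_int_def fourier_coeff_def mult.commute)
qed

lemma cauchy_int_holomorphic:
  assumes "continuous_on {0..2*pi} g"
  shows "cauchy_int g holomorphic_on ball 0 1"
  using cauchy_int_sums[OF assms] by (intro power_series_holomorphic) auto

lemma cauchy_int_integrable:
  assumes "continuous_on {0..2*pi} g" "norm z < 1"
  shows "(\<lambda>t. g t / (1 - z * cis (-t))) integrable_on {0..2*pi}"
  using assms one_minus_cis_nonzero[OF assms(2)]
  by (intro integrable_continuous_real continuous_intros) auto

lemma cauchy_int_add:
  assumes "continuous_on {0..2*pi} g" "continuous_on {0..2*pi} h" "norm z < 1"
  shows "cauchy_int (\<lambda>t. g t + h t) z = cauchy_int g z + cauchy_int h z"
  using assms by (simp add: cauchy_int_def add_divide_distrib Henstock_Kurzweil_Integration.integral_add cauchy_int_integrable)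

lemma cauchy_int_cmult: "cauchy_int (\<lambda>t. c * g t) z = c * cauchy_int g z"
proof -
  have "(\<lambda>t. c * g t / (1 - z * cis (-t))) = (\<lambda>t. c * (g t / (1 - z * cis (-t))))" by (simp add: fun_eq_iff)
  then have "integral {0..2*pi} (\<lambda>t. c * g t / (1 - z * cis (-t)))
      = c * integral {0..2*pi} (\<lambda>t. g t / (1 - z * cis (-t)))"
    by (simp only: integral_mult_right)
  then show ?thesis by (simp add: cauchy_int_def)
qed

text \<open>\<open>Re (w\<^sup>p)\<close> is harmonic on the half plane, so this pointwise bound turns into an \<open>L\<^sup>p\<close> bound of a holomorphic
  function by its positive real part.\<close>
lemma half_plane_powr_bound:
  fixes p :: real
  assumes p: "1 < p" "p \<le> 2"
  obtains A B where "0 \<le> A" "0 \<le> B"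
    "\<And>w. 0 < Re w \<Longrightarrow> norm w powr p \<le> A * Re w powr p - B * Re (w powr (of_real p))"
proof -
  \<comment> \<open>An angle strictly between \<open>pi / (2 * p)\<close> and \<open>pi / 2\<close>:
    there \<open>cos \<phi>\<close> is still positive while \<open>cos (p * \<phi>)\<close> is
    already negative. The condition \<open>p \<le> 2\<close> keeps \<open>p * \<phi>\<close> and
    \<open>p * t\<close> within \<open>pi\<close>, where the cosine decreases.\<close>
  define \<phi> where "\<phi> = (pi / (2 * p) + pi / 2) / 2"
  have lt: "pi / (2 * p) < pi / 2" using p by (simp add: field_simps)
  have \<phi>: "pi / (2 * p) < \<phi>" "\<phi> < pi / 2" "0 < \<phi>" using lt p by (auto simp: \<phi>_def field_simps add_pos_pos)
  have p\<phi>: "pi / 2 < p * \<phi>" using \<phi>(1) p by (simp add: field_simps)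
  have p\<phi>': "p * \<phi> \<le> pi"
  proof -
    have "p * \<phi> \<le> 2 * (pi / 2)" using p \<phi> by (intro mult_mono) auto
    then show ?thesis by simp
  qed
  have c: "cos (p * \<phi>) < 0" using p\<phi> p\<phi>' cos_lt_zero_pi[of "p * \<phi>"] by simp
  have cp: "0 < cos \<phi>" using \<phi> by (intro cos_gt_zero) auto
  \<comment> \<open>\<open>B\<close> makes the harmonic term at least 1 for angles beyond
    \<open>\<phi>\<close>; \<open>A\<close> makes the real part outweigh \<open>1 + B\<close> for
    angles up to \<open>\<phi>\<close>.\<close>
  define B where "B = 1 / (- cos (p * \<phi>))"
  define A where "A = (1 + B) / cos \<phi> powr p"
  have B: "0 \<le> B" using c by (simp add: B_def)
  have A: "0 \<le> A" using B by (simp add: A_def)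
  have angle: "1 \<le> A * cos t powr p - B * cos (p * t)" if t: "0 \<le> t" "t < pi / 2" for t
  proof (cases "t \<le> \<phi>")
    case True
    have "cos \<phi> \<le> cos t" using True t \<phi> by (intro cos_monotone_0_pi_le) auto
    then have "A * cos \<phi> powr p \<le> A * cos t powr p" using A cp p by (intro mult_left_mono powr_mono2) auto
    moreover have "A * cos \<phi> powr p = 1 + B" using cp by (simp add: A_def)
    moreover have "B * cos (p * t) \<le> B * 1" using B by (intro mult_left_mono) auto
    ultimately show ?thesis by linarith
  next
    case False
    have "p * t \<le> 2 * (pi / 2)" using p t by (intro mult_mono) auto
    moreover have "p * \<phi> \<le> p * t" using False p by (intro mult_left_mono) auto
    ultimately have "cos (p * t) \<le> cos (p * \<phi>)" using p \<phi> by (intro cos_monotone_0_pi_le) auto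
    then have "B * cos (p * t) \<le> B * cos (p * \<phi>)" using B by (rule mult_left_mono)
    also have "\<dots> = -1" using c by (simp add: B_def)
    finally have "B * cos (p * t) \<le> -1" .
    moreover have "0 \<le> A * cos t powr p" using A by simp
    ultimately show ?thesis by linarith
  qed
  show ?thesis
  proof (rule that[OF A B])
    fix w :: complex assume w: "0 < Re w"
    then have w0: "w \<noteq> 0" by auto
    define t where "t = Im (Ln w)"
    have t: "\<bar>t\<bar> < pi / 2" using Re_Ln_pos_lt_imp[OF w] by (simp add: t_def)
    have Ln: "Ln w = Complex (ln (norm w)) t" using w0 by (simp add: t_def complex_eq_iff)
    have "Re (exp (Ln w)) = norm w * cos t" using w0 by (simp add: Ln Re_exp)
    then have Rew: "Re w = norm w * cos t" using w0 by simp
    have "Re (w powr of_real p) = norm w powr p * cos (p * t)"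
      using w0 by (simp add: powr_def Ln Re_exp)
    moreover have "Re w powr p = norm w powr p * cos t powr p"
      using t cos_gt_zero_pi[of t] by (simp add: Rew powr_mult)
    moreover have "1 \<le> A * cos t powr p - B * cos (p * t)"
    proof (cases "0 \<le> t")
      case True then show ?thesis using angle t by simp
    next
      case False then show ?thesis using angle[of "-t"] t by simp
    qed
    then have "norm w powr p * 1 \<le> norm w powr p * (A * cos t powr p - B * cos (p * t))"
      by (rule mult_left_mono) simp
    ultimately show "norm w powr p \<le> A * Re w powr p - B * Re (w powr of_real p)"
      by (simp add: algebra_simps)
  qed
qed

text \<open>The power of \<open>F\<close> is holomorphic because \<open>F\<close> takes values in
  the right half plane. By the mean value property its integral over the circle is 2 pi times its
  value at 0, which is positive since \<open>F 0\<close> is a positive real; the term with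
  \<open>B\<close> can therefore be dropped.\<close>

lemma integral_powr_half_plane_le:
  assumes hF: "F holomorphic_on ball 0 1" and pos: "\<And>z. norm z < 1 \<Longrightarrow> 0 < Re (F z)"
    and F0: "Im (F 0) = 0" and p: "1 < p" and r: "0 \<le> r" "r < 1" and A: "0 \<le> A" "0 \<le> B"
    and bd: "\<And>w. 0 < Re w \<Longrightarrow> norm w powr p \<le> A * Re w powr p - B * Re (w powr (of_real p))"
  shows "integral {0..2*pi} (\<lambda>\<theta>. norm (F (of_real r * cis \<theta>)) powr p)
       \<le> A * integral {0..2*pi} (\<lambda>\<theta>. Re (F (of_real r * cis \<theta>)) powr p)"
proof -
  let ?F = "\<lambda>\<theta>. F (of_real r * cis \<theta>)"
  have in_disc: "norm (complex_of_real r * z) < 1" if "norm z \<le> 1" for z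
  proof -
    have "r * norm z \<le> r * 1" using that r by (intro mult_left_mono) auto
    then show ?thesis using r by (simp add: norm_mult)
  qed
  have Rep: "0 < Re (F (complex_of_real r * z))" if "norm z \<le> 1" for z
    using pos[OF in_disc[OF that]] .
  have nr: "F (complex_of_real r * z) \<notin> \<real>\<^sub>\<le>\<^sub>0" if "norm z \<le> 1" for z
    using Rep[OF that] by (auto simp: complex_nonpos_Reals_iff)
  let ?k = "\<lambda>z. F (complex_of_real r * z) powr (of_real p)"
  have k: "continuous_on (cball 0 1) ?k" "?k holomorphic_on ball 0 1"
  proof -
    show "continuous_on (cball 0 1) ?k"
      using Rep by (intro continuous_on_powr_complex dilate(1)[OF hF r] continuous_on_const)
        (fastforce simp: less_le)+
    show "?k holomorphic_on ball 0 1"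
      using nr by (intro holomorphic_on_powr dilate(2)[OF hF r] holomorphic_on_const) auto
  qed
  have "((\<lambda>t. ?k (cis t)) has_integral 2 * pi * ?k 0) {0..2*pi}"
    using Cauchy_circle[OF k, of 0] by simp
  from has_integral_linear[OF this bounded_linear_Re]
  have Rek: "((\<lambda>t. Re (?F t powr of_real p)) has_integral Re (2 * pi * F 0 powr of_real p)) {0..2*pi}"
    by (simp add: o_def)
  have "F 0 = of_real (Re (F 0))" using F0 by (simp add: complex_eq_iff)
  then have "F 0 powr of_real p = of_real (Re (F 0) powr p)"
    using pos[of 0] by (metis less_imp_le norm_zero powr_of_real zero_less_one)
  then have "0 \<le> Re (2 * pi * F 0 powr of_real p)" by simp
  have cF: "continuous_on {0..2*pi} ?F" using continuous_circ_slice[OF hF r] .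
  have rp: "0 < Re (?F \<theta>)" for \<theta> using in_disc[of "cis \<theta>"] pos by simp
  have "(\<lambda>\<theta>. Re (?F \<theta>) powr p) integrable_on {0..2*pi}"
    using p rp by (intro integrable_continuous_real continuous_intros cF) (auto intro: less_imp_le)
  then have rhs: "((\<lambda>\<theta>. A * Re (?F \<theta>) powr p - B * Re (?F \<theta> powr of_real p)) has_integral
     A * integral {0..2*pi} (\<lambda>\<theta>. Re (?F \<theta>) powr p) - B * Re (2 * pi * F 0 powr of_real p)) {0..2*pi}"
    by (intro has_integral_diff has_integral_mult_right Rek integrable_integral)
  have "integral {0..2*pi} (\<lambda>\<theta>. norm (?F \<theta>) powr p)
      \<le> A * integral {0..2*pi} (\<lambda>\<theta>. Re (?F \<theta>) powr p) - B * Re (2 * pi * F 0 powr of_real p)"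
  proof (rule has_integral_le[OF _ rhs])
    show "((\<lambda>\<theta>. norm (?F \<theta>) powr p) has_integral integral {0..2*pi} (\<lambda>\<theta>. norm (?F \<theta>) powr p)) {0..2*pi}"
      using p cF by (intro integrable_integral continuous_on_mean_powr) auto
  qed (use bd rp in auto)
  also have "\<dots> \<le> A * integral {0..2*pi} (\<lambda>\<theta>. Re (?F \<theta>) powr p)"
    using A(2) \<open>0 \<le> Re (2 * pi * F 0 powr of_real p)\<close> by simp
  finally show ?thesis .
qed

lemma poisson_0: "poisson 0 t = 1"
  by (simp add: poisson_def)

text \<open>Twice the Cauchy kernel minus 1 has the Poisson kernel as real part. So twice the Cauchy
  integral of nonnegative data, minus their mean, has nonnegative real part.\<close>

lemma herglotz_kernel:
  assumes "norm z < 1"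
  shows "2 / (1 - z * cis (-t)) - 1 = (cis t + z) / (cis t - z)"
    and "Re ((cis t + z) / (cis t - z)) = poisson z t"
proof -
  have nz: "cis t - z \<noteq> 0" using cis_minus_nonzero[OF assms] .
  have e: "1 - z * cis (-t) = (cis t - z) * cis (-t)" by (simp add: algebra_simps cis_mult)
  show "2 / (1 - z * cis (-t)) - 1 = (cis t + z) / (cis t - z)"
  proof -
    have a: "2 / ((cis t - z) * cis (-t)) = 2 * cis t / (cis t - z)"
      unfolding cis_inverse[symmetric] by (simp add: divide_inverse)
    have b: "2 * cis t / (cis t - z) - 1 = (2 * cis t - (cis t - z)) / (cis t - z)"
      using diff_divide_distrib[of "2 * cis t" "cis t - z" "cis t - z"] divide_self[OF nz] by metis
    have c: "2 * cis t - (cis t - z) = cis t + z" by simp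
    show ?thesis by (simp only: e a b c)
  qed
  have "(cis t + z) / (cis t - z) = (cis t + z) * cnj (cis t - z) / of_real ((norm (cis t - z))\<^sup>2)"
    by (rule complex_div_cnj)
  moreover have "Re ((cis t + z) * cnj (cis t - z)) = 1 - (norm z)\<^sup>2"
  proof -
    have "Re ((cis t + z) * cnj (cis t - z)) = ((cos t)\<^sup>2 + (sin t)\<^sup>2) - ((Re z)\<^sup>2 + (Im z)\<^sup>2)"
      by (simp add: power2_eq_square algebra_simps del: sin_cos_squared_add sin_cos_squared_add2)
    then show ?thesis by (simp add: cmod_power2)
  qed
  ultimately show "Re ((cis t + z) / (cis t - z)) = poisson z t"
    by (simp add: poisson_def Re_divide_of_real del: of_real_power)
qed

text \<open>With \<open>G\<close> the Cauchy integral and \<open>m\<close> the mean of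
  \<open>g\<close>, the function \<open>F = 2 * G - m\<close> has the Poisson integral of
  \<open>g\<close> as real part and the real value \<open>m\<close> at 0. The half plane estimate
  bounds \<open>F\<close> by its real part, and Poisson contraction bounds that by \<open>g\<close>.
  Returning to \<open>G\<close> costs the mean, which accounts for the 1 in
  \<open>A + 1\<close>.\<close>

lemma riesz_projection_nonneg:
  fixes g :: "real \<Rightarrow> real"
  assumes p: "1 < p" and A: "0 \<le> A" "0 \<le> B"
    and bd: "\<And>w. 0 < Re w \<Longrightarrow> norm w powr p \<le> A * Re w powr p - B * Re (w powr (of_real p))"
    and g: "continuous_on {0..2*pi} g" "\<And>t. t \<in> {0..2*pi} \<Longrightarrow> 0 \<le> g t" and r: "0 \<le> r" "r < 1"
  shows "integral {0..2*pi} (\<lambda>\<theta>. norm (cauchy_int (\<lambda>t. of_real (g t)) (of_real r * cis \<theta>)) powr p)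
       \<le> (A + 1) * integral {0..2*pi} (\<lambda>t. g t powr p)"
proof (cases "\<forall>t\<in>{0..2*pi}. g t = 0")
  \<comment> \<open>Zero data are treated apart: the power of \<open>F\<close> needs a strictly
    positive real part, and that holds as soon as \<open>g\<close> is not identically zero.\<close>
  case True
  have "cauchy_int (\<lambda>t. of_real (g t)) z = 0" for z
  proof -
    have "integral {0..2*pi} (\<lambda>t. complex_of_real (g t) / (1 - z * cis (-t))) = integral {0..2*pi} (\<lambda>t. 0)"
      using True by (intro Henstock_Kurzweil_Integration.integral_cong) auto
    then show ?thesis by (simp add: cauchy_int_def)
  qed
  moreover have "integral {0..2*pi} (\<lambda>t. g t powr p) = integral {0..2*pi} (\<lambda>t. 0)"
    using True by (intro Henstock_Kurzweil_Integration.integral_cong) auto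
  ultimately show ?thesis by simp
next
  case False
  define m where "m = integral {0..2*pi} g / (2*pi)"
  have gc: "continuous_on {0..2*pi} (\<lambda>t. complex_of_real (g t))" by (intro continuous_intros g)
  define G where "G = cauchy_int (\<lambda>t. of_real (g t))"
  define F where "F = (\<lambda>z. 2 * G z - of_real m)"
  have hG: "G holomorphic_on ball 0 1" unfolding G_def by (rule cauchy_int_holomorphic[OF gc])
  have hF: "F holomorphic_on ball 0 1" unfolding F_def by (intro holomorphic_intros hG)
  have gi: "integral {0..2*pi} (\<lambda>t. complex_of_real (g t)) = of_real (integral {0..2*pi} g)"
    by (rule integral_of_real_Icc[OF integrable_continuous_real[OF g(1)]])
  have ReF: "Re (F z) = integral {0..2*pi} (\<lambda>t. poisson z t * g t) / (2*pi)" if z: "norm z < 1" for z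
  proof -
    have i1: "(\<lambda>t. 2 * (complex_of_real (g t) / (1 - z * cis (-t)))) integrable_on {0..2*pi}"
      by (intro integrable_on_mult_right cauchy_int_integrable gc z)
    have i2: "(\<lambda>t. complex_of_real (g t)) integrable_on {0..2*pi}"
      by (rule integrable_continuous_real[OF gc])
    have eq: "2 * (complex_of_real (g t) / (1 - z * cis (-t))) - complex_of_real (g t)
        = of_real (g t) * ((cis t + z) / (cis t - z))" for t
      unfolding herglotz_kernel(1)[OF z, symmetric] by (simp add: algebra_simps)
    have "F z = (2 * integral {0..2*pi} (\<lambda>t. complex_of_real (g t) / (1 - z * cis (-t))) - of_real (integral {0..2*pi} g)) / (2*pi)"
      by (simp add: F_def G_def cauchy_int_def m_def diff_divide_distrib)
    also have "\<dots> = integral {0..2*pi} (\<lambda>t. 2 * (complex_of_real (g t) / (1 - z * cis (-t))) - complex_of_real (g t)) / (2*pi)"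
      unfolding Henstock_Kurzweil_Integration.integral_diff[OF i1 i2] integral_mult_right gi ..
    also have "\<dots> = integral {0..2*pi} (\<lambda>t. of_real (g t) * ((cis t + z) / (cis t - z))) / (2*pi)"
      unfolding eq ..
    finally have "Re (F z) = Re (integral {0..2*pi} (\<lambda>t. of_real (g t) * ((cis t + z) / (cis t - z)))) / (2*pi)"
      by (simp only: Re_divide_of_real)
    also have "Re (integral {0..2*pi} (\<lambda>t. of_real (g t) * ((cis t + z) / (cis t - z))))
       = integral {0..2*pi} (\<lambda>t. Re (of_real (g t) * ((cis t + z) / (cis t - z))))"
    proof -
      have "(\<lambda>t. of_real (g t) * ((cis t + z) / (cis t - z))) integrable_on {0..2*pi}"
        unfolding eq[symmetric] by (rule integrable_diff[OF i1 i2])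
      from integral_linear[OF this bounded_linear_Re] show ?thesis by (simp add: o_def)
    qed
    also have "(\<lambda>t. Re (of_real (g t) * ((cis t + z) / (cis t - z)))) = (\<lambda>t. poisson z t * g t)"
    proof
      have "Re (complex_of_real a * w) = Re w * a" for a w by simp
      then show "Re (of_real (g t) * ((cis t + z) / (cis t - z))) = poisson z t * g t" for t
        by (simp only: herglotz_kernel(2)[OF z])
    qed
    finally show ?thesis .
  qed
  have pos: "0 < Re (F z)" if z: "norm z < 1" for z
  proof -
    have c: "continuous_on {0..2*pi} (\<lambda>t. poisson z t * g t)"
      using z by (intro continuous_intros continuous_on_poisson g)
    have nn: "0 \<le> poisson z t * g t" if "t \<in> {0..2*pi}" for t
      using poisson_pos[OF z, of t] g(2)[OF that] by simp
    have "integral {0..2*pi} (\<lambda>t. poisson z t * g t) \<noteq> 0"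
      using integral_eq_0_iff[OF c _ nn] False poisson_pos[OF z] by (auto simp: less_imp_neq[THEN not_sym])
    moreover have "0 \<le> integral {0..2*pi} (\<lambda>t. poisson z t * g t)"
      by (intro integral_nonneg integrable_continuous_real c nn)
    ultimately show ?thesis using ReF[OF z] by simp
  qed
  have F0: "F 0 = of_real m"
    by (simp add: F_def G_def cauchy_int_def gi m_def)
  have m0: "0 \<le> m" using pos[of 0] F0 by simp
  have I1: "integral {0..2*pi} (\<lambda>\<theta>. norm (F (of_real r * cis \<theta>)) powr p)
       \<le> A * integral {0..2*pi} (\<lambda>\<theta>. Re (F (of_real r * cis \<theta>)) powr p)"
    by (rule integral_powr_half_plane_le[OF hF pos _ p r A bd]) (auto simp: F0)
  also have "integral {0..2*pi} (\<lambda>\<theta>. Re (F (of_real r * cis \<theta>)) powr p)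
     = integral {0..2*pi} (\<lambda>\<theta>. (integral {0..2*pi} (\<lambda>t. poisson (of_real r * cis \<theta>) t * g t) / (2*pi)) powr p)"
    using r by (intro Henstock_Kurzweil_Integration.integral_cong) (simp add: ReF norm_mult)
  also have "A * \<dots> \<le> A * integral {0..2*pi} (\<lambda>t. g t powr p)"
    by (intro mult_left_mono Poisson_contraction g p r A)
  finally have IF: "integral {0..2*pi} (\<lambda>\<theta>. norm (F (of_real r * cis \<theta>)) powr p)
     \<le> A * integral {0..2*pi} (\<lambda>t. g t powr p)" .
  \<comment> \<open>Jensen at the centre of the disc, where the Poisson kernel is constant.\<close>
  have mp: "2 * pi * m powr p \<le> integral {0..2*pi} (\<lambda>t. g t powr p)"
    using Poisson_Jensen[OF g p, of 0] by (simp add: poisson_0 m_def field_simps)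
  have iF: "(\<lambda>\<theta>. norm (F (of_real r * cis \<theta>)) powr p) integrable_on {0..2*pi}"
    using p by (intro continuous_on_mean_powr continuous_circ_slice[OF hF r]) auto
  have "integral {0..2*pi} (\<lambda>\<theta>. norm (G (of_real r * cis \<theta>)) powr p)
      \<le> integral {0..2*pi} (\<lambda>\<theta>. norm (F (of_real r * cis \<theta>)) powr p + m powr p)"
  proof (rule integral_le)
    show "(\<lambda>\<theta>. norm (G (of_real r * cis \<theta>)) powr p) integrable_on {0..2*pi}"
      using p by (intro continuous_on_mean_powr continuous_circ_slice[OF hG r]) auto
    show "(\<lambda>\<theta>. norm (F (of_real r * cis \<theta>)) powr p + m powr p) integrable_on {0..2*pi}"
      by (intro integrable_add iF integrable_const_ivl)
    fix \<theta>
    let ?w = "F (of_real r * cis \<theta>)"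
    have "norm (G (of_real r * cis \<theta>)) powr p = norm ((?w + of_real m) / 2) powr p"
      by (simp add: F_def)
    also have "\<dots> = norm (?w + of_real m) powr p / 2 powr p"
      by (simp add: norm_divide powr_divide)
    \<comment> \<open>The halving in \<open>G = (F + m) / 2\<close> cancels the factor
      \<open>2 powr p\<close> of \<open>norm_add_powr_le\<close>.\<close>
    also have "\<dots> \<le> norm ?w powr p + norm (complex_of_real m) powr p"
      using norm_add_powr_le[of p ?w "of_real m"] p by (simp add: field_simps)
    finally show "norm (G (of_real r * cis \<theta>)) powr p \<le> norm ?w powr p + m powr p"
      using m0 by simp
  qed
  also have "\<dots> = integral {0..2*pi} (\<lambda>\<theta>. norm (F (of_real r * cis \<theta>)) powr p) + 2 * pi * m powr p"
    using iF by (subst Henstock_Kurzweil_Integration.integral_add) auto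
  also have "\<dots> \<le> (A + 1) * integral {0..2*pi} (\<lambda>t. g t powr p)"
    using IF mp by (simp add: algebra_simps)
  finally show ?thesis by (simp add: G_def)
qed

lemma integral_norm_add_powr_le:
  fixes f g :: "real \<Rightarrow> complex"
  assumes f: "continuous_on {0..2*pi} f" and g: "continuous_on {0..2*pi} g" and p: "0 < p"
  shows "integral {0..2*pi} (\<lambda>t. norm (f t + g t) powr p)
     \<le> 2 powr p * (integral {0..2*pi} (\<lambda>t. norm (f t) powr p) + integral {0..2*pi} (\<lambda>t. norm (g t) powr p))"
proof -
  have if': "(\<lambda>t. norm (f t) powr p) integrable_on {0..2*pi}" and ig: "(\<lambda>t. norm (g t) powr p) integrable_on {0..2*pi}"
    using f g p by (intro continuous_on_mean_powr; simp)+
  have "integral {0..2*pi} (\<lambda>t. norm (f t + g t) powr p)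
     \<le> integral {0..2*pi} (\<lambda>t. 2 powr p * (norm (f t) powr p + norm (g t) powr p))"
  proof (rule integral_le)
    show "(\<lambda>t. norm (f t + g t) powr p) integrable_on {0..2*pi}"
      using f g p by (intro continuous_on_mean_powr continuous_intros)
    show "(\<lambda>t. 2 powr p * (norm (f t) powr p + norm (g t) powr p)) integrable_on {0..2*pi}"
      by (intro integrable_on_mult_right integrable_add if' ig)
  qed (use norm_add_powr_le p in auto)
  also have "\<dots> = 2 powr p * (integral {0..2*pi} (\<lambda>t. norm (f t) powr p) + integral {0..2*pi} (\<lambda>t. norm (g t) powr p))"
    unfolding integral_mult_right by (subst Henstock_Kurzweil_Integration.integral_add[OF if' ig]) simp
  finally show ?thesis .
qed

lemma integral_norm_powr_mono:
  fixes f g :: "real \<Rightarrow> complex"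
  assumes f: "continuous_on {0..2*pi} f" and g: "continuous_on {0..2*pi} g" and p: "0 < p"
    and le: "\<And>t. norm (f t) \<le> norm (g t)"
  shows "integral {0..2*pi} (\<lambda>t. norm (f t) powr p) \<le> integral {0..2*pi} (\<lambda>t. norm (g t) powr p)"
  using assms by (intro integral_le continuous_on_mean_powr powr_mono2) auto

text \<open>Assembles general data from simpler parts that are dominated by the whole
  \<open>k\<close>: positive and negative part with \<open>c = -1\<close>, real and imaginary part
  with \<open>c = \<i>\<close>.\<close>

lemma riesz_projection_add:
  fixes k :: "real \<Rightarrow> complex"
  assumes g: "continuous_on {0..2*pi} g" and h: "continuous_on {0..2*pi} h" and k: "continuous_on {0..2*pi} k"
    and le: "\<And>t. norm (g t) \<le> norm (k t)" "\<And>t. norm (h t) \<le> norm (k t)"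
    and p: "0 < p" and A: "0 \<le> A" and r: "0 \<le> r" "r < 1" and c: "norm c = 1"
    and bg: "integral {0..2*pi} (\<lambda>\<theta>. norm (cauchy_int g (of_real r * cis \<theta>)) powr p) \<le> A * integral {0..2*pi} (\<lambda>t. norm (g t) powr p)"
    and bh: "integral {0..2*pi} (\<lambda>\<theta>. norm (cauchy_int h (of_real r * cis \<theta>)) powr p) \<le> A * integral {0..2*pi} (\<lambda>t. norm (h t) powr p)"
  shows "integral {0..2*pi} (\<lambda>\<theta>. norm (cauchy_int (\<lambda>t. g t + c * h t) (of_real r * cis \<theta>)) powr p)
      \<le> (2 powr p * (2 * A)) * integral {0..2*pi} (\<lambda>t. norm (k t) powr p)"
proof -
  let ?z = "\<lambda>\<theta>. of_real r * cis \<theta>"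
  have ch: "continuous_on {0..2*pi} (\<lambda>t. c * h t)" by (intro continuous_intros h)
  have nz: "norm (?z \<theta>) < 1" for \<theta> using r by (simp add: norm_mult)
  have "integral {0..2*pi} (\<lambda>\<theta>. norm (cauchy_int (\<lambda>t. g t + c * h t) (?z \<theta>)) powr p)
     = integral {0..2*pi} (\<lambda>\<theta>. norm (cauchy_int g (?z \<theta>) + c * cauchy_int h (?z \<theta>)) powr p)"
    by (simp add: cauchy_int_add[OF g ch nz] cauchy_int_cmult)
  also have "\<dots> \<le> 2 powr p * (integral {0..2*pi} (\<lambda>\<theta>. norm (cauchy_int g (?z \<theta>)) powr p)
      + integral {0..2*pi} (\<lambda>\<theta>. norm (c * cauchy_int h (?z \<theta>)) powr p))"
    by (intro integral_norm_add_powr_le p continuous_on_mult continuous_on_const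
        continuous_circ_slice cauchy_int_holomorphic g h r)
  also have "integral {0..2*pi} (\<lambda>\<theta>. norm (c * cauchy_int h (?z \<theta>)) powr p)
     = integral {0..2*pi} (\<lambda>\<theta>. norm (cauchy_int h (?z \<theta>)) powr p)"
    by (simp add: norm_mult c)
  also have "2 powr p * (integral {0..2*pi} (\<lambda>\<theta>. norm (cauchy_int g (?z \<theta>)) powr p) + \<dots>)
     \<le> 2 powr p * (A * integral {0..2*pi} (\<lambda>t. norm (k t) powr p) + A * integral {0..2*pi} (\<lambda>t. norm (k t) powr p))"
    by (intro mult_left_mono add_mono order_trans[OF bg] order_trans[OF bh] integral_norm_powr_mono g h k p le A) simp
  finally show ?thesis by (simp add: algebra_simps)
qed

text \<open>The constants \<open>A1\<close>, \<open>A2\<close>, \<open>A3\<close> belong to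
  nonnegative, real and complex data; each enlargement costs a factor
  \<open>2 powr p * 2\<close>.\<close>

lemma riesz_projection_le_2:
  assumes p: "1 < p" "p \<le> 2"
  obtains A where "0 \<le> A" "\<And>g r. continuous_on {0..2*pi} g \<Longrightarrow> 0 \<le> r \<Longrightarrow> r < 1 \<Longrightarrow>
    integral {0..2*pi} (\<lambda>\<theta>. norm (cauchy_int g (of_real r * cis \<theta>)) powr p)
       \<le> A * integral {0..2*pi} (\<lambda>t. norm (g t) powr p)"
proof -
  obtain A B where A: "0 \<le> A" "0 \<le> B"
    "\<And>w. 0 < Re w \<Longrightarrow> norm w powr p \<le> A * Re w powr p - B * Re (w powr (of_real p))"
    using half_plane_powr_bound[OF p] by blast
  have p0: "0 < p" using p by simp
  define A1 where "A1 = A + 1"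
  define A2 where "A2 = 2 powr p * (2 * A1)"
  define A3 where "A3 = 2 powr p * (2 * A2)"
  have nonneg: "0 \<le> A1" "0 \<le> A2" "0 \<le> A3" using A(1) by (auto simp: A1_def A2_def A3_def)
  let ?I = "\<lambda>g. integral {0..2*pi} (\<lambda>t. norm (g t :: complex) powr p)"
  let ?C = "\<lambda>r g. integral {0..2*pi} (\<lambda>\<theta>. norm (cauchy_int g (of_real r * cis \<theta>)) powr p)"
  have pos: "?C r (\<lambda>t. complex_of_real (g t)) \<le> A1 * ?I (\<lambda>t. complex_of_real (g t))"
    if "continuous_on {0..2*pi} g" "\<And>t. 0 \<le> g t" "0 \<le> r" "r < 1" for g r
    using riesz_projection_nonneg[OF p(1) A that(1) _ that(3,4)] that(2) by (simp add: A1_def)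
  have real: "?C r (\<lambda>t. complex_of_real (g t)) \<le> A2 * ?I (\<lambda>t. complex_of_real (g t))"
    if g: "continuous_on {0..2*pi} g" and r: "0 \<le> r" "r < 1" for g r
  proof -
    have c: "continuous_on {0..2*pi} (\<lambda>t. max (g t) 0)" "continuous_on {0..2*pi} (\<lambda>t. max (- g t) 0)"
      by (intro continuous_intros g)+
    have "?C r (\<lambda>t. of_real (max (g t) 0) + (-1) * of_real (max (- g t) 0)) \<le> A2 * ?I (\<lambda>t. complex_of_real (g t))"
      unfolding A2_def
      by (intro riesz_projection_add pos c continuous_on_of_real g nonneg r p0) auto
    moreover have "(\<lambda>t. complex_of_real (g t)) = (\<lambda>t. of_real (max (g t) 0) + (-1) * of_real (max (- g t) 0))"
      by (auto simp: fun_eq_iff max_def)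
    ultimately show ?thesis by simp
  qed
  have "?C r g \<le> A3 * ?I g" if g: "continuous_on {0..2*pi} g" and r: "0 \<le> r" "r < 1" for g r
  proof -
    have "?C r (\<lambda>t. of_real (Re (g t)) + \<i> * of_real (Im (g t))) \<le> A3 * ?I g"
      unfolding A3_def
      by (intro riesz_projection_add real continuous_on_of_real continuous_on_Re continuous_on_Im g nonneg r p0)
         (auto simp: abs_Re_le_cmod abs_Im_le_cmod)
    then show ?thesis by (simp add: complex_eq[symmetric])
  qed
  then show ?thesis using nonneg by (intro that[of A3])
qed


text \<open>The dilated Cauchy kernel is Hermitian: exchanging the two angles conjugates it. Fubini
  then gives self-adjointness, which carries the Riesz bound to the conjugate exponent.\<close>

lemma cauchy_int_adjoint:
  assumes g: "continuous_on {0..2*pi} g" and k: "continuous_on {0..2*pi} k" and r: "0 \<le> r" "r < 1"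
  shows "integral {0..2*pi} (\<lambda>\<theta>. cauchy_int g (of_real r * cis \<theta>) * cnj (k \<theta>))
       = integral {0..2*pi} (\<lambda>t. g t * cnj (cauchy_int k (of_real r * cis t)))"
proof -
  let ?K = "\<lambda>\<theta> t. g t * cnj (k \<theta>) / (1 - of_real r * cis \<theta> * cis (-t)) / (2*pi)"
  have nr: "norm (of_real r * cis \<theta>) < 1" for \<theta> using r by (simp add: norm_mult)
  have cK: "continuous_on ({0..2*pi} \<times> {0..2*pi}) (\<lambda>(\<theta>, t). ?K \<theta> t)"
  proof -
    have "continuous_on ({0..2*pi} \<times> {0..2*pi}) (\<lambda>x. g (snd x))"
      by (rule continuous_on_compose2[OF g continuous_on_snd[OF continuous_on_id]]) auto
    moreover have "continuous_on ({0..2*pi} \<times> {0..2*pi}) (\<lambda>x. k (fst x))"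
      by (rule continuous_on_compose2[OF k continuous_on_fst[OF continuous_on_id]]) auto
    ultimately show ?thesis
      unfolding case_prod_unfold using one_minus_cis_nonzero[OF nr]
      by (intro continuous_intros) auto
  qed
  have "cauchy_int g (of_real r * cis \<theta>) * cnj (k \<theta>) = integral {0..2*pi} (?K \<theta>)" for \<theta>
  proof -
    have "?K \<theta> = (\<lambda>t. cnj (k \<theta>) / (2*pi) * (g t / (1 - of_real r * cis \<theta> * cis (-t))))"
      by (simp add: fun_eq_iff mult.commute)
    then have "integral {0..2*pi} (?K \<theta>) = cnj (k \<theta>) / (2*pi) * integral {0..2*pi} (\<lambda>t. g t / (1 - of_real r * cis \<theta> * cis (-t)))"
      by (simp only: integral_mult_right)
    then show ?thesis by (simp add: cauchy_int_def)
  qed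
  then have "integral {0..2*pi} (\<lambda>\<theta>. cauchy_int g (of_real r * cis \<theta>) * cnj (k \<theta>))
      = integral {0..2*pi} (\<lambda>\<theta>. integral {0..2*pi} (?K \<theta>))" by simp
  also have "\<dots> = integral {0..2*pi} (\<lambda>t. integral {0..2*pi} (\<lambda>\<theta>. ?K \<theta> t))"
    by (rule integral_swap_ivl[OF cK])
  also have "(\<lambda>t. integral {0..2*pi} (\<lambda>\<theta>. ?K \<theta> t)) = (\<lambda>t. g t * cnj (cauchy_int k (of_real r * cis t)))"
  proof
    fix t
    let ?f = "\<lambda>\<theta>. k \<theta> / (1 - of_real r * cis t * cis (-\<theta>))"
    have "cis \<theta> * cis (-t) = cnj (cis t * cis (-\<theta>))" for \<theta> by (simp add: cis_cnj cis_mult)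
    then have "(\<lambda>\<theta>. ?K \<theta> t) = (\<lambda>\<theta>. g t / (2*pi) * cnj (?f \<theta>))"
      by (simp add: fun_eq_iff mult.assoc)
    then have "integral {0..2*pi} (\<lambda>\<theta>. ?K \<theta> t) = g t / (2*pi) * integral {0..2*pi} (\<lambda>\<theta>. cnj (?f \<theta>))"
      by (simp only: integral_mult_right)
    also have "integral {0..2*pi} (\<lambda>\<theta>. cnj (?f \<theta>)) = cnj (integral {0..2*pi} ?f)"
      by (rule Henstock_Kurzweil_Integration.integral_cnj[symmetric])
    finally show "integral {0..2*pi} (\<lambda>\<theta>. ?K \<theta> t) = g t * cnj (cauchy_int k (of_real r * cis t))"
      by (simp add: cauchy_int_def)
  qed
  finally show ?thesis .
qed

text \<open>The equality case of Hoelder's inequality: the product with the conjugate of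
  \<open>w\<close> is \<open>norm w powr p\<close>, and so is the modulus raised to the conjugate
  exponent.\<close>

definition duality_map :: "real \<Rightarrow> complex \<Rightarrow> complex" where
  "duality_map p w = of_real (norm w powr (p - 2)) * w"

lemma norm_duality_map:
  assumes "1 < p" shows "norm (duality_map p w) = norm w powr (p - 1)"
proof (cases "w = 0")
  case False
  then have "norm w powr (p - 2) * norm w powr 1 = norm w powr (p - 1)"
    by (subst powr_add[symmetric]) simp
  then show ?thesis using False by (simp add: duality_map_def norm_mult)
qed (simp add: duality_map_def)

lemma duality_map_mult_cnj:
  shows "duality_map p w * cnj w = of_real (norm w powr p)" "w * cnj (duality_map p w) = of_real (norm w powr p)"
proof -
  have *: "of_real (norm w powr (p - 2)) * (w * cnj w) = complex_of_real (norm w powr p)"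
  proof (cases "w = 0")
    case False
    then have "norm w powr (p - 2) * norm w powr 2 = norm w powr p"
      by (subst powr_add[symmetric]) simp
    then have "norm w powr (p - 2) * (norm w)\<^sup>2 = norm w powr p" using False by simp
    then show ?thesis unfolding complex_norm_square[symmetric] by (metis of_real_mult of_real_power)
  qed simp
  then show "duality_map p w * cnj w = of_real (norm w powr p)" "w * cnj (duality_map p w) = of_real (norm w powr p)"
    by (auto simp: duality_map_def mult.assoc mult.left_commute)
qed

lemma continuous_duality_map:
  assumes p: "1 < p"
  shows "continuous_on A (duality_map p)"
proof -
  have "isCont (duality_map p) w" for w
  proof (cases "w = 0")
    \<comment> \<open>For \<open>p < 2\<close> the scalar factor is unbounded near 0; continuity
      there comes from the modulus, which is the positive power \<open>p - 1\<close>.\<close>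
    case True
    have "((\<lambda>w. norm w powr (p - 1)) \<longlongrightarrow> norm (0::complex) powr (p - 1)) (at (0::complex))"
      using p by (intro tendsto_powr' tendsto_intros) auto
    then have "((\<lambda>w. norm (duality_map p w)) \<longlongrightarrow> 0) (at 0)"
      using p by (simp add: norm_duality_map)
    then have "(duality_map p \<longlongrightarrow> 0) (at 0)" by (rule tendsto_norm_zero_cancel)
    then show ?thesis using True by (simp add: isCont_def duality_map_def)
  next
    case False
    then show ?thesis unfolding duality_map_def by (intro continuous_intros) auto
  qed
  then show ?thesis by (simp add: continuous_at_imp_continuous_on)
qed

text \<open>The absorption step of the duality arguments: testing against the extremal function
  brings the quantity to be estimated back on the right with a smaller exponent.\<close>

lemma powr_le_of_le_mult_powr:
  fixes x D p q :: real
  assumes pq: "1 < p" "1 < q" "1/p + 1/q = 1" and x: "0 \<le> x" and D: "0 \<le> D" and le: "x \<le> D * x powr (1/q)"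
  shows "x \<le> D powr p"
proof (cases "x = 0")
  case False
  then have x0: "0 < x" using x by simp
  have "x powr (1/p) * x powr (1/q) = x" using x0 pq by (simp flip: powr_add)
  then have "x powr (1/p) * x powr (1/q) \<le> D * x powr (1/q)" using le by simp
  then have "x powr (1/p) \<le> D" using x0 by simp
  then have "(x powr (1/p)) powr p \<le> D powr p" using pq by (intro powr_mono2) auto
  then show ?thesis using x0 pq by (simp add: powr_powr)
qed simp

text \<open>For \<open>p > 2\<close> the projection is tested against its own duality map. The
  adjoint relation moves the projection to that factor, where the conjugate exponent is below 2 and
  the previous case applies.\<close>

lemma riesz_projection:
  assumes p: "1 < p"
  obtains A where "0 \<le> A" "\<And>g r. continuous_on {0..2*pi} g \<Longrightarrow> 0 \<le> r \<Longrightarrow> r < 1 \<Longrightarrow>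
    integral {0..2*pi} (\<lambda>\<theta>. norm (cauchy_int g (of_real r * cis \<theta>)) powr p)
       \<le> A * integral {0..2*pi} (\<lambda>t. norm (g t) powr p)"
proof (cases "p \<le> 2")
  case True
  show ?thesis using riesz_projection_le_2[OF p True] that by metis
next
  case False
  define q where "q = p / (p - 1)"
  have q: "1 < q" "q \<le> 2" "1/p + 1/q = 1" using False by (auto simp: q_def field_simps)
  obtain A where A: "0 \<le> A" "\<And>g r. continuous_on {0..2*pi} g \<Longrightarrow> 0 \<le> r \<Longrightarrow> r < 1 \<Longrightarrow>
    integral {0..2*pi} (\<lambda>\<theta>. norm (cauchy_int g (of_real r * cis \<theta>)) powr q)
       \<le> A * integral {0..2*pi} (\<lambda>t. norm (g t) powr q)"
    using riesz_projection_le_2[OF q(1,2)] by metis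
  have "integral {0..2*pi} (\<lambda>\<theta>. norm (cauchy_int g (of_real r * cis \<theta>)) powr p)
       \<le> A powr (p / q) * integral {0..2*pi} (\<lambda>t. norm (g t) powr p)"
    if g: "continuous_on {0..2*pi} g" and r: "0 \<le> r" "r < 1" for g r
  proof -
    let ?G = "\<lambda>\<theta>. cauchy_int g (of_real r * cis \<theta>)"
    define k where "k = (\<lambda>\<theta>. duality_map p (?G \<theta>))"
    let ?H = "\<lambda>\<theta>. cauchy_int k (of_real r * cis \<theta>)"
    define X where "X = integral {0..2*pi} (\<lambda>\<theta>. norm (?G \<theta>) powr p)"
    define Y where "Y = integral {0..2*pi} (\<lambda>\<theta>. norm (g \<theta>) powr p)"
    have cG: "continuous_on {0..2*pi} ?G"
      by (intro continuous_circ_slice cauchy_int_holomorphic g r)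
    have ck: "continuous_on {0..2*pi} k" unfolding k_def
      by (rule continuous_on_compose2[OF continuous_duality_map[OF p] cG]) auto
    have cH: "continuous_on {0..2*pi} ?H"
      by (intro continuous_circ_slice cauchy_int_holomorphic ck r)
    have nonneg: "0 \<le> X" "0 \<le> Y"
      unfolding X_def Y_def using p g cG by (auto intro!: integral_nonneg continuous_on_mean_powr)
    have kq: "norm (k \<theta>) powr q = norm (?G \<theta>) powr p" for \<theta>
      using p by (simp add: k_def norm_duality_map powr_powr q_def)
    have "complex_of_real X = integral {0..2*pi} (\<lambda>\<theta>. ?G \<theta> * cnj (k \<theta>))"
      using integral_of_real_Icc[OF continuous_on_mean_powr[OF cG], of p] p
      by (simp add: X_def k_def duality_map_mult_cnj)
    also have "\<dots> = integral {0..2*pi} (\<lambda>t. g t * cnj (?H t))"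
      by (rule cauchy_int_adjoint[OF g ck r])
    also have "\<dots> = integral\<^sup>L circ (\<lambda>t. g t * cnj (?H t))"
      by (intro continuous_circ(2)[symmetric] continuous_intros g cH)
    finally have "X = norm (integral\<^sup>L circ (\<lambda>t. g t * cnj (?H t)))"
      using nonneg by (metis abs_of_nonneg norm_of_real)
    also have "\<dots> \<le> (integral\<^sup>L circ (\<lambda>t. norm (g t) powr p)) powr (1/p)
        * (integral\<^sup>L circ (\<lambda>t. norm (cnj (?H t)) powr q)) powr (1/q)"
      using p q by (intro Holder_inequality_complex(2) borel_measurable_integrable continuous_circ(1) continuous_intros g cH) auto
    also have "integral\<^sup>L circ (\<lambda>t. norm (g t) powr p) = Y"
      unfolding Y_def using p g by (intro continuous_circ(2) continuous_intros) auto
    also have "integral\<^sup>L circ (\<lambda>t. norm (cnj (?H t)) powr q) = integral {0..2*pi} (\<lambda>t. norm (?H t) powr q)"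
      using q cH by (subst continuous_circ(2)) (auto intro!: continuous_intros)
    also have "Y powr (1/p) * \<dots> powr (1/q) \<le> Y powr (1/p) * (A * X) powr (1/q)"
    proof (intro mult_left_mono powr_mono2)
      show "integral {0..2*pi} (\<lambda>t. norm (?H t) powr q) \<le> A * X"
        using A(2)[OF ck r] by (simp add: kq X_def)
      show "0 \<le> integral {0..2*pi} (\<lambda>t. norm (?H t) powr q)"
        using q cH by (intro integral_nonneg continuous_on_mean_powr) auto
    qed (use q in auto)
    also have "\<dots> = (Y powr (1/p) * A powr (1/q)) * X powr (1/q)"
      using A nonneg by (simp add: powr_mult)
    finally have "X \<le> (Y powr (1/p) * A powr (1/q)) powr p"
      by (intro powr_le_of_le_mult_powr[OF p q(1,3)] nonneg) auto
    also have "\<dots> = A powr (p / q) * Y"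
      using p nonneg A by (simp add: powr_mult powr_powr)
    finally show ?thesis by (simp add: X_def Y_def)
  qed
  then show ?thesis by (intro that[of "A powr (p / q)"]) auto
qed

subsection \<open>Functionals on the unweighted Hardy space\<close>

definition circ_norm :: "real \<Rightarrow> (real \<Rightarrow> complex) \<Rightarrow> real" where
  "circ_norm p u = (integral\<^sup>L circ (\<lambda>t. norm (u t) powr p)) powr (1/p)"

lemma hardyI:
  assumes "f holomorphic_on ball 0 1"
    and "\<And>r. 0 \<le> r \<Longrightarrow> r < 1 \<Longrightarrow> integral {0..2*pi} (\<lambda>t. norm (f (of_real r * cis t)) powr p) \<le> B"
  shows "f \<in> hardy p"
  using assms unfolding hardy_def by (intro CollectI conjI exI[of _ B]) auto

lemma hardy_disc_algebra:
  assumes f: "continuous_on (cball 0 1) f" "f holomorphic_on ball 0 1" and p: "1 < p"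
  shows "f \<in> hardy p"
  using f(2) integral_mean_le[OF f p] by (rule hardyI)

lemma hardy_lincomb:
  assumes f: "f \<in> hardy p" and g: "g \<in> hardy p" and p: "1 < p"
  shows "(\<lambda>z. a * f z + b * g z) \<in> hardy p"
proof -
  have hf: "f holomorphic_on ball 0 1" "g holomorphic_on ball 0 1" using f g hardy_holomorphic by auto
  obtain B C where B: "\<forall>r\<in>{0..<1}. integral {0..2*pi} (\<lambda>t. norm (f (of_real r * cis t)) powr p) \<le> B"
    and C: "\<forall>r\<in>{0..<1}. integral {0..2*pi} (\<lambda>t. norm (g (of_real r * cis t)) powr p) \<le> C"
    using f g by (auto simp: hardy_def)
  have "integral {0..2*pi} (\<lambda>t. norm (a * f (of_real r * cis t) + b * g (of_real r * cis t)) powr p)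
     \<le> 2 powr p * (norm a powr p * B + norm b powr p * C)" if r: "0 \<le> r" "r < 1" for r
  proof -
    have "integral {0..2*pi} (\<lambda>t. norm (a * f (of_real r * cis t) + b * g (of_real r * cis t)) powr p)
     \<le> 2 powr p * (integral {0..2*pi} (\<lambda>t. norm (a * f (of_real r * cis t)) powr p)
        + integral {0..2*pi} (\<lambda>t. norm (b * g (of_real r * cis t)) powr p))"
      using r p by (intro integral_norm_add_powr_le continuous_on_mult continuous_on_const continuous_circ_slice hf) auto
    also have "\<dots> = 2 powr p * (norm a powr p * integral {0..2*pi} (\<lambda>t. norm (f (of_real r * cis t)) powr p)
        + norm b powr p * integral {0..2*pi} (\<lambda>t. norm (g (of_real r * cis t)) powr p))"
      by (simp add: norm_mult powr_mult)
    also have "\<dots> \<le> 2 powr p * (norm a powr p * B + norm b powr p * C)"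
      using B C r by (intro mult_left_mono add_mono) auto
    finally show ?thesis .
  qed
  then show ?thesis using hf by (intro hardyI[where B = "2 powr p * (norm a powr p * B + norm b powr p * C)"] holomorphic_intros)
qed

text \<open>Only almost everywhere: where a radial limit fails to exist, \<open>bval\<close> is a
  default value and not additive.\<close>

lemma bval_lincomb_AE:
  assumes f: "f \<in> hardy p" and g: "g \<in> hardy p" and p: "1 < p"
  shows "AE t in circ. bval (\<lambda>z. a * f z + b * g z) t = a * bval f t + b * bval g t"
  using hardy_bval_limit[OF f p] hardy_bval_limit[OF g p]
proof eventually_elim
  case (elim t)
  show ?case by (rule bval_eqI) (intro tendsto_intros elim)
qed

lemma circ_norm_cong_AE:
  assumes "AE t in circ. u t = v t" "u \<in> borel_measurable circ" "v \<in> borel_measurable circ"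
  shows "circ_norm p u = circ_norm p v"
proof -
  have "integral\<^sup>L circ (\<lambda>t. norm (u t) powr p) = integral\<^sup>L circ (\<lambda>t. norm (v t) powr p)"
    using assms by (intro integral_cong_AE borel_measurable_norm_powr) auto
  then show ?thesis by (simp add: circ_norm_def)
qed

lemma hardy_bval_measurable: "f \<in> hardy p \<Longrightarrow> bval f \<in> borel_measurable circ"
  by (intro measurable_circ bval_measurable hardy_holomorphic)

lemma circ_norm_bound:
  assumes p: "1 < p" and c: "continuous_on {0..2*pi} u" and le: "\<And>t. norm (u t) \<le> e"
  shows "circ_norm p u \<le> (2*pi) powr (1/p) * e"
proof -
  have e: "0 \<le> e" using le[of 0] norm_ge_zero order_trans by blast
  have "integral\<^sup>L circ (\<lambda>t. norm (u t) powr p) = integral {0..2*pi} (\<lambda>t. norm (u t) powr p)"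
    using p c by (intro continuous_circ(2) continuous_intros) auto
  also have "\<dots> \<le> integral {0..2*pi} (\<lambda>t. e powr p)"
    using p c le by (intro integral_le continuous_on_mean_powr integrable_const_ivl powr_mono2) auto
  also have "\<dots> = 2 * pi * e powr p" by simp
  finally have "circ_norm p u \<le> (2 * pi * e powr p) powr (1/p)"
    unfolding circ_norm_def using p by (intro powr_mono2) auto
  also have "\<dots> = (2*pi) powr (1/p) * e"
    using p e by (simp add: powr_mult powr_powr)
  finally show ?thesis .
qed

lemma circ_norm_slice_tendsto:
  assumes f: "f \<in> hardy p" and p: "1 < p"
  shows "((\<lambda>r. circ_norm p (\<lambda>t. bval f t - f (of_real r * cis t))) \<longlongrightarrow> 0) (at_left 1)"
proof -
  have "((\<lambda>r. circ_norm p (\<lambda>t. bval f t - f (of_real r * cis t))) \<longlongrightarrow> 0 powr (1/p)) (at_left 1)"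
    unfolding circ_norm_def using p
    by (intro tendsto_powr' hardy_slice_tendsto_bval[OF f p] tendsto_const) auto
  then show ?thesis by simp
qed

lemma pairing_Holder:
  assumes pq: "1 < p" "1 < q" "1/p + 1/q = 1"
    and u: "u \<in> borel_measurable circ" "integrable circ (\<lambda>t. norm (u t) powr p)"
    and v: "v \<in> borel_measurable circ" "integrable circ (\<lambda>t. norm (v t) powr q)"
  shows "integrable circ (\<lambda>t. u t * cnj (v t))"
    "norm (integral\<^sup>L circ (\<lambda>t. u t * cnj (v t))) \<le> circ_norm p u * circ_norm q v"
proof -
  have m: "(\<lambda>t. cnj (v t)) \<in> borel_measurable circ"
    using v(1) by (rule measurable_compose) (auto intro!: borel_measurable_continuous_onI continuous_intros)
  show "integrable circ (\<lambda>t. u t * cnj (v t))"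
    by (rule Holder_inequality_complex(1)[OF pq u(1) m u(2)]) (use v in simp)
  show "norm (integral\<^sup>L circ (\<lambda>t. u t * cnj (v t))) \<le> circ_norm p u * circ_norm q v"
    unfolding circ_norm_def using Holder_inequality_complex(2)[OF pq u(1) m u(2)] v by simp
qed

text \<open>The difference is split as (u - u_r) v_r + u (v - v_r), with v conjugated. Hoelder
  bounds each product; the means of v_r are bounded uniformly in r, and the other two differences
  tend to 0 in mean.\<close>

lemma pairing_slices_tendsto:
  assumes pq: "1 < p" "1 < q" "1/p + 1/q = 1" and f: "f \<in> hardy p" and g: "g \<in> hardy q"
  shows "((\<lambda>r. integral {0..2*pi} (\<lambda>t. f (of_real r * cis t) * cnj (g (of_real r * cis t))))
    \<longlongrightarrow> integral\<^sup>L circ (\<lambda>t. bval f t * cnj (bval g t))) (at_left 1)"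
proof -
  have hol: "f holomorphic_on ball 0 1" "g holomorphic_on ball 0 1" using f g hardy_holomorphic by auto
  obtain B where B: "\<forall>r\<in>{0..<1}. integral {0..2*pi} (\<lambda>t. norm (g (of_real r * cis t)) powr q) \<le> B"
    using g by (auto simp: hardy_def)
  let ?fr = "\<lambda>r t. f (of_real r * cis t)"
  let ?gr = "\<lambda>r t. g (of_real r * cis t)"
  let ?J = "integral\<^sup>L circ (\<lambda>t. bval f t * cnj (bval g t))"
  let ?bound = "\<lambda>r. circ_norm p (\<lambda>t. bval f t - ?fr r t) * B powr (1/q) + circ_norm p (bval f) * circ_norm q (\<lambda>t. bval g t - ?gr r t)"
  have bound: "norm (integral {0..2*pi} (\<lambda>t. ?fr r t * cnj (?gr r t)) - ?J) \<le> ?bound r" if r: "0 \<le> r" "r < 1" for r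
  proof -
    have cf: "continuous_on {0..2*pi} (?fr r)" and cg: "continuous_on {0..2*pi} (?gr r)"
      using r hol by (auto intro: continuous_circ_slice)
    have mf: "?fr r \<in> borel_measurable circ" and mg: "?gr r \<in> borel_measurable circ"
      using continuous_circ(1)[OF cf] continuous_circ(1)[OF cg] by auto
    have cgq: "continuous_on {0..2*pi} (\<lambda>t. norm (?gr r t) powr q)"
      using pq cg by (intro continuous_intros) auto
    note df = borel_measurable_diff[OF hardy_bval_measurable[OF f] mf]
    note dg = borel_measurable_diff[OF hardy_bval_measurable[OF g] mg]
    note H1 = pairing_Holder[OF pq df hardy_slice_tendsto_bval(2)[OF f pq(1) r] mg continuous_circ(1)[OF cgq]]
    note H2 = pairing_Holder[OF pq hardy_bval_measurable[OF f] hardy_bval_integrable[OF f pq(1)] dg hardy_slice_tendsto_bval(2)[OF g pq(2) r]]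
    have i: "integrable circ (\<lambda>t. ?fr r t * cnj (?gr r t))"
      by (intro continuous_circ(1) continuous_intros cf cg)
    have "integral\<^sup>L circ (\<lambda>t. ((bval f t - ?fr r t) * cnj (?gr r t) + bval f t * cnj (bval g t - ?gr r t)) + ?fr r t * cnj (?gr r t))
      = integral\<^sup>L circ (\<lambda>t. (bval f t - ?fr r t) * cnj (?gr r t)) + integral\<^sup>L circ (\<lambda>t. bval f t * cnj (bval g t - ?gr r t))
        + integral\<^sup>L circ (\<lambda>t. ?fr r t * cnj (?gr r t))"
      unfolding Bochner_Integration.integral_add[OF Bochner_Integration.integrable_add[OF H1(1) H2(1)] i]
        Bochner_Integration.integral_add[OF H1(1) H2(1)] ..
    moreover have "(\<lambda>t. ((bval f t - ?fr r t) * cnj (?gr r t) + bval f t * cnj (bval g t - ?gr r t)) + ?fr r t * cnj (?gr r t))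
       = (\<lambda>t. bval f t * cnj (bval g t))"
      by (simp add: fun_eq_iff algebra_simps)
    moreover have "integral\<^sup>L circ (\<lambda>t. ?fr r t * cnj (?gr r t)) = integral {0..2*pi} (\<lambda>t. ?fr r t * cnj (?gr r t))"
      by (intro continuous_circ(2) continuous_intros cf cg)
    ultimately have "?J - integral {0..2*pi} (\<lambda>t. ?fr r t * cnj (?gr r t))
      = integral\<^sup>L circ (\<lambda>t. (bval f t - ?fr r t) * cnj (?gr r t)) + integral\<^sup>L circ (\<lambda>t. bval f t * cnj (bval g t - ?gr r t))"
      by simp
    then have "norm (integral {0..2*pi} (\<lambda>t. ?fr r t * cnj (?gr r t)) - ?J)
      \<le> circ_norm p (\<lambda>t. bval f t - ?fr r t) * circ_norm q (?gr r) + circ_norm p (bval f) * circ_norm q (\<lambda>t. bval g t - ?gr r t)"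
      unfolding norm_minus_commute[of _ ?J] using H1(2) H2(2) by (simp only: norm_triangle_mono)
    moreover have "circ_norm q (?gr r) \<le> B powr (1/q)"
      unfolding circ_norm_def continuous_circ(2)[OF cgq] using B r pq cg
      by (intro powr_mono2 integral_nonneg continuous_on_mean_powr) auto
    then have "circ_norm p (\<lambda>t. bval f t - ?fr r t) * circ_norm q (?gr r) \<le> circ_norm p (\<lambda>t. bval f t - ?fr r t) * B powr (1/q)"
      by (rule mult_left_mono) (simp add: circ_norm_def)
    ultimately show ?thesis by linarith
  qed
  have lim: "(?bound \<longlongrightarrow> 0 * B powr (1/q) + circ_norm p (bval f) * 0) (at_left 1)"
    by (rule tendsto_add[OF tendsto_mult[OF circ_norm_slice_tendsto[OF f pq(1)] tendsto_const]
        tendsto_mult[OF tendsto_const circ_norm_slice_tendsto[OF g pq(2)]]])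
  have "eventually (\<lambda>r. r \<in> {0<..<1}) (at_left (1::real))" by (rule eventually_at_left_real) simp
  then have "eventually (\<lambda>r. norm (integral {0..2*pi} (\<lambda>t. ?fr r t * cnj (?gr r t)) - ?J) \<le> ?bound r) (at_left 1)"
    by eventually_elim (rule bound; simp)
  then have "((\<lambda>r. integral {0..2*pi} (\<lambda>t. ?fr r t * cnj (?gr r t)) - ?J) \<longlongrightarrow> 0) (at_left 1)"
    by (rule Lim_null_comparison[OF _ lim[unfolded mult_zero_left mult_zero_right add_0]])
  then show ?thesis by (rule Lim_null[THEN iffD2])
qed

section \<open>A bounded functional on the unweighted space and its representing function\<close>

locale hardy_functional =
  fixes p q :: real and \<Lambda> :: "(complex \<Rightarrow> complex) \<Rightarrow> complex" and C :: real
  assumes pq: "1 < p" "1 < q" "1/p + 1/q = 1"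
    and linear: "\<And>f g a b. f \<in> hardy p \<Longrightarrow> g \<in> hardy p \<Longrightarrow> \<Lambda> (\<lambda>z. a * f z + b * g z) = a * \<Lambda> f + b * \<Lambda> g"
    and C: "0 \<le> C"
    and bounded: "\<And>f. f \<in> hardy p \<Longrightarrow> norm (\<Lambda> f) \<le> C * circ_norm p (bval f)"
begin

lemma diff_le:
  assumes f: "f \<in> hardy p" and g: "g \<in> hardy p"
  shows "norm (\<Lambda> f - \<Lambda> g) \<le> C * circ_norm p (\<lambda>t. bval f t - bval g t)"
proof -
  have h: "(\<lambda>z. 1 * f z + (-1) * g z) \<in> hardy p" by (rule hardy_lincomb[OF f g pq(1)])
  have "norm (\<Lambda> f - \<Lambda> g) = norm (\<Lambda> (\<lambda>z. 1 * f z + (-1) * g z))"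
    by (subst linear[OF f g]) simp
  also have "\<dots> \<le> C * circ_norm p (bval (\<lambda>z. 1 * f z + (-1) * g z))"
    by (rule bounded[OF h])
  also have "circ_norm p (bval (\<lambda>z. 1 * f z + (-1) * g z)) = circ_norm p (\<lambda>t. bval f t - bval g t)"
  proof (rule circ_norm_cong_AE)
    show "AE t in circ. bval (\<lambda>z. 1 * f z + (-1) * g z) t = bval f t - bval g t"
      using bval_lincomb_AE[OF f g pq(1), of 1 "-1"] by simp
    show "(\<lambda>t. bval f t - bval g t) \<in> borel_measurable circ"
      by (intro borel_measurable_diff hardy_bval_measurable[OF f] hardy_bval_measurable[OF g])
  qed (rule hardy_bval_measurable[OF h])
  finally show ?thesis .
qed

text \<open>Continuity of the functional under uniform convergence on the closed disc, which later
  permits evaluation term by term.\<close>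

lemma disc_algebra_diff_le:
  assumes f: "continuous_on (cball 0 1) f" "f holomorphic_on ball 0 1"
    and g: "continuous_on (cball 0 1) g" "g holomorphic_on ball 0 1"
    and le: "\<And>z. norm z \<le> 1 \<Longrightarrow> norm (f z - g z) \<le> e"
  shows "norm (\<Lambda> f - \<Lambda> g) \<le> C * ((2*pi) powr (1/p) * e)"
proof -
  have cc: "continuous_on {0..2*pi} (\<lambda>t. k (cis t))" if "continuous_on (cball 0 1) k" for k :: "complex \<Rightarrow> complex"
    by (rule continuous_on_compose2[OF that]) (auto intro!: continuous_intros)
  have "norm (\<Lambda> f - \<Lambda> g) \<le> C * circ_norm p (\<lambda>t. bval f t - bval g t)"
    by (intro diff_le hardy_disc_algebra f g pq)
  also have "\<dots> = C * circ_norm p (\<lambda>t. f (cis t) - g (cis t))"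
    by (simp add: bval_continuous[OF f(1)] bval_continuous[OF g(1)])
  also have "\<dots> \<le> C * ((2*pi) powr (1/p) * e)"
    using le by (intro mult_left_mono circ_norm_bound pq continuous_on_diff cc f g C) auto
  finally show ?thesis .
qed

text \<open>Elements of \<open>hardy p\<close> are functions on the whole plane, so a functional
  might distinguish extensions of the same function on the disc. Boundedness forbids it, since the
  boundary values depend on the disc only.\<close>

lemma cong_ball:
  assumes f: "f \<in> hardy p" and g: "g \<in> hardy p" and eq: "\<And>z. norm z < 1 \<Longrightarrow> f z = g z"
  shows "\<Lambda> f = \<Lambda> g"
proof -
  have "bval f t = bval g t" for t
  proof -
    have "eventually (\<lambda>r. r \<in> {0<..<1}) (at_left (1::real))" by (rule eventually_at_left_real) simp
    then have "eventually (\<lambda>r. f (of_real r * cis t) = g (of_real r * cis t)) (at_left 1)"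
      by eventually_elim (auto intro!: eq simp: norm_mult)
    then have "((\<lambda>r. f (of_real r * cis t)) \<longlongrightarrow> l) (at_left 1) \<longleftrightarrow> ((\<lambda>r. g (of_real r * cis t)) \<longlongrightarrow> l) (at_left 1)" for l
      by (rule tendsto_cong)
    then show ?thesis by (simp add: bval_def t2_space_class.Lim_def)
  qed
  then have "norm (\<Lambda> f - \<Lambda> g) \<le> C * circ_norm p (\<lambda>t. 0)"
    using diff_le[OF f g] by simp
  then show ?thesis by (simp add: circ_norm_def)
qed

definition \<mu> :: "nat \<Rightarrow> complex" where
  "\<mu> n = \<Lambda> (\<lambda>z. z ^ n)"

lemma power_hardy: "(\<lambda>z. z ^ n) \<in> hardy p"
  by (intro hardy_disc_algebra continuous_intros holomorphic_intros pq)

lemma norm_\<mu>_le: "norm (\<mu> n) \<le> C * (2*pi) powr (1/p)"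
proof -
  have zero: "\<Lambda> (\<lambda>z. 0) = 0"
    using linear[OF power_hardy[of 0] power_hardy[of 0], of 0 0] by simp
  have "norm (\<Lambda> (\<lambda>z. z ^ n) - \<Lambda> (\<lambda>z. 0)) \<le> C * ((2*pi) powr (1/p) * 1)"
    by (rule disc_algebra_diff_le) (auto intro!: continuous_intros holomorphic_intros simp: norm_power power_le_one)
  then show ?thesis by (simp add: zero \<mu>_def)
qed

lemma \<Lambda>_polynomial: "\<Lambda> (\<lambda>z. \<Sum>n<N. a n * z ^ n) = (\<Sum>n<N. a n * \<mu> n)"
proof (induction N)
  case 0
  show ?case using linear[OF power_hardy[of 0] power_hardy[of 0], of 0 0] by simp
next
  case (Suc N)
  have h: "(\<lambda>z. \<Sum>n<N. a n * z ^ n) \<in> hardy p"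
    by (intro hardy_disc_algebra continuous_intros holomorphic_intros pq)
  show ?case
    using linear[OF h power_hardy[of N], of 1 "a N"] Suc by (simp add: \<mu>_def)
qed

text \<open>Absolute summability of the coefficients bounds the error of the partial sums uniformly
  on the closed disc by the tail \<open>T N\<close>.\<close>

lemma \<Lambda>_power_series:
  assumes f: "continuous_on (cball 0 1) f" "f holomorphic_on ball 0 1"
    and sums: "\<And>z. norm z \<le> 1 \<Longrightarrow> (\<lambda>n. a n * z ^ n) sums f z" and a: "summable (\<lambda>n. norm (a n))"
  shows "(\<lambda>n. a n * \<mu> n) sums \<Lambda> f"
proof -
  define T where "T = (\<lambda>N. \<Sum>n. norm (a (n + N)))"
  have "norm (f z - (\<Sum>n<N. a n * z ^ n)) \<le> T N" if z: "norm z \<le> 1" for z N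
  proof -
    have s: "summable (\<lambda>n. norm (a (n + N)))"
      using a by (subst summable_iff_shift[of "\<lambda>n. norm (a n)"])
    have "(\<lambda>n. a (n + N) * z ^ (n + N)) sums (f z - (\<Sum>n<N. a n * z ^ n))"
      using sums[OF z] by (subst sums_iff_shift) simp
    then have "f z - (\<Sum>n<N. a n * z ^ n) = (\<Sum>n. a (n + N) * z ^ (n + N))" by (simp add: sums_iff)
    also have "norm \<dots> \<le> T N"
      unfolding T_def using z
      by (intro norm_suminf_le s) (simp add: norm_mult norm_power mult_left_le power_le_one)
    finally show ?thesis .
  qed
  then have bd: "norm (\<Lambda> f - (\<Sum>n<N. a n * \<mu> n)) \<le> C * ((2*pi) powr (1/p) * T N)" for N
    unfolding \<Lambda>_polynomial[symmetric]
    by (intro disc_algebra_diff_le f continuous_intros holomorphic_intros) auto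
  have "T \<longlonglongrightarrow> 0"
    unfolding T_def using suminf_exist_split2[OF a] by simp
  then have lim: "(\<lambda>N. C * ((2*pi) powr (1/p) * T N)) \<longlonglongrightarrow> C * ((2*pi) powr (1/p) * 0)"
    by (intro tendsto_mult_left)
  have "eventually (\<lambda>N. norm ((\<Sum>n<N. a n * \<mu> n) - \<Lambda> f) \<le> C * ((2*pi) powr (1/p) * T N)) sequentially"
    using bd by (intro always_eventually allI) (simp only: norm_minus_commute)
  then have "(\<lambda>N. (\<Sum>n<N. a n * \<mu> n) - \<Lambda> f) \<longlonglongrightarrow> 0"
    by (rule Lim_null_comparison[OF _ lim[unfolded mult_zero_right]])
  then show ?thesis
    unfolding sums_def by (rule Lim_null[THEN iffD2])
qed

text \<open>The coefficients are forced by the monomials: pairing \<open>z ^ n\<close> with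
  \<open>h\<close> must return \<open>\<mu> n\<close>, while \<open>z ^ n\<close> paired with itself
  over the circle gives 2 pi. The conjugate offsets the one in the pairing.\<close>

definition h :: "complex \<Rightarrow> complex" where
  "h w = (\<Sum>n. cnj (\<mu> n) * w ^ n) / (2*pi)"

lemma summable_\<mu>:
  assumes "norm (w::complex) < 1"
  shows "summable (\<lambda>n. norm (\<mu> n) * norm w ^ n)"
proof (rule summable_comparison_test')
  show "summable (\<lambda>n. (C * (2*pi) powr (1/p)) * norm w ^ n)"
    using assms by (intro summable_mult summable_geometric) simp
  show "norm (norm (\<mu> n) * norm w ^ n) \<le> (C * (2*pi) powr (1/p)) * norm w ^ n" for n
    using norm_\<mu>_le[of n] by (simp add: mult_right_mono)
qed

lemma h_sums:
  assumes w: "norm w < 1"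
  shows "(\<lambda>n. cnj (\<mu> n) / (2*pi) * w ^ n) sums h w"
proof -
  have "summable (\<lambda>n. cnj (\<mu> n) * w ^ n)"
    using summable_\<mu>[OF w] by (intro summable_norm_cancel[of "\<lambda>n. cnj (\<mu> n) * w ^ n"]) (simp add: norm_mult norm_power)
  then show ?thesis
    unfolding h_def using sums_divide[OF summable_sums, of "\<lambda>n. cnj (\<mu> n) * w ^ n" "complex_of_real (2*pi)"] by simp
qed

lemma h_holomorphic: "h holomorphic_on ball 0 1"
  by (rule power_series_holomorphic[where a = "\<lambda>n. cnj (\<mu> n) / (2*pi)"]) (use h_sums in simp)

text \<open>Both sides are the sum of \<open>fourier_coeff g n * s ^ n * \<mu> n\<close>. The
  Fourier coefficients and the moments are only known to be bounded; the powers of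
  \<open>s < 1\<close> supply the absolute convergence on either side.\<close>

lemma \<Lambda>_cauchy_int:
  assumes g: "continuous_on {0..2*pi} g" and s: "0 \<le> s" "s < 1"
  shows "\<Lambda> (\<lambda>z. cauchy_int g (complex_of_real s * z))
       = integral {0..2*pi} (\<lambda>t. g t * cnj (h (of_real s * cis t)))"
proof -
  obtain B where B: "0 \<le> B" "\<And>t. t \<in> {0..2*pi} \<Longrightarrow> norm (g t) \<le> B"
    using continuous_on_bounded_Icc[OF g] by blast
  let ?a = "\<lambda>n. fourier_coeff g n * complex_of_real s ^ n"
  have ns: "norm (complex_of_real s) < 1" using s by simp
  have fc: "norm (fourier_coeff g n) \<le> B" for n
  proof -
    have "norm (integral {0..2*pi} (\<lambda>t. g t * cis (-t) ^ n)) \<le> B * (2*pi - 0)"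
      using B by (intro integral_bound continuous_intros g) (auto simp: norm_mult norm_power)
    then show ?thesis by (simp add: fourier_coeff_def norm_divide field_simps)
  qed
  have "(\<lambda>n. ?a n * \<mu> n) sums \<Lambda> (\<lambda>z. cauchy_int g (complex_of_real s * z))"
  proof (rule \<Lambda>_power_series)
    show "continuous_on (cball 0 1) (\<lambda>z. cauchy_int g (complex_of_real s * z))"
      "(\<lambda>z. cauchy_int g (complex_of_real s * z)) holomorphic_on ball 0 1"
      by (rule dilate[OF cauchy_int_holomorphic[OF g] s])+
    show "(\<lambda>n. ?a n * z ^ n) sums cauchy_int g (complex_of_real s * z)" if "norm z \<le> 1" for z
    proof -
      have "s * norm z \<le> s" using that s by (intro mult_left_le) auto
      then have "norm (complex_of_real s * z) < 1" using s by (simp add: norm_mult)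
      from cauchy_int_sums[OF g this] show ?thesis by (simp add: power_mult_distrib mult.assoc)
    qed
    show "summable (\<lambda>n. norm (?a n))"
    proof (rule summable_comparison_test')
      show "summable (\<lambda>n. B * norm (complex_of_real s) ^ n)"
        by (intro summable_mult summable_geometric) (use s in simp)
      show "norm (norm (?a n)) \<le> B * norm (complex_of_real s) ^ n" for n
        using mult_right_mono[OF fc, of "norm (complex_of_real s) ^ n" n] by (simp add: norm_mult norm_power)
    qed
  qed
  moreover have "(\<lambda>n. ?a n * \<mu> n) sums integral {0..2*pi} (\<lambda>t. g t * cnj (h (of_real s * cis t)))"
  proof -
    let ?u = "\<lambda>n t. g t * (\<mu> n / (2*pi) * (of_real s * cis (-t)) ^ n)"
    have "(\<lambda>n. integral {0..2*pi} (?u n)) sums integral {0..2*pi} (\<lambda>t. \<Sum>n. ?u n t)"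
    proof (rule integral_sums_Weierstrass)
      show "continuous_on {0..2*pi} (?u n)" for n by (intro continuous_intros g) auto
      show "norm (?u n t) \<le> B / (2*pi) * (norm (\<mu> n) * norm (complex_of_real s) ^ n)" if "t \<in> {0..2*pi}" for n t
        using mult_right_mono[OF B(2)[OF that], of "norm (\<mu> n) * norm (complex_of_real s) ^ n / (2*pi)"]
        by (simp add: norm_mult norm_divide norm_power)
      show "summable (\<lambda>n. B / (2*pi) * (norm (\<mu> n) * norm (complex_of_real s) ^ n))"
        by (intro summable_mult summable_\<mu> ns)
    qed
    moreover have "integral {0..2*pi} (?u n) = ?a n * \<mu> n" for n
    proof -
      have "?u n = (\<lambda>t. (\<mu> n / (2*pi) * complex_of_real s ^ n) * (g t * cis (-t) ^ n))"
        by (simp add: fun_eq_iff power_mult_distrib)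
      then have "integral {0..2*pi} (?u n) = (\<mu> n / (2*pi) * complex_of_real s ^ n) * integral {0..2*pi} (\<lambda>t. g t * cis (-t) ^ n)"
        by (simp only: integral_mult_right)
      then show ?thesis by (simp add: fourier_coeff_def)
    qed
    moreover have "(\<Sum>n. ?u n t) = g t * cnj (h (of_real s * cis t))" for t
    proof -
      have "norm (of_real s * cis t) < 1" using s by (simp add: norm_mult)
      from h_sums[OF this]
      have "(\<lambda>n. cnj (cnj (\<mu> n) / (2*pi) * (of_real s * cis t) ^ n)) sums cnj (h (of_real s * cis t))"
        by (simp only: sums_cnj)
      then have "(\<lambda>n. \<mu> n / (2*pi) * (of_real s * cis (-t)) ^ n) sums cnj (h (of_real s * cis t))"
        by (simp add: cis_cnj)
      from sums_mult[OF this, of "g t"] show ?thesis by (simp add: sums_iff)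
    qed
    ultimately show ?thesis by simp
  qed
  ultimately show ?thesis by (rule sums_unique2)
qed

lemma h_hardy: "h \<in> hardy q"
proof -
  obtain A where A: "0 \<le> A" "\<And>g r. continuous_on {0..2*pi} g \<Longrightarrow> 0 \<le> r \<Longrightarrow> r < 1 \<Longrightarrow>
    integral {0..2*pi} (\<lambda>t. norm (cauchy_int g (of_real r * cis t)) powr p)
       \<le> A * integral {0..2*pi} (\<lambda>t. norm (g t) powr p)"
    using riesz_projection[OF pq(1)] by metis
  have qp: "p = q / (q - 1)" using pq by (simp add: field_simps)
  have "integral {0..2*pi} (\<lambda>t. norm (h (of_real s * cis t)) powr q) \<le> (C * A powr (1/p)) powr q"
    if s': "0 \<le> s" "s < 1" for s
  proof -
    let ?h = "\<lambda>t. h (of_real s * cis t)"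
    define k where "k = (\<lambda>t. duality_map q (?h t))"
    define X where "X = integral {0..2*pi} (\<lambda>t. norm (?h t) powr q)"
    have ch: "continuous_on {0..2*pi} ?h" by (rule continuous_circ_slice[OF h_holomorphic s'])
    have ck: "continuous_on {0..2*pi} k" unfolding k_def
      by (rule continuous_on_compose2[OF continuous_duality_map[OF pq(2)] ch]) auto
    have X0: "0 \<le> X" unfolding X_def using pq ch by (auto intro!: integral_nonneg continuous_on_mean_powr)
    have kp: "norm (k t) powr p = norm (?h t) powr q" for t
      using pq by (simp add: k_def norm_duality_map powr_powr qp)
    let ?G = "\<lambda>z. cauchy_int k (complex_of_real s * z)"
    have G: "continuous_on (cball 0 1) ?G" "?G holomorphic_on ball 0 1"
      by (rule dilate[OF cauchy_int_holomorphic[OF ck] s'])+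
    have "complex_of_real X = integral {0..2*pi} (\<lambda>t. k t * cnj (?h t))"
      using integral_of_real_Icc[OF continuous_on_mean_powr[OF ch], of q] pq
      by (simp add: X_def k_def duality_map_mult_cnj)
    also have "\<dots> = \<Lambda> ?G" by (rule \<Lambda>_cauchy_int[OF ck s', symmetric])
    finally have "X = norm (\<Lambda> ?G)" using X0 by (metis abs_of_nonneg norm_of_real)
    also have "\<dots> \<le> C * circ_norm p (bval ?G)"
      by (intro bounded hardy_disc_algebra G pq)
    also have "circ_norm p (bval ?G) = (integral {0..2*pi} (\<lambda>t. norm (?G (cis t)) powr p)) powr (1/p)"
      unfolding circ_norm_def bval_continuous[OF G(1)] using pq
      by (subst continuous_circ(2))
        (auto intro!: continuous_on_powr_nonneg continuous_on_norm continuous_circ_slice cauchy_int_holomorphic ck s')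
    also have "C * \<dots> \<le> C * (A * X) powr (1/p)"
    proof (intro mult_left_mono powr_mono2 C)
      show "integral {0..2*pi} (\<lambda>t. norm (?G (cis t)) powr p) \<le> A * X"
        using A(2)[OF ck s'] by (simp add: kp X_def)
      show "0 \<le> integral {0..2*pi} (\<lambda>t. norm (?G (cis t)) powr p)"
        using pq by (intro integral_nonneg continuous_on_mean_powr continuous_circ_slice cauchy_int_holomorphic ck s') auto
    qed (use pq in auto)
    also have "\<dots> = (C * A powr (1/p)) * X powr (1/p)"
      using A X0 by (simp add: powr_mult)
    \<comment> \<open>Absorption with the roles of \<open>p\<close> and \<open>q\<close> exchanged;
      the resulting bound is independent of the radius \<open>s\<close>.\<close>
    finally have "X \<le> (C * A powr (1/p)) powr q"
      using pq C by (intro powr_le_of_le_mult_powr[of q p] X0) auto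
    then show ?thesis by (simp add: X_def)
  qed
  then show ?thesis by (rule hardyI[OF h_holomorphic])
qed

text \<open>The radius \<open>r\<close> enters twice: the boundary data are the slice at
  \<open>r\<close>, whose Cauchy integral is the dilate of \<open>f\<close> by \<open>r\<close>, and
  \<open>\<Lambda>_cauchy_int\<close> dilates once more while moving \<open>h\<close> to the circle
  of radius \<open>r\<close>.\<close>

lemma \<Lambda>_dilate:
  assumes f: "f \<in> hardy p" and r: "0 \<le> r" "r < 1"
  shows "\<Lambda> (\<lambda>z. f (complex_of_real (r * r) * z))
    = integral {0..2*pi} (\<lambda>t. f (of_real r * cis t) * cnj (h (of_real r * cis t)))"
proof -
  have hf: "f holomorphic_on ball 0 1" using f by (rule hardy_holomorphic)
  let ?g = "\<lambda>t. f (of_real r * cis t)"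
  have cg: "continuous_on {0..2*pi} ?g" by (rule continuous_circ_slice[OF hf r])
  have rr: "0 \<le> r * r" "r * r < 1" using r mult_left_le[of r r] by (simp, linarith)
  have ci: "cauchy_int ?g z = f (complex_of_real r * z)" if "norm z < 1" for z
    using integral_unique[OF Cauchy_circle[OF dilate[OF hf r] that]] by (simp add: cauchy_int_def)
  have "\<Lambda> (\<lambda>z. f (complex_of_real (r * r) * z)) = \<Lambda> (\<lambda>z. cauchy_int ?g (complex_of_real r * z))"
  proof (rule cong_ball)
    show "(\<lambda>z. f (complex_of_real (r * r) * z)) \<in> hardy p"
      by (intro hardy_disc_algebra dilate hf rr pq)
    show "(\<lambda>z. cauchy_int ?g (complex_of_real r * z)) \<in> hardy p"
      by (intro hardy_disc_algebra dilate cauchy_int_holomorphic cg r pq)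
    fix z :: complex assume "norm z < 1"
    then have "r * norm z \<le> r" using r by (intro mult_left_le) auto
    then have "norm (complex_of_real r * z) < 1" using r by (simp add: norm_mult)
    from ci[OF this] show "f (complex_of_real (r * r) * z) = cauchy_int ?g (complex_of_real r * z)"
      by (simp add: mult.assoc)
  qed
  also have "\<dots> = integral {0..2*pi} (\<lambda>t. ?g t * cnj (h (of_real r * cis t)))"
    by (rule \<Lambda>_cauchy_int[OF cg r])
  finally show ?thesis .
qed

text \<open>The limit of \<open>\<Lambda>_dilate\<close> as \<open>r\<close> tends to 1. On the left
  the dilates converge to \<open>f\<close> in the norm that bounds the functional; on the right the
  pairings of slices converge to the boundary pairing.\<close>

lemma representation:
  assumes f: "f \<in> hardy p"
  shows "\<Lambda> f = integral\<^sup>L circ (\<lambda>t. bval f t * cnj (bval h t))"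
proof -
  have hf: "f holomorphic_on ball 0 1" using f by (rule hardy_holomorphic)
  have sq: "filterlim (\<lambda>r::real. r * r) (at_left 1) (at_left 1)"
  proof -
    have "((\<lambda>r::real. r * r) \<longlongrightarrow> 1 * 1) (at_left 1)" by (intro tendsto_intros)
    moreover have "eventually (\<lambda>r. r \<in> {0<..<1}) (at_left (1::real))" by (rule eventually_at_left_real) simp
    then have "eventually (\<lambda>r::real. r * r \<in> {..<1} \<and> r * r \<noteq> 1) (at_left 1)"
    proof eventually_elim
      case (elim r)
      then have "r * r \<le> r" "r < 1" by (auto intro: mult_left_le)
      then show ?case by simp
    qed
    ultimately show ?thesis by (simp add: filterlim_at)
  qed
  have bd: "norm (\<Lambda> (\<lambda>z. f (complex_of_real r * z)) - \<Lambda> f) \<le> C * circ_norm p (\<lambda>t. bval f t - f (of_real r * cis t))"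
    if r: "0 \<le> r" "r < 1" for r
    using diff_le[OF f hardy_disc_algebra[OF dilate[OF hf r] pq(1)]]
    by (simp add: bval_continuous[OF dilate(1)[OF hf r]] norm_minus_commute)
  have lim: "((\<lambda>r. C * circ_norm p (\<lambda>t. bval f t - f (of_real r * cis t))) \<longlongrightarrow> C * 0) (at_left 1)"
    by (rule tendsto_mult[OF tendsto_const circ_norm_slice_tendsto[OF f pq(1)]])
  have ev: "eventually (\<lambda>r. r \<in> {0<..<1}) (at_left (1::real))" by (rule eventually_at_left_real) simp
  then have "eventually (\<lambda>r. norm (\<Lambda> (\<lambda>z. f (complex_of_real r * z)) - \<Lambda> f)
      \<le> C * circ_norm p (\<lambda>t. bval f t - f (of_real r * cis t))) (at_left 1)"
    by eventually_elim (rule bd; simp)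
  then have "((\<lambda>r. \<Lambda> (\<lambda>z. f (complex_of_real r * z)) - \<Lambda> f) \<longlongrightarrow> 0) (at_left 1)"
    by (rule Lim_null_comparison[OF _ lim[unfolded mult_zero_right]])
  then have "((\<lambda>r. \<Lambda> (\<lambda>z. f (complex_of_real r * z))) \<longlongrightarrow> \<Lambda> f) (at_left 1)"
    by (rule Lim_null[THEN iffD2])
  then have "((\<lambda>r. \<Lambda> (\<lambda>z. f (complex_of_real (r * r) * z))) \<longlongrightarrow> \<Lambda> f) (at_left 1)"
    using sq by (rule filterlim_compose)
  moreover have "eventually (\<lambda>r. \<Lambda> (\<lambda>z. f (complex_of_real (r * r) * z))
     = integral {0..2*pi} (\<lambda>t. f (of_real r * cis t) * cnj (h (of_real r * cis t)))) (at_left 1)"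
    using ev by eventually_elim (rule \<Lambda>_dilate[OF f]; simp)
  ultimately have "((\<lambda>r. integral {0..2*pi} (\<lambda>t. f (of_real r * cis t) * cnj (h (of_real r * cis t)))) \<longlongrightarrow> \<Lambda> f) (at_left 1)"
    by (rule Lim_transform_eventually)
  then show ?thesis
    using pairing_slices_tendsto[OF pq f h_hardy] by (intro tendsto_unique[OF trivial_limit_at_left_real])
qed

end

subsection \<open>The weight\<close>

text \<open>A branch of \<open>(1 - z)\<^sup>\<alpha>\<close>. It vanishes nowhere, the junk value at \<open>z = 1\<close> included, so that
  multiplication by it is a bijection of functions on the whole plane.\<close>
definition disc_weight :: "real \<Rightarrow> complex \<Rightarrow> complex" where
  "disc_weight \<alpha> z = exp (of_real \<alpha> * Ln (1 - z))"

lemma disc_weight_nonzero: "disc_weight \<alpha> z \<noteq> 0"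
  by (simp add: disc_weight_def)

lemma norm_disc_weight: "z \<noteq> 1 \<Longrightarrow> norm (disc_weight \<alpha> z) = norm (z - 1) powr \<alpha>"
  by (simp add: disc_weight_def powr_def norm_minus_commute)

text \<open>The half plane contains the closed disc except the point 1, so the weight is continuous
  at almost every boundary point.\<close>

lemma disc_weight_holomorphic: "disc_weight \<alpha> holomorphic_on {z. Re z < 1}"
proof -
  have "1 - z \<notin> \<real>\<^sub>\<le>\<^sub>0" if "Re z < 1" for z
    using that by (auto simp: complex_nonpos_Reals_iff)
  then have "(\<lambda>z. exp (of_real \<alpha> * Ln (1 - z))) holomorphic_on {z. Re z < 1}"
    by (intro holomorphic_intros) auto
  then show ?thesis by (simp add: disc_weight_def[abs_def])
qed

lemma Re_less_1_of_norm: "norm z < 1 \<Longrightarrow> Re z < 1"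
  using complex_Re_le_cmod[of z] by linarith

lemma disc_weight_holomorphic_ball: "disc_weight \<alpha> holomorphic_on ball 0 1"
  by (rule holomorphic_on_subset[OF disc_weight_holomorphic]) (auto simp: Re_less_1_of_norm)

lemma slice_neq_1:
  assumes "0 \<le> r" "r < 1" shows "of_real r * cis \<theta> \<noteq> 1"
proof
  assume "of_real r * cis \<theta> = 1"
  then have "norm (of_real r * cis \<theta>) = 1" by simp
  then show False using assms by (simp add: norm_mult)
qed

text \<open>The exponent \<open>\<alpha> * p\<close> is the one for which the weight is the p-th
  power of the modulus of \<open>disc_weight\<close>; since that function has no zeros, holomorphy
  passes in both directions.\<close>

lemma wHardy_iff:
  assumes p: "1 < p"
  shows "f \<in> wHardy p (\<alpha> * p) \<longleftrightarrow> (\<lambda>z. disc_weight \<alpha> z * f z) \<in> hardy p"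
proof -
  let ?F = "\<lambda>z. disc_weight \<alpha> z * f z"
  have hol: "f holomorphic_on ball 0 1 \<longleftrightarrow> ?F holomorphic_on ball 0 1"
  proof
    assume "?F holomorphic_on ball 0 1"
    then have "(\<lambda>z. ?F z / disc_weight \<alpha> z) holomorphic_on ball 0 1"
      by (intro holomorphic_on_divide disc_weight_holomorphic_ball) (simp_all add: disc_weight_nonzero)
    then show "f holomorphic_on ball 0 1" by (simp add: disc_weight_nonzero)
  qed (intro holomorphic_intros disc_weight_holomorphic_ball)
  have int: "(LINT \<theta>:{0..2*pi}|lborel. norm (f (of_real r * cis \<theta>)) powr p * norm (of_real r * cis \<theta> - 1) powr (\<alpha> * p))
     = integral {0..2*pi} (\<lambda>\<theta>. norm (?F (of_real r * cis \<theta>)) powr p)"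
    if F: "?F holomorphic_on ball 0 1" and r: "r \<in> {0..<1}" for r
  proof -
    have "norm (f (of_real r * cis \<theta>)) powr p * norm (of_real r * cis \<theta> - 1) powr (\<alpha> * p)
       = norm (?F (of_real r * cis \<theta>)) powr p" for \<theta>
      using r slice_neq_1[of r \<theta>] by (simp add: norm_mult norm_disc_weight powr_mult powr_powr mult.commute)
    then have "(LINT \<theta>:{0..2*pi}|lborel. norm (f (of_real r * cis \<theta>)) powr p * norm (of_real r * cis \<theta> - 1) powr (\<alpha> * p))
      = integral\<^sup>L circ (\<lambda>\<theta>. norm (?F (of_real r * cis \<theta>)) powr p)"
      by (simp only: LINT_circ)
    also have "\<dots> = integral {0..2*pi} (\<lambda>\<theta>. norm (?F (of_real r * cis \<theta>)) powr p)"
      using p r by (intro continuous_circ(2) continuous_on_powr_nonneg continuous_on_norm continuous_circ_slice[OF F]) auto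
    finally show ?thesis .
  qed
  show ?thesis
  proof (cases "?F holomorphic_on ball 0 1")
    case True
    have "((\<lambda>r. LINT \<theta>:{0..2*pi}|lborel. norm (f (of_real r * cis \<theta>)) powr p * norm (of_real r * cis \<theta> - 1) powr (\<alpha> * p)) ` {0..<1})
      = ((\<lambda>r. integral {0..2*pi} (\<lambda>\<theta>. norm (?F (of_real r * cis \<theta>)) powr p)) ` {0..<1})"
      by (rule image_cong[OF refl int[OF True]])
    then show ?thesis
      unfolding wHardy_def hardy_def mem_Collect_eq hol bdd_above_def by (simp only: ball_simps)
  qed (simp add: wHardy_def hardy_def hol)
qed

lemma AE_circ_cis: "AE \<theta> in circ. cis \<theta> \<noteq> 1"
proof -
  have "{0, 2*pi} \<in> null_sets lborel" by (intro finite_imp_null_set_lborel) auto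
  then have "AE \<theta> in lborel. \<theta> \<notin> {0, 2*pi}" by (rule AE_not_in)
  then have "AE \<theta> in lborel. \<theta> \<in> {0..2*pi} \<longrightarrow> cis \<theta> \<noteq> 1"
  proof eventually_elim
    case (elim \<theta>)
    show ?case
    proof (intro impI notI)
      assume \<theta>: "\<theta> \<in> {0..2*pi}" "cis \<theta> = 1"
      then have "cos \<theta> = 1" by (metis Re_complex_of_real cis.sel(1) of_real_1)
      then obtain n :: int where "\<theta> = of_int n * (2 * pi)" using cos_one_2pi_int[of \<theta>] by (auto simp: algebra_simps)
      then have "real_of_int n = \<theta> / (2 * pi)" by simp
      moreover have "0 \<le> \<theta> / (2 * pi)" "\<theta> / (2 * pi) \<le> 1" using \<theta> by simp_all
      ultimately have "n = 0 \<or> n = 1" by linarith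
      then show False using elim \<open>\<theta> = of_int n * (2 * pi)\<close> by auto
    qed
  qed
  then show ?thesis by (simp add: AE_restrict_space_iff)
qed

text \<open>Existence of the limit is known for the product. Dividing by the weight, which is
  continuous and nonzero at every boundary point other than 1, yields the limit of \<open>f\<close>
  itself.\<close>

lemma bval_disc_weight:
  assumes F: "(\<lambda>z. disc_weight \<alpha> z * f z) \<in> hardy p" and p: "1 < p"
  shows "AE \<theta> in circ. bval (\<lambda>z. disc_weight \<alpha> z * f z) \<theta> = disc_weight \<alpha> (cis \<theta>) * bval f \<theta>
      \<and> norm (disc_weight \<alpha> (cis \<theta>)) = norm (cis \<theta> - 1) powr \<alpha>"
  using hardy_bval_limit[OF F p] AE_circ_cis
proof eventually_elim
  case (elim \<theta>)
  let ?F = "\<lambda>z. disc_weight \<alpha> z * f z"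
  have "cos \<theta> \<noteq> 1"
  proof
    assume "cos \<theta> = 1"
    then have "sin \<theta> = 0" using sin_cos_squared_add[of \<theta>] by simp
    then show False using \<open>cos \<theta> = 1\<close> elim(2) by (simp add: complex_eq_iff)
  qed
  then have "Re (cis \<theta>) < 1" using cos_le_one[of \<theta>] by (simp add: less_le)
  moreover have "open {z. Re z < 1}" by (intro open_Collect_less continuous_intros)
  ultimately have cont: "isCont (disc_weight \<alpha>) (cis \<theta>)"
    using holomorphic_on_imp_continuous_on[OF disc_weight_holomorphic[of \<alpha>]]
    by (simp add: continuous_on_eq_continuous_at)
  have "((\<lambda>r. of_real r * cis \<theta>) \<longlongrightarrow> of_real 1 * cis \<theta>) (at_left 1)"
    by (intro tendsto_intros)
  then have "((\<lambda>r. of_real r * cis \<theta>) \<longlongrightarrow> cis \<theta>) (at_left 1)" by simp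
  from isCont_tendsto_compose[OF cont this]
  have w: "((\<lambda>r. disc_weight \<alpha> (of_real r * cis \<theta>)) \<longlongrightarrow> disc_weight \<alpha> (cis \<theta>)) (at_left 1)" .
  have "((\<lambda>r. ?F (of_real r * cis \<theta>) / disc_weight \<alpha> (of_real r * cis \<theta>)) \<longlongrightarrow> bval ?F \<theta> / disc_weight \<alpha> (cis \<theta>)) (at_left 1)"
    by (rule tendsto_divide[OF elim(1) w disc_weight_nonzero])
  then have "((\<lambda>r. f (of_real r * cis \<theta>)) \<longlongrightarrow> bval ?F \<theta> / disc_weight \<alpha> (cis \<theta>)) (at_left 1)"
    by (simp add: disc_weight_nonzero)
  then have "bval f \<theta> = bval ?F \<theta> / disc_weight \<alpha> (cis \<theta>)" by (rule bval_eqI)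
  then show ?case using norm_disc_weight[OF elim(2)] by (simp add: disc_weight_nonzero)
qed

section \<open>Transfer of norm, pairing and functionals to the unweighted space\<close>

lemma wHardy_holomorphic: "f \<in> wHardy p \<beta> \<Longrightarrow> f holomorphic_on ball 0 1"
  by (simp add: wHardy_def)

lemma wHardy_norm_eq:
  assumes f: "f \<in> wHardy p (\<alpha> * p)" and p: "1 < p"
  shows "wHardy_norm p (\<alpha> * p) f = circ_norm p (bval (\<lambda>z. disc_weight \<alpha> z * f z))"
proof -
  have F: "(\<lambda>z. disc_weight \<alpha> z * f z) \<in> hardy p" using f wHardy_iff[OF p] by blast
  have [measurable]: "bval f \<in> borel_measurable circ"
    by (intro measurable_circ bval_measurable wHardy_holomorphic[OF f])
  have [measurable]: "cis \<in> borel_measurable circ"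
    by (intro measurable_circ borel_measurable_continuous_onI continuous_intros)
  have "integral\<^sup>L circ (\<lambda>\<theta>. norm (bval f \<theta>) powr p * norm (cis \<theta> - 1) powr (\<alpha> * p))
      = integral\<^sup>L circ (\<lambda>\<theta>. norm (bval (\<lambda>z. disc_weight \<alpha> z * f z) \<theta>) powr p)"
  proof (rule integral_cong_AE)
    show "AE \<theta> in circ. norm (bval f \<theta>) powr p * norm (cis \<theta> - 1) powr (\<alpha> * p)
        = norm (bval (\<lambda>z. disc_weight \<alpha> z * f z) \<theta>) powr p"
      using bval_disc_weight[OF F p]
      by eventually_elim (simp add: norm_mult powr_mult powr_powr mult.commute)
    show "(\<lambda>\<theta>. norm (bval f \<theta>) powr p * norm (cis \<theta> - 1) powr (\<alpha> * p)) \<in> borel_measurable circ"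
      by measurable
  qed (intro borel_measurable_norm_powr hardy_bval_measurable[OF F])
  then show ?thesis by (simp add: wHardy_norm_def circ_norm_def LINT_circ)
qed

text \<open>Each function absorbs one factor \<open>disc_weight\<close>; the product of the weight
  with its conjugate has exponent \<open>2*\<alpha>\<close>, whatever \<open>p\<close> and
  \<open>q\<close> are.\<close>

lemma weighted_pairing_AE:
  assumes F: "(\<lambda>z. disc_weight \<alpha> z * f z) \<in> hardy p" and p: "1 < p"
    and H: "(\<lambda>z. disc_weight \<alpha> z * h z) \<in> hardy q" and q: "1 < q"
  shows "AE \<theta> in circ. bval f \<theta> * cnj (bval h \<theta>) * complex_of_real (norm (cis \<theta> - 1) powr (2*\<alpha>))
    = bval (\<lambda>z. disc_weight \<alpha> z * f z) \<theta> * cnj (bval (\<lambda>z. disc_weight \<alpha> z * h z) \<theta>)"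
  using bval_disc_weight[OF F p] bval_disc_weight[OF H q]
proof eventually_elim
  case (elim \<theta>)
  have "disc_weight \<alpha> (cis \<theta>) * cnj (disc_weight \<alpha> (cis \<theta>)) = of_real ((norm (cis \<theta> - 1) powr \<alpha>)\<^sup>2)"
    using elim by (metis complex_norm_square of_real_power)
  also have "(norm (cis \<theta> - 1) powr \<alpha>)\<^sup>2 = norm (cis \<theta> - 1) powr (2*\<alpha>)"
    by (simp add: power2_eq_square flip: powr_add)
  finally have w: "disc_weight \<alpha> (cis \<theta>) * cnj (disc_weight \<alpha> (cis \<theta>)) = complex_of_real (norm (cis \<theta> - 1) powr (2*\<alpha>))" .
  show ?case unfolding w[symmetric] using elim by simp
qed

lemma weighted_pairing_measurable:
  assumes "f holomorphic_on ball 0 1" "h holomorphic_on ball 0 1"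
  shows "(\<lambda>\<theta>. bval f \<theta> * cnj (bval h \<theta>) * complex_of_real (norm (cis \<theta> - 1) powr (2*\<alpha>))) \<in> borel_measurable circ"
proof -
  have [measurable]: "cis \<in> borel_measurable circ"
    by (intro measurable_circ borel_measurable_continuous_onI continuous_intros)
  have [measurable]: "cnj \<in> borel_measurable borel"
    by (intro borel_measurable_continuous_onI continuous_intros)
  note [measurable] = bval_measurable[OF assms(1), THEN measurable_circ] bval_measurable[OF assms(2), THEN measurable_circ]
  show ?thesis by measurable
qed

lemma pairing_eq:
  assumes pq: "1 < p" "1 < q" "1/p + 1/q = 1" and f: "f \<in> wHardy p (\<alpha> * p)" and h: "h \<in> wHardy q (\<alpha> * q)"
  shows "integrable circ (\<lambda>\<theta>. bval f \<theta> * cnj (bval h \<theta>) * complex_of_real (norm (cis \<theta> - 1) powr (2*\<alpha>)))"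
    and "pairing \<alpha> f h = integral\<^sup>L circ (\<lambda>\<theta>. bval (\<lambda>z. disc_weight \<alpha> z * f z) \<theta> * cnj (bval (\<lambda>z. disc_weight \<alpha> z * h z) \<theta>))"
proof -
  have F: "(\<lambda>z. disc_weight \<alpha> z * f z) \<in> hardy p" and H: "(\<lambda>z. disc_weight \<alpha> z * h z) \<in> hardy q"
    using f h wHardy_iff pq by blast+
  note m = weighted_pairing_measurable[OF wHardy_holomorphic[OF f] wHardy_holomorphic[OF h]]
  note ae = weighted_pairing_AE[OF F pq(1) H pq(2)]
  have i: "integrable circ (\<lambda>\<theta>. bval (\<lambda>z. disc_weight \<alpha> z * f z) \<theta> * cnj (bval (\<lambda>z. disc_weight \<alpha> z * h z) \<theta>))"
    by (intro pairing_Holder(1)[OF pq] hardy_bval_measurable[OF F] hardy_bval_measurable[OF H]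
        hardy_bval_integrable[OF F pq(1)] hardy_bval_integrable[OF H pq(2)])
  show "integrable circ (\<lambda>\<theta>. bval f \<theta> * cnj (bval h \<theta>) * complex_of_real (norm (cis \<theta> - 1) powr (2*\<alpha>)))"
    by (rule integrable_cong_AE_imp[OF i m]) (use ae in \<open>simp add: eq_commute\<close>)
  show "pairing \<alpha> f h = integral\<^sup>L circ (\<lambda>\<theta>. bval (\<lambda>z. disc_weight \<alpha> z * f z) \<theta> * cnj (bval (\<lambda>z. disc_weight \<alpha> z * h z) \<theta>))"
    unfolding pairing_def LINT_circ
    by (rule integral_cong_AE[OF m borel_measurable_integrable[OF i] ae])
qed

lemma pairing_bounded_linear:
  assumes pq: "1 < p" "1 < q" "1/p + 1/q = 1" and h: "h \<in> wHardy q (\<alpha> * q)"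
  shows "bounded_linear_functional_on p (\<alpha> * p) (\<lambda>f. pairing \<alpha> f h)"
  unfolding bounded_linear_functional_on_def
proof (intro conjI ballI allI exI)
  let ?W = "disc_weight \<alpha>"
  have H: "(\<lambda>z. ?W z * h z) \<in> hardy q" using h wHardy_iff pq by blast
  note mH = hardy_bval_measurable[OF H]
  note iH = hardy_bval_integrable[OF H pq(2)]
  have hF: "(\<lambda>z. ?W z * f z) \<in> hardy p" if "f \<in> wHardy p (\<alpha> * p)" for f
    using that wHardy_iff pq by blast
  have i: "integrable circ (\<lambda>\<theta>. bval F \<theta> * cnj (bval (\<lambda>z. ?W z * h z) \<theta>))" if "F \<in> hardy p" for F
    by (rule pairing_Holder(1)[OF pq hardy_bval_measurable[OF that] hardy_bval_integrable[OF that pq(1)] mH iH])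
  show "norm (pairing \<alpha> f h) \<le> circ_norm q (bval (\<lambda>z. ?W z * h z)) * wHardy_norm p (\<alpha> * p) f"
    if f: "f \<in> wHardy p (\<alpha> * p)" for f
    unfolding pairing_eq(2)[OF pq f h] wHardy_norm_eq[OF f pq(1)]
    using pairing_Holder(2)[OF pq hardy_bval_measurable[OF hF[OF f]] hardy_bval_integrable[OF hF[OF f] pq(1)] mH iH]
    by (simp add: mult.commute)
  fix f g a b
  assume f: "f \<in> wHardy p (\<alpha> * p)" and g: "g \<in> wHardy p (\<alpha> * p)"
  let ?F = "\<lambda>z. ?W z * f z" and ?G = "\<lambda>z. ?W z * g z" and ?H = "\<lambda>z. ?W z * h z"
  have eq: "(\<lambda>z. ?W z * (a * f z + b * g z)) = (\<lambda>z. a * ?F z + b * ?G z)"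
    by (simp add: fun_eq_iff algebra_simps)
  have S: "(\<lambda>z. a * ?F z + b * ?G z) \<in> hardy p" by (rule hardy_lincomb[OF hF[OF f] hF[OF g] pq(1)])
  have fg: "(\<lambda>z. a * f z + b * g z) \<in> wHardy p (\<alpha> * p)"
    unfolding wHardy_iff[OF pq(1)] eq by (rule S)
  have "pairing \<alpha> (\<lambda>z. a * f z + b * g z) h = integral\<^sup>L circ (\<lambda>\<theta>. bval (\<lambda>z. a * ?F z + b * ?G z) \<theta> * cnj (bval ?H \<theta>))"
    unfolding pairing_eq(2)[OF pq fg h] eq ..
  also have "\<dots> = integral\<^sup>L circ (\<lambda>\<theta>. a * (bval ?F \<theta> * cnj (bval ?H \<theta>)) + b * (bval ?G \<theta> * cnj (bval ?H \<theta>)))"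
  proof (rule integral_cong_AE)
    show "AE \<theta> in circ. bval (\<lambda>z. a * ?F z + b * ?G z) \<theta> * cnj (bval ?H \<theta>)
       = a * (bval ?F \<theta> * cnj (bval ?H \<theta>)) + b * (bval ?G \<theta> * cnj (bval ?H \<theta>))"
      using bval_lincomb_AE[OF hF[OF f] hF[OF g] pq(1), of a b]
      by eventually_elim (simp only: ring_distribs mult.assoc)
  qed (intro borel_measurable_integrable Bochner_Integration.integrable_add integrable_mult_right i S hF f g)+
  also have "\<dots> = a * integral\<^sup>L circ (\<lambda>\<theta>. bval ?F \<theta> * cnj (bval ?H \<theta>)) + b * integral\<^sup>L circ (\<lambda>\<theta>. bval ?G \<theta> * cnj (bval ?H \<theta>))"
    by (subst Bochner_Integration.integral_add)
       (intro integrable_mult_right i hF f g | simp only: integral_mult_right_zero)+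
  finally show "pairing \<alpha> (\<lambda>z. a * f z + b * g z) h = a * pairing \<alpha> f h + b * pairing \<alpha> g h"
    by (simp only: pairing_eq(2)[OF pq f h] pairing_eq(2)[OF pq g h])
qed

text \<open>The functional is pulled back along division by the weight. The representing function is
  divided by the weight too, since the weighted pairing multiplies it back.\<close>

lemma pairing_represents:
  assumes pq: "1 < p" "1 < q" "1/p + 1/q = 1" and L: "bounded_linear_functional_on p (\<alpha> * p) L"
  shows "\<exists>h\<in>wHardy q (\<alpha> * q). \<forall>f\<in>wHardy p (\<alpha> * p). L f = pairing \<alpha> f h"
proof -
  let ?W = "disc_weight \<alpha>"
  obtain C where C: "\<And>f. f \<in> wHardy p (\<alpha> * p) \<Longrightarrow> norm (L f) \<le> C * wHardy_norm p (\<alpha> * p) f"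
    and lin: "\<And>f g a b. f \<in> wHardy p (\<alpha> * p) \<Longrightarrow> g \<in> wHardy p (\<alpha> * p) \<Longrightarrow> L (\<lambda>z. a * f z + b * g z) = a * L f + b * L g"
    using L unfolding bounded_linear_functional_on_def by blast
  define \<Lambda> where "\<Lambda> = (\<lambda>F. L (\<lambda>z. F z / ?W z))"
  have W: "?W z * (F z / ?W z) = F z" for F z by (simp add: disc_weight_nonzero)
  have div: "(\<lambda>z. F z / ?W z) \<in> wHardy s (\<alpha> * s)" if "F \<in> hardy s" "1 < s" for F s
    using that by (simp add: wHardy_iff disc_weight_nonzero)
  \<comment> \<open>The definition of a bounded functional leaves the sign of the constant open,
    whereas the locale asks for a nonnegative one.\<close>
  interpret hardy_functional p q \<Lambda> "max C 0"
  proof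
    fix f g a b assume "f \<in> hardy p" "g \<in> hardy p"
    then show "\<Lambda> (\<lambda>z. a * f z + b * g z) = a * \<Lambda> f + b * \<Lambda> g"
      using lin[of "\<lambda>z. f z / ?W z" "\<lambda>z. g z / ?W z" a b] div pq(1)
      by (simp add: \<Lambda>_def add_divide_distrib)
  next
    fix F assume F: "F \<in> hardy p"
    have "norm (\<Lambda> F) \<le> C * circ_norm p (bval F)"
      using C[OF div[OF F pq(1)]] wHardy_norm_eq[OF div[OF F pq(1)] pq(1)] by (simp add: \<Lambda>_def disc_weight_nonzero)
    also have "\<dots> \<le> max C 0 * circ_norm p (bval F)"
      by (intro mult_right_mono) (auto simp: circ_norm_def)
    finally show "norm (\<Lambda> F) \<le> max C 0 * circ_norm p (bval F)" .
  qed (use pq in auto)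
  show ?thesis
  proof (intro bexI ballI)
    show h': "(\<lambda>z. h z / ?W z) \<in> wHardy q (\<alpha> * q)" by (rule div[OF h_hardy pq(2)])
    fix f assume f: "f \<in> wHardy p (\<alpha> * p)"
    then have "(\<lambda>z. ?W z * f z) \<in> hardy p" using wHardy_iff pq by blast
    from representation[OF this]
    show "L f = pairing \<alpha> f (\<lambda>z. h z / ?W z)"
      unfolding pairing_eq(2)[OF pq f h'] by (simp add: \<Lambda>_def disc_weight_nonzero)
  qed
qed

theorem theorem5:
  fixes \<alpha> p q :: real
  assumes "\<alpha> \<ge> 0" and "1 < p" and "1/p + 1/q = 1"
  shows "(\<forall>h\<in>wHardy q (\<alpha>*q).
            (\<forall>f\<in>wHardy p (\<alpha>*p). set_integrable lborel {0..2*pi}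
               (\<lambda>\<theta>. bval f \<theta> * cnj (bval h \<theta>) * complex_of_real (norm (cis \<theta> - 1) powr (2*\<alpha>)))) \<and>
            bounded_linear_functional_on p (\<alpha>*p) (\<lambda>f. pairing \<alpha> f h))
       \<and> (\<forall>L. bounded_linear_functional_on p (\<alpha>*p) L \<longrightarrow>
            (\<exists>h\<in>wHardy q (\<alpha>*q). \<forall>f\<in>wHardy p (\<alpha>*p). L f = pairing \<alpha> f h))"
proof -
  have "0 < 1 / p" "1 / p < 1" using assms(2) by simp_all
  then have "0 < 1 / q" "1 / q < 1" using assms(3) by linarith+
  then have q: "1 < q" by (simp add: divide_less_eq split: if_splits)
  show ?thesis
    using pairing_eq(1)[OF assms(2) q assms(3)] pairing_bounded_linear[OF assms(2) q assms(3)]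
      pairing_represents[OF assms(2) q assms(3)]
    by (simp add: set_integrable_circ)
qed

end
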